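(* Let $\alpha\in(0,1)$, $s>1$ be real and $K\geq1$ an integer. Given any nested sequence of spaces $V_1\subset\cdots\subset V_K\subset L^2(X,\rho)$, $V_k=\mathrm{span}\{\psi_1,\ldots,\psi_{n_k}\}$, with dimensions $n_1<\cdots<n_K$, if $$m_k=\tau_k n_k,\qquad \tau_k:=\left\lceil\theta^{-1}\ln\left(\frac{\zeta(s)\,n_k^{s+1}}{\alpha}\right)\right\rceil,\quad k=1,\ldots,K,$$ then (i) $\Pr\left(\bigcap_{k=1}^K\left\{\|G_k-I_k\|_2\leq\frac12\right\}\right)\geq1-\alpha$, where $G_k\in\mathbb{R}^{n_k\times n_k}$ is defined by $(G_k)_{pq}=m_k^{-1}\sum_{j=1}^{m_k}\psi_p(x^j)\psi_q(x^j)$ and $x^1,\ldots,x^{m_K}$ is a set of $m_K$ independent random samples such that for any $k=1,\ldots,K$ and any $j=1,\ldots,n_k$ the samples $x^{(j-1)\tau_k+1},\ldots,x^{j\tau_k}$ are distributed according to $\chi_j$ (such a set can be generated sequentially, recycling all samples from previous iterations, by adding at step $k$ $\tau_k-\tau_{k-1}$ new samples from $\chi_j$ for each $j\leq n_{k-1}$ and $\tau_k$ samples from $\chi_j$ for each $n_{k-1}<j\leq n_k$); (ii) if $u\in L^2(X,\rho)$ then for any $k=1,\ldots,K$, $\mathbb{E}(\|u-u_C^k\|^2)\leq\left(1+\frac{4\theta}{\ln(\zeta(s)n_k^{s+1}/\alpha)}\right)e_{n_k,2}(u)^2+\alpha\|u\|^2$.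
   Context: $X\subseteq\mathbb{R}^d$ Borel, $\rho$ a Borel probability measure, $(\psi_i)_{i\geq1}$ an orthonormal basis of $L^2(X,\rho)$ (norm $\|\cdot\|$), with the spaces such that for each $x$ some basis function in $V_1$ is nonzero at $x$. $\chi_j(A)=\int_A|\psi_j|^2d\rho$. $\theta=\frac{3\ln(3/2)-1}{2}\approx0.108$, $\zeta$ the Riemann zeta function, $I_k$ the $n_k\times n_k$ identity, $\|\cdot\|_2$ the spectral norm. For space $V_k$: weight $w_k(x)=n_k/\sum_{i=1}^{n_k}|\psi_i(x)|^2$, discrete seminorm $\|f\|_{m_k}^2=\frac1{m_k}\sum_{i=1}^{m_k}w_k(x^i)f(x^i)^2$ using the first $m_k$ samples, $u_W^k=\arg\min_{v\in V_k}\|u-v\|_{m_k}$, $u_C^k=u_W^k$ if $\|G_k-I_k\|_2\leq\frac12$ and $0$ otherwise, and $e_{n_k,2}(u)=\min_{v\in V_k}\|u-v\|$.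
   Formalization: The Gram matrix G_k carries the weight w_k(x^j) in each term (without it (i) fails); the index layout, inconsistent across k, becomes: among the first m_k samples exactly τ_k are drawn from χ_j for each j≤n_k; that such samples can be generated sequentially is not stated. *)

theory Defs
  imports "HOL-Probability.Probability"
begin

definition theta :: real where
  "theta = (3 * ln (3/2) - 1) / 2"

definition zeta_real :: "real \<Rightarrow> real" where
  "zeta_real s = (\<Sum>i. 1 / real (Suc i) powr s)"

definition L2set :: "'a measure \<Rightarrow> ('a \<Rightarrow> real) set" where
  "L2set \<rho> = {f. f \<in> borel_measurable \<rho> \<and> integrable \<rho> (\<lambda>x. (f x)^2)}"

definition L2norm :: "'a measure \<Rightarrow> ('a \<Rightarrow> real) \<Rightarrow> real" where
  "L2norm \<rho> f = sqrt (\<integral>x. (f x)^2 \<partial>\<rho>)"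

definition L2_onb :: "'a measure \<Rightarrow> (nat \<Rightarrow> 'a \<Rightarrow> real) \<Rightarrow> bool" where
  "L2_onb \<rho> \<psi> \<longleftrightarrow>
     (\<forall>i\<ge>1. \<psi> i \<in> L2set \<rho>) \<and>
     (\<forall>i\<ge>1. \<forall>j\<ge>1. (\<integral>x. \<psi> i x * \<psi> j x \<partial>\<rho>) = (if i = j then 1 else 0)) \<and>
     (\<forall>f\<in>L2set \<rho>. (\<forall>i\<ge>1. (\<integral>x. f x * \<psi> i x \<partial>\<rho>) = 0) \<longrightarrow> (AE x in \<rho>. f x = 0))"

definition chi :: "'a measure \<Rightarrow> (nat \<Rightarrow> 'a \<Rightarrow> real) \<Rightarrow> nat \<Rightarrow> 'a measure" where
  "chi \<rho> \<psi> j = density \<rho> (\<lambda>x. ennreal ((\<psi> j x)^2))"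

definition tau :: "real \<Rightarrow> real \<Rightarrow> nat \<Rightarrow> nat" where
  "tau s \<alpha> n = nat \<lceil>ln (zeta_real s * real n powr (s + 1) / \<alpha>) / theta\<rceil>"

definition msamp :: "real \<Rightarrow> real \<Rightarrow> nat \<Rightarrow> nat" where
  "msamp s \<alpha> n = tau s \<alpha> n * n"

definition wt :: "(nat \<Rightarrow> 'a \<Rightarrow> real) \<Rightarrow> nat \<Rightarrow> 'a \<Rightarrow> real" where
  "wt \<psi> n x = real n / (\<Sum>i=1..n. (\<psi> i x)^2)"

text \<open>Gram matrix (indices 1..n), built from the first m samples omega 1, ..., omega m.\<close>
definition gram :: "(nat \<Rightarrow> 'a \<Rightarrow> real) \<Rightarrow> nat \<Rightarrow> nat \<Rightarrow> (nat \<Rightarrow> 'a) \<Rightarrow> nat \<Rightarrow> nat \<Rightarrow> real" where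
  "gram \<psi> n m \<omega> p q = (1 / real m) * (\<Sum>j=1..m. wt \<psi> n (\<omega> j) * \<psi> p (\<omega> j) * \<psi> q (\<omega> j))"

definition spec_norm :: "nat \<Rightarrow> (nat \<Rightarrow> nat \<Rightarrow> real) \<Rightarrow> real" where
  "spec_norm n A = (SUP v \<in> {v. (\<Sum>j=1..n. (v j)^2) \<le> 1}.
                      sqrt (\<Sum>i=1..n. (\<Sum>j=1..n. A i j * v j)^2))"

definition idm :: "nat \<Rightarrow> nat \<Rightarrow> real" where
  "idm p q = (if p = q then 1 else 0)"

definition Vspace :: "(nat \<Rightarrow> 'a \<Rightarrow> real) \<Rightarrow> nat \<Rightarrow> ('a \<Rightarrow> real) set" where
  "Vspace \<psi> n = {(\<lambda>x. \<Sum>i=1..n. c i * \<psi> i x) | c. True}"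

definition disc_norm :: "(nat \<Rightarrow> 'a \<Rightarrow> real) \<Rightarrow> nat \<Rightarrow> nat \<Rightarrow> (nat \<Rightarrow> 'a) \<Rightarrow> ('a \<Rightarrow> real) \<Rightarrow> real" where
  "disc_norm \<psi> n m \<omega> f = sqrt ((1 / real m) * (\<Sum>i=1..m. wt \<psi> n (\<omega> i) * (f (\<omega> i))^2))"

definition uW :: "(nat \<Rightarrow> 'a \<Rightarrow> real) \<Rightarrow> nat \<Rightarrow> nat \<Rightarrow> (nat \<Rightarrow> 'a) \<Rightarrow> ('a \<Rightarrow> real) \<Rightarrow> ('a \<Rightarrow> real)" where
  "uW \<psi> n m \<omega> u = (SOME v. v \<in> Vspace \<psi> n \<and>
      (\<forall>v'\<in>Vspace \<psi> n. disc_norm \<psi> n m \<omega> (\<lambda>x. u x - v x) \<le> disc_norm \<psi> n m \<omega> (\<lambda>x. u x - v' x)))"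

definition uC :: "(nat \<Rightarrow> 'a \<Rightarrow> real) \<Rightarrow> nat \<Rightarrow> nat \<Rightarrow> (nat \<Rightarrow> 'a) \<Rightarrow> ('a \<Rightarrow> real) \<Rightarrow> ('a \<Rightarrow> real)" where
  "uC \<psi> n m \<omega> u = (if spec_norm n (\<lambda>p q. gram \<psi> n m \<omega> p q - idm p q) \<le> 1/2
                      then uW \<psi> n m \<omega> u else (\<lambda>x. 0))"

definition best_err :: "'a measure \<Rightarrow> (nat \<Rightarrow> 'a \<Rightarrow> real) \<Rightarrow> nat \<Rightarrow> ('a \<Rightarrow> real) \<Rightarrow> real" where
  "best_err \<rho> \<psi> n u = (INF v \<in> Vspace \<psi> n. L2norm \<rho> (\<lambda>x. u x - v x))"

end

theory Submission
  imports Defs "HOL-Real_Asymp.Real_Asymp"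
begin

text \<open>
  After the substitution \<open>v = \<psi>(x) / |\<psi>(x)|\<close> the matrix \<open>\<tau> G\<close> is a sum of independent rank-one projections
  \<open>v v\<^sup>T\<close> whose expectations add up to \<open>\<tau> I\<close>, because all \<open>n\<close> densities \<open>\<psi>\<^sub>j\<^sup>2\<close> are used equally often
  and the weight cancels their sum. The samples are not identically distributed, so the sharp matrix
  Chernoff bound needs Lieb's concavity of \<open>A \<mapsto> tr exp (H + log A)\<close>. Only its tangent form enters: for every
  positive \<open>C\<close> there is a matrix \<open>D\<close> with \<open>tr exp (H + log A) \<le> \<langle>D, A\<rangle>\<close> for all positive \<open>A\<close>, with equality
  at \<open>C\<close>. Taking \<open>A = exp (t v v\<^sup>T)\<close> and \<open>C\<close> its expectation, linearity bounds one sample at a time.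

  The upper and the lower tail have the rates \<open>\<theta>\<close> and \<open>(1 - ln 2) / 2 \<ge> 7/5 \<theta>\<close>. Their sum costs more than the
  budget \<open>\<alpha> / (\<zeta>(s) n\<^sup>s)\<close> of a single level, but a level with \<open>n = 1\<close> never fails, and the unused first term
  of \<open>\<zeta>(s)\<close> pays for all lower tails since \<open>\<Sum>\<^sub>n\<^sub>\<ge>\<^sub>2 n powr (-9/5) \<le> 1\<close>.

  For the error, the noise vector in the normal equations is centred, and its second moment is the squared
  best approximation error divided by \<open>\<tau>\<close>; on the good event the Gram matrix loses at most a factor \<open>4\<close>.
\<close>

subsection \<open>Spectral theorem for symmetric matrices over a finite index set\<close>

text \<open>The Golden-Thompson inequality would bound the trace by a product of norms of the single
  expected exponentials; as the \<open>chi j\<close> differ, that product can be far larger than the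
  exponential of the summed second moments, which is all that isotropy controls. Lieb's argument
  keeps the sum inside the exponential. Its tangent form comes from the relative entropy: being
  jointly convex and homogeneous of degree one, it lies above its linearisation, and that
  linearisation has no constant term. No matrix-valued exponential or logarithm is defined; matrix
  functions are written through eigenbases, with eigenvectors as rows. Both rates are values of
  \<open>exp t - 1 - x * t\<close> at the minimiser \<open>t = ln x\<close>: \<open>x = 3/2\<close>
  gives \<open>- theta\<close>, and \<open>x = 1/2\<close> gives \<open>- (1 - ln 2) / 2\<close>.
  The recycling of samples is encoded by a single labelling: what matters is how often each label
  occurs among the first samples of a level, not their order, so all levels live on one product
  space.\<close>

definition orthobasis :: "'i set \<Rightarrow> ('i \<Rightarrow> 'i \<Rightarrow> real) \<Rightarrow> bool" where
  "orthobasis I e \<longleftrightarrow>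
     (\<forall>k\<in>I. \<forall>l\<in>I. (\<Sum>i\<in>I. e k i * e l i) = (if k = l then 1 else 0)) \<and>
     (\<forall>i\<in>I. \<forall>j\<in>I. (\<Sum>k\<in>I. e k i * e k j) = (if i = j then 1 else 0))"

text \<open>The symmetric matrix with eigenvectors \<open>e k\<close> and eigenvalues
  \<open>l k\<close>; a function of it is obtained by changing \<open>l\<close> and keeping
  \<open>e\<close>.\<close>

definition spec_mat :: "'i set \<Rightarrow> ('i \<Rightarrow> 'i \<Rightarrow> real) \<Rightarrow> ('i \<Rightarrow> real) \<Rightarrow> 'i \<Rightarrow> 'i \<Rightarrow> real" where
  "spec_mat I e l i j = (\<Sum>k\<in>I. l k * e k i * e k j)"

definition bilin :: "'i set \<Rightarrow> ('i \<Rightarrow> 'i \<Rightarrow> real) \<Rightarrow> ('i \<Rightarrow> real) \<Rightarrow> ('i \<Rightarrow> real) \<Rightarrow> real" where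
  "bilin I S x y = (\<Sum>i\<in>I. \<Sum>j\<in>I. x i * S i j * y j)"

lemma orthobasis_rows:
  "orthobasis I e \<Longrightarrow> k \<in> I \<Longrightarrow> l \<in> I \<Longrightarrow> (\<Sum>i\<in>I. e k i * e l i) = (if k = l then 1 else 0)"
  by (simp add: orthobasis_def)

lemma orthobasis_cols:
  "orthobasis I e \<Longrightarrow> i \<in> I \<Longrightarrow> j \<in> I \<Longrightarrow> (\<Sum>k\<in>I. e k i * e k j) = (if i = j then 1 else 0)"
  by (simp add: orthobasis_def)

lemma orthobasis_transpose: "orthobasis I e \<longleftrightarrow> orthobasis I (\<lambda>i k. e k i)"
  by (auto simp: orthobasis_def)

lemma sum_delta_mult_left:
  fixes f :: "'i \<Rightarrow> real"
  assumes "finite I" "i \<in> I"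
  shows "(\<Sum>j\<in>I. (if i = j then 1 else 0) * f j) = f i"
  using assms by (simp add: if_distrib[of "\<lambda>x. x * _"] sum.delta cong: if_cong)

lemma orthobasis_expand:
  assumes "finite I" "orthobasis I e" "i \<in> I"
  shows "(\<Sum>k\<in>I. e k i * (\<Sum>j\<in>I. e k j * x j)) = x i"
proof -
  have "(\<Sum>k\<in>I. e k i * (\<Sum>j\<in>I. e k j * x j)) = (\<Sum>j\<in>I. (\<Sum>k\<in>I. e k i * e k j) * x j)"
    unfolding sum_distrib_left sum_distrib_right by (subst sum.swap) (simp add: mult_ac)
  also have "\<dots> = (\<Sum>j\<in>I. (if i = j then 1 else 0) * x j)"
    using assms by (intro sum.cong) (auto simp: orthobasis_cols)
  finally show ?thesis using assms sum_delta_mult_left by metis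
qed

lemma parseval:
  assumes "finite I" "orthobasis I e"
  shows "(\<Sum>k\<in>I. (\<Sum>i\<in>I. e k i * x i) * (\<Sum>j\<in>I. e k j * y j)) = (\<Sum>i\<in>I. x i * y i)"
proof -
  have "(\<Sum>k\<in>I. (\<Sum>i\<in>I. e k i * x i) * (\<Sum>j\<in>I. e k j * y j))
      = (\<Sum>k\<in>I. \<Sum>i\<in>I. x i * (e k i * (\<Sum>j\<in>I. e k j * y j)))"
    by (simp add: sum_distrib_right mult_ac)
  also have "\<dots> = (\<Sum>i\<in>I. x i * (\<Sum>k\<in>I. e k i * (\<Sum>j\<in>I. e k j * y j)))"
    by (subst sum.swap) (simp add: sum_distrib_left)
  also have "\<dots> = (\<Sum>i\<in>I. x i * y i)"
    using assms by (intro sum.cong) (auto simp: orthobasis_expand)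
  finally show ?thesis .
qed

lemma orthobasis_bounded:
  assumes "finite I" "orthobasis I e" "k \<in> I" "i \<in> I"
  shows "\<bar>e k i\<bar> \<le> 1"
proof -
  have "(e k i)^2 \<le> (\<Sum>j\<in>I. (e k j)^2)"
    using assms by (intro member_le_sum) auto
  also have "\<dots> = 1" using orthobasis_rows[OF assms(2,3,3)] by (simp add: power2_eq_square)
  finally show ?thesis by (simp add: abs_square_le_1)
qed

lemma orthobasis_id: "finite I \<Longrightarrow> orthobasis I (\<lambda>i j. if i = j then 1 else 0)"
  by (auto simp: orthobasis_def if_distrib[of "\<lambda>x. x * _"] sum.delta sum.delta' cong: if_cong)

lemma sum_split_two:
  fixes f :: "'i \<Rightarrow> real"
  assumes "finite I" "p \<in> I" "q \<in> I" "p \<noteq> q"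
  shows "sum f I = f p + f q + sum f (I - {p, q})"
proof -
  have "sum f I = f p + sum f (I - {p})" using assms by (simp add: sum.remove)
  also have "sum f (I - {p}) = f q + sum f (I - {p} - {q})" using assms by (intro sum.remove) auto
  also have "I - {p} - {q} = I - {p, q}" by auto
  finally show ?thesis by simp
qed

text \<open>Rotation in the plane of the rows \<open>p\<close> and \<open>q\<close>, parametrised by
  the tangent \<open>u\<close> of the angle: after squaring, the normalisation is the rational
  factor \<open>1 / (1 + u^2)\<close>, so optimality becomes a polynomial condition in
  \<open>u\<close>.\<close>

definition rot :: "'i \<Rightarrow> 'i \<Rightarrow> real \<Rightarrow> ('i \<Rightarrow> 'i \<Rightarrow> real) \<Rightarrow> 'i \<Rightarrow> 'i \<Rightarrow> real" where
  "rot p q u e k i = (if k = p then (e p i + u * e q i) / sqrt (1 + u\<^sup>2)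
     else if k = q then (e q i - u * e p i) / sqrt (1 + u\<^sup>2) else e k i)"

lemma orthobasis_rot:
  assumes I: "finite I" "p \<in> I" "q \<in> I" "p \<noteq> q" and e: "orthobasis I e"
  shows "orthobasis I (rot p q u e)"
proof -
  have pos: "1 + u\<^sup>2 > 0" by (simp add: add_pos_nonneg)
  note R = orthobasis_rows[OF e]
  have lin: "(\<Sum>i\<in>I. (a * x i + b * y i) * (c * z i + d * w i)) =
      a * c * (\<Sum>i\<in>I. x i * z i) + a * d * (\<Sum>i\<in>I. x i * w i) + b * c * (\<Sum>i\<in>I. y i * z i)
      + b * d * (\<Sum>i\<in>I. y i * w i)" for a b c d :: real and x y z w
    unfolding sum_distrib_left sum.distrib[symmetric] by (intro sum.cong) (auto simp: algebra_simps)
  have lin1: "(\<Sum>i\<in>I. (a * x i + b * y i) * z i) =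
      a * (\<Sum>i\<in>I. x i * z i) + b * (\<Sum>i\<in>I. y i * z i)" for a b :: real and x y z
    using lin[of a x b y 1 z 0 z] by simp
  define c where "c = 1 / sqrt (1 + u\<^sup>2)"
  have c2: "c * c * (1 + u\<^sup>2) = 1" using pos by (simp add: c_def field_simps)
  have rp: "rot p q u e p = (\<lambda>i. c * e p i + (c * u) * e q i)"
    by (auto simp: fun_eq_iff rot_def c_def add_divide_distrib diff_divide_distrib)
  have rq: "rot p q u e q = (\<lambda>i. (- (c * u)) * e p i + c * e q i)"
    using I by (auto simp: fun_eq_iff rot_def c_def add_divide_distrib diff_divide_distrib)
  have ro: "rot p q u e k = e k" if "k \<noteq> p" "k \<noteq> q" for k
    using that by (auto simp: rot_def)
  have c2': "c * c + (c * u) * (c * u) = 1" using c2 by (simp add: algebra_simps power2_eq_square)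
  have npq: "q \<noteq> p" using I by simp
  have G1: "(\<Sum>i\<in>I. (a * e p i + b * e q i) * (a' * e p i + b' * e q i)) = a * a' + b * b'" for a b a' b'
    unfolding lin using I npq by (simp add: R)
  have G2: "(\<Sum>i\<in>I. (a * e p i + b * e q i) * e k i) = 0" if "k \<in> I" "k \<noteq> p" "k \<noteq> q" for a b k
    unfolding lin1 using I that by (simp add: R)
  have G3: "(\<Sum>i\<in>I. e k i * (a * e p i + b * e q i)) = 0" if "k \<in> I" "k \<noteq> p" "k \<noteq> q" for a b k
    using G2[OF that] by (simp add: mult.commute)
  have rows: "(\<Sum>i\<in>I. rot p q u e k i * rot p q u e l i) = (if k = l then 1 else 0)"
    if kl: "k \<in> I" "l \<in> I" for k l
  proof -
    consider "k = p" | "k = q" | "k \<noteq> p" "k \<noteq> q" by blast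
    then show ?thesis
    proof cases
      case 1
      consider "l = p" | "l = q" | "l \<noteq> p" "l \<noteq> q" by blast
      then show ?thesis using 1 kl I c2' npq
        by cases (simp_all only: rp rq ro G1 G2 simp_thms if_False if_True, simp_all)
    next
      case 2
      consider "l = p" | "l = q" | "l \<noteq> p" "l \<noteq> q" by blast
      then show ?thesis using 2 kl I c2' npq
        by cases (simp_all only: rp rq ro G1 G2 simp_thms if_False if_True, simp_all)
    next
      case 3
      consider "l = p" | "l = q" | "l \<noteq> p" "l \<noteq> q" by blast
      then show ?thesis using 3 kl I
        by cases (simp_all only: rp rq ro G3 R simp_thms if_False)
    qed
  qed
  have cols: "(\<Sum>k\<in>I. rot p q u e k i * rot p q u e k j) = (if i = j then 1 else 0)"
    if ij: "i \<in> I" "j \<in> I" for i j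
  proof -
    have "(\<Sum>k\<in>I. rot p q u e k i * rot p q u e k j) =
      rot p q u e p i * rot p q u e p j + rot p q u e q i * rot p q u e q j
        + (\<Sum>k\<in>I - {p,q}. rot p q u e k i * rot p q u e k j)"
      using I by (rule sum_split_two)
    also have "(\<Sum>k\<in>I - {p,q}. rot p q u e k i * rot p q u e k j) = (\<Sum>k\<in>I - {p,q}. e k i * e k j)"
      by (intro sum.cong) (auto simp: ro)
    also have "rot p q u e p i * rot p q u e p j + rot p q u e q i * rot p q u e q j
        = (c * c + (c*u)*(c*u)) * (e p i * e p j + e q i * e q j)"
      unfolding rp rq by (simp add: algebra_simps)
    also have "\<dots> + (\<Sum>k\<in>I - {p,q}. e k i * e k j) = (\<Sum>k\<in>I. e k i * e k j)"
      unfolding c2' using I by (subst (2) sum_split_two[of _ p q]) auto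
    also have "\<dots> = (if i = j then 1 else 0)" using e ij by (rule orthobasis_cols)
    finally show ?thesis .
  qed
  show ?thesis using rows cols unfolding orthobasis_def by blast
qed

text \<open>Compactness: orthonormality is a closed condition that bounds all entries by 1, and the
  objective is continuous in the entries.\<close>

lemma exists_optimal_orthobasis:
  assumes "finite I"
  shows "\<exists>e. orthobasis I e \<and>
    (\<forall>e'. orthobasis I e' \<longrightarrow> (\<Sum>k\<in>I. w k * bilin I S (e' k) (e' k)) \<le> (\<Sum>k\<in>I. w k * bilin I S (e k) (e k)))"
proof -
  define C :: "('a \<times> 'a \<Rightarrow> real) set" where
    "C = (PiE UNIV (\<lambda>_. {-1..1})) \<inter> {E. orthobasis I (curry E)}"
  define F where "F = (\<lambda>E :: 'a \<times> 'a \<Rightarrow> real. \<Sum>k\<in>I. w k * bilin I S (curry E k) (curry E k))"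
  \<comment> \<open>The index type may be infinite, so matrices are points of a product over all
    pairs of indices, and the cube is compact by Tychonoff's theorem.\<close>
  have "compactin (product_topology (\<lambda>_::'a\<times>'a. euclidean :: real topology) UNIV) (PiE UNIV (\<lambda>_. {-1..1}))"
    by (subst compactin_PiE) auto
  then have c1: "compact (PiE UNIV (\<lambda>_. {-1..1}) :: ('a \<times> 'a \<Rightarrow> real) set)"
    by (simp add: euclidean_product_topology)
  have cont: "continuous_on UNIV (\<lambda>E :: 'a \<times> 'a \<Rightarrow> real. E p)" for p
    by simp
  have closed: "closed {E :: 'a \<times> 'a \<Rightarrow> real. orthobasis I (curry E)}"
    unfolding orthobasis_def curry_def Ball_def
    by (intro closed_Collect_conj closed_Collect_all closed_Collect_imp closed_Collect_eq continuous_intros cont) auto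
  have comp: "compact C" unfolding C_def using c1 closed by (rule compact_Int_closed)
  have id_in: "(\<lambda>(i,j). if i = j then 1 else 0) \<in> C"
    using orthobasis_id[OF assms] by (auto simp: C_def curry_def)
  have "continuous_on C F"
    unfolding F_def bilin_def curry_def
    by (intro continuous_intros continuous_on_subset[OF cont]) auto
  then obtain E where E: "E \<in> C" "\<And>E'. E' \<in> C \<Longrightarrow> F E' \<le> F E"
    using continuous_attains_sup[OF comp] id_in by blast
  show ?thesis
  proof (intro exI[of _ "curry E"] conjI allI impI)
    show "orthobasis I (curry E)" using E(1) by (simp add: C_def)
    fix e' assume e': "orthobasis I e'"
    \<comment> \<open>\<open>orthobasis\<close> does not restrict entries outside \<open>I\<close>;
      zeroing them moves any competitor into the cube without changing its objective.\<close>
    define E' where "E' = (\<lambda>(k,i). if k \<in> I \<and> i \<in> I then e' k i else 0)"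
    have "E' \<in> C" using e' orthobasis_bounded[OF assms e']
      by (auto simp: C_def E'_def orthobasis_def curry_def abs_le_iff minus_le_iff cong: sum.cong)
    then have "F E' \<le> F E" by (rule E(2))
    moreover have "F E' = (\<Sum>k\<in>I. w k * bilin I S (e' k) (e' k))"
      unfolding F_def bilin_def by (intro sum.cong arg_cong2[of _ _ _ _ "(*)"]) (auto simp: E'_def)
    ultimately show "(\<Sum>k\<in>I. w k * bilin I S (e' k) (e' k)) \<le> (\<Sum>k\<in>I. w k * bilin I S (curry E k) (curry E k))"
      by (simp add: F_def)
  qed
qed

lemma bilin_cong:
  "(\<And>i. i \<in> I \<Longrightarrow> x i = x' i) \<Longrightarrow> (\<And>i. i \<in> I \<Longrightarrow> y i = y' i) \<Longrightarrow>
   (\<And>i j. i \<in> I \<Longrightarrow> j \<in> I \<Longrightarrow> S i j = S' i j) \<Longrightarrow> bilin I S x y = bilin I S' x' y'"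
  unfolding bilin_def by (intro sum.cong) auto

lemma bilin_sym:
  assumes "\<And>i j. i \<in> I \<Longrightarrow> j \<in> I \<Longrightarrow> S i j = S j i"
  shows "bilin I S x y = bilin I S y x"
  unfolding bilin_def by (subst sum.swap) (intro sum.cong, auto simp: mult_ac assms)

lemma bilin_add_left: "bilin I S (\<lambda>i. a * x i + b * y i) z = a * bilin I S x z + b * bilin I S y z"
  unfolding bilin_def sum_distrib_left sum.distrib[symmetric]
  by (intro sum.cong) (auto simp: algebra_simps)

lemma bilin_add_right: "bilin I S z (\<lambda>i. a * x i + b * y i) = a * bilin I S z x + b * bilin I S z y"
  unfolding bilin_def sum_distrib_left sum.distrib[symmetric]
  by (intro sum.cong) (auto simp: algebra_simps)

text \<open>First-order condition at a maximum. The witness \<open>a / (|d| + 1)\<close> is small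
  enough for the linear term to beat the quadratic one.\<close>

lemma linear_coeff_zero:
  fixes a d :: real
  assumes "\<And>u. 2 * u * a + u\<^sup>2 * d \<le> 0"
  shows "a = 0"
proof (rule ccontr)
  assume a: "a \<noteq> 0"
  define u where "u = a / (\<bar>d\<bar> + 1)"
  have "u * (2 * a + u * d) \<le> 0" using assms[of u] by (simp add: algebra_simps power2_eq_square)
  moreover have "u * (2 * a + u * d) = a\<^sup>2 * (2 * (\<bar>d\<bar> + 1) + d) / (\<bar>d\<bar> + 1)\<^sup>2"
    by (simp add: u_def power2_eq_square) (simp add: field_simps)
  moreover have "a\<^sup>2 * (2 * (\<bar>d\<bar> + 1) + d) / (\<bar>d\<bar> + 1)\<^sup>2 > 0"
    using a by (intro divide_pos_pos mult_pos_pos) (auto simp: abs_if)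
  ultimately show False by linarith
qed

text \<open>
  A basis maximising \<open>\<Sum>\<^sub>k w\<^sub>k \<langle>e\<^sub>k, S e\<^sub>k\<rangle>\<close> with distinct weights diagonalises \<open>S\<close>: a nonzero off-diagonal entry would
  allow an improving plane rotation.
\<close>

theorem spectral_theorem:
  assumes I: "finite I" and sym: "\<And>i j. i \<in> I \<Longrightarrow> j \<in> I \<Longrightarrow> S i j = S j i"
  shows "\<exists>e l. orthobasis I e \<and> (\<forall>i\<in>I. \<forall>j\<in>I. S i j = spec_mat I e l i j)"
proof -
  obtain f :: "'a \<Rightarrow> nat" where f: "inj_on f I"
    using finite_imp_inj_to_nat_seg[OF I] by blast
  define w where "w k = real (f k)" for k
  obtain e where e: "orthobasis I e"
    and opt: "\<And>e'. orthobasis I e' \<Longrightarrow>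
      (\<Sum>k\<in>I. w k * bilin I S (e' k) (e' k)) \<le> (\<Sum>k\<in>I. w k * bilin I S (e k) (e k))"
    using exists_optimal_orthobasis[OF I, of w S] by blast
  let ?B = "\<lambda>k l. bilin I S (e k) (e l)"
  have Bsym: "?B k l = ?B l k" for k l using sym by (rule bilin_sym)
  have offdiag: "?B p q = 0" if pq: "p \<in> I" "q \<in> I" "p \<noteq> q" for p q
  proof -
    \<comment> \<open>Optimality against the rotation by \<open>u\<close>, with the denominator
      \<open>1 + u^2\<close> cleared. The linear coefficient is the off-diagonal entry times the
      difference of two weights, which is nonzero because \<open>f\<close> is injective.\<close>
    have "2 * u * ((w p - w q) * ?B p q) + u\<^sup>2 * ((w p - w q) * (?B q q - ?B p p)) \<le> 0" for u
    proof -
      let ?e = "rot p q u e"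
      have pos: "1 + u\<^sup>2 > 0" by (simp add: add_pos_nonneg)
      define c where "c = 1 / sqrt (1 + u\<^sup>2)"
      have c2: "c * c = 1 / (1 + u\<^sup>2)" using pos by (simp add: c_def field_simps)
      have rp: "?e p = (\<lambda>i. c * e p i + (c * u) * e q i)"
        by (auto simp: fun_eq_iff rot_def c_def add_divide_distrib diff_divide_distrib)
      have rq: "?e q = (\<lambda>i. (- (c * u)) * e p i + c * e q i)"
        using pq by (auto simp: fun_eq_iff rot_def c_def add_divide_distrib diff_divide_distrib)
      have "(\<Sum>k\<in>I. w k * bilin I S (?e k) (?e k)) \<le> (\<Sum>k\<in>I. w k * ?B k k)"
        using opt orthobasis_rot[OF I pq e] by blast
      moreover have "(\<Sum>k\<in>I - {p,q}. w k * bilin I S (?e k) (?e k)) = (\<Sum>k\<in>I - {p,q}. w k * ?B k k)"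
        by (intro sum.cong arg_cong2[of _ _ _ _ "(*)"] bilin_cong) (auto simp: rot_def)
      ultimately have "w p * bilin I S (?e p) (?e p) + w q * bilin I S (?e q) (?e q)
          \<le> w p * ?B p p + w q * ?B q q"
        by (simp add: sum_split_two[OF I pq])
      moreover have "bilin I S (?e p) (?e p) = (c * c) * (?B p p + 2 * u * ?B p q + u\<^sup>2 * ?B q q)"
        unfolding rp bilin_add_left bilin_add_right Bsym[of q p]
        by (simp add: algebra_simps power2_eq_square)
      moreover have "bilin I S (?e q) (?e q) = (c * c) * (?B q q - 2 * u * ?B p q + u\<^sup>2 * ?B p p)"
        unfolding rq bilin_add_left bilin_add_right Bsym[of q p]
        by (simp add: algebra_simps power2_eq_square)
      ultimately have "w p * ((?B p p + 2 * u * ?B p q + u\<^sup>2 * ?B q q) / (1 + u\<^sup>2))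
        + w q * ((?B q q - 2 * u * ?B p q + u\<^sup>2 * ?B p p) / (1 + u\<^sup>2)) \<le> w p * ?B p p + w q * ?B q q"
        by (simp add: c2)
      then have "w p * (?B p p + 2 * u * ?B p q + u\<^sup>2 * ?B q q)
        + w q * (?B q q - 2 * u * ?B p q + u\<^sup>2 * ?B p p) \<le> (w p * ?B p p + w q * ?B q q) * (1 + u\<^sup>2)"
        using pos by (simp add: add_divide_distrib[symmetric] pos_divide_le_eq)
      then show ?thesis by (simp add: algebra_simps)
    qed
    then have "(w p - w q) * ?B p q = 0" by (rule linear_coeff_zero)
    moreover have "w p \<noteq> w q" using f pq by (auto simp: w_def inj_on_def)
    ultimately show ?thesis by simp
  qed
  have "S i j = spec_mat I e (\<lambda>k. ?B k k) i j" if ij: "i \<in> I" "j \<in> I" for i j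
  proof -
    have "S i j = (\<Sum>k\<in>I. e k i * (\<Sum>i'\<in>I. e k i' * S i' j))"
      using orthobasis_expand[OF I e ij(1), of "\<lambda>i. S i j"] by simp
    also have "\<dots> = (\<Sum>k\<in>I. e k i * (\<Sum>i'\<in>I. e k i' * (\<Sum>l\<in>I. e l j * (\<Sum>j'\<in>I. e l j' * S i' j'))))"
      using orthobasis_expand[OF I e ij(2)] by (intro sum.cong arg_cong2[of _ _ _ _ "(*)"]) auto
    also have "\<dots> = (\<Sum>k\<in>I. e k i * (\<Sum>l\<in>I. e l j * ?B k l))"
    proof (rule sum.cong[OF refl])
      fix k
      have "(\<Sum>i'\<in>I. e k i' * (\<Sum>l\<in>I. e l j * (\<Sum>j'\<in>I. e l j' * S i' j')))
        = (\<Sum>i'\<in>I. \<Sum>l\<in>I. e l j * (\<Sum>j'\<in>I. e k i' * S i' j' * e l j'))"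
        by (simp add: sum_distrib_left mult_ac)
      also have "\<dots> = (\<Sum>l\<in>I. e l j * ?B k l)"
        by (subst sum.swap) (simp add: bilin_def sum_distrib_left)
      finally show "e k i * (\<Sum>i'\<in>I. e k i' * (\<Sum>l\<in>I. e l j * (\<Sum>j'\<in>I. e l j' * S i' j')))
        = e k i * (\<Sum>l\<in>I. e l j * ?B k l)" by simp
    qed
    also have "\<dots> = (\<Sum>k\<in>I. e k i * (\<Sum>l\<in>I. if k = l then e k j * ?B k k else 0))"
      using offdiag by (intro sum.cong arg_cong2[of _ _ _ _ "(*)"]) auto
    also have "\<dots> = spec_mat I e (\<lambda>k. ?B k k) i j"
      using I by (simp add: spec_mat_def mult_ac)
    finally show ?thesis .
  qed
  then show ?thesis using e by blast
qed

subsection \<open>Tangent inequality for the relative entropy\<close>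

text \<open>First divided difference of \<open>ln\<close>; on eigenvalues it is the kernel of the
  derivative of the matrix logarithm (Daleckii-Krein formula).\<close>

definition log_slope :: "real \<Rightarrow> real \<Rightarrow> real" where
  "log_slope x y = (if x = y then 1 / x else (ln x - ln y) / (x - y))"

text \<open>
  Primitives in \<open>s\<close> of \<open>b/(s b + c) \<cdot> b/(s b + c')\<close> and of
  \<open>b/(s b + c) + b'/(s b' + c) - s \<cdot> b/(s b + c) \<cdot> b'/(s b' + c)\<close>.
\<close>

definition primA :: "real \<Rightarrow> real \<Rightarrow> real \<Rightarrow> real \<Rightarrow> real" where
  "primA b c c' s = (if c = c' then - b / (s * b + c)
     else b / (c' - c) * (ln (s * b + c) - ln (s * b + c')))"

definition primB :: "real \<Rightarrow> real \<Rightarrow> real \<Rightarrow> real \<Rightarrow> real" where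
  "primB b b' c s = (if b = b' then ln (s * b + c) - c / (s * b + c)
     else (b * ln (s * b + c) - b' * ln (s * b' + c)) / (b - b'))"

text \<open>First divided difference of \<open>x * ln x\<close>; it is the part depending on
  \<open>b\<close> and \<open>b'\<close> in the limit of the increment of \<open>primB\<close>, once
  \<open>ln (1 + s)\<close> is subtracted.\<close>

definition limB :: "real \<Rightarrow> real \<Rightarrow> real" where
  "limB b b' = (if b = b' then ln b + 1 else (b * ln b - b' * ln b') / (b - b'))"

lemma primA_deriv:
  assumes "b > 0" "c > 0" "c' > 0" "s \<ge> 0"
  shows "(primA b c c' has_real_derivative (b / (s * b + c)) * (b / (s * b + c'))) (at s)"
proof -
  have p: "s * b + c > 0" "s * b + c' > 0" using assms by (auto intro: add_nonneg_pos)
  show ?thesis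
  proof (cases "c = c'")
    case True
    show ?thesis unfolding primA_def[abs_def] using p True
      by (auto intro!: derivative_eq_intros simp: power2_eq_square)
  next
    case False
    have "b / (s * b + c) - b / (s * b + c') = b * (c' - c) / ((s * b + c) * (s * b + c'))"
      using p by (simp add: divide_simps) (simp add: algebra_simps)
    then have "b / (c' - c) * (b / (s * b + c) - b / (s * b + c')) =
        b / (c' - c) * (b * (c' - c) / ((s * b + c) * (s * b + c')))" by (rule arg_cong)
    also have "\<dots> = (b / (s * b + c)) * (b / (s * b + c'))"
      using False by simp
    finally have eq: "b / (c' - c) * (b / (s * b + c) - b / (s * b + c')) = (b / (s * b + c)) * (b / (s * b + c'))" .
    have "((\<lambda>s. b / (c' - c) * (ln (s * b + c) - ln (s * b + c'))) has_real_derivative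
      b / (c' - c) * (b / (s * b + c) - b / (s * b + c'))) (at s)"
      using p False by (auto intro!: derivative_eq_intros)
    then show ?thesis unfolding primA_def[abs_def] eq using False by simp
  qed
qed

lemma primB_deriv:
  assumes "b > 0" "b' > 0" "c > 0" "s \<ge> 0"
  shows "(primB b b' c has_real_derivative
     b / (s * b + c) + b' / (s * b' + c) - s * (b / (s * b + c)) * (b' / (s * b' + c))) (at s)"
proof -
  have p: "s * b + c > 0" "s * b' + c > 0" using assms by (auto intro: add_nonneg_pos)
  show ?thesis
  proof (cases "b = b'")
    case True
    have eq: "b / (s * b + c) + c * b / (s * b + c)^2 =
      b / (s * b + c) + b / (s * b + c) - s * (b / (s * b + c)) * (b / (s * b + c))"
      using p by (simp add: divide_simps) (simp add: algebra_simps power2_eq_square)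
    have "((\<lambda>s. ln (s * b + c) - c / (s * b + c)) has_real_derivative
       b / (s * b + c) + c * b / (s * b + c)^2) (at s)"
      using p by (auto intro!: derivative_eq_intros simp: power2_eq_square)
    then show ?thesis unfolding primB_def[abs_def] using True eq by simp
  next
    case False
    have eq: "(b * (b / (s * b + c)) - b' * (b' / (s * b' + c))) / (b - b') =
      b / (s * b + c) + b' / (s * b' + c) - s * (b / (s * b + c)) * (b' / (s * b' + c))"
      using p False by (simp add: divide_simps) (simp add: algebra_simps)
    have "((\<lambda>s. (b * ln (s * b + c) - b' * ln (s * b' + c)) / (b - b')) has_real_derivative
      (b * (b / (s * b + c)) - b' * (b' / (s * b' + c))) / (b - b')) (at s)"
      using p False by (auto intro!: derivative_eq_intros)
    then show ?thesis unfolding primB_def[abs_def] eq using False by simp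
  qed
qed

lemma primA_0: "c > 0 \<Longrightarrow> c' > 0 \<Longrightarrow> primA b c c' 0 = - (b * log_slope c c')"
  by (auto simp: primA_def log_slope_def divide_simps) (auto simp: algebra_simps)

text \<open>The logarithms in the primitives diverge; \<open>ln (1 + s)\<close> is a common
  divergent part that does not depend on the eigenvalues.\<close>

lemma ln_affine_limit:
  fixes b c :: real
  assumes "b > 0" "c > 0"
  shows "((\<lambda>s. ln (s * b + c) - ln (1 + s)) \<longlongrightarrow> ln b) at_top"
proof -
  have "((\<lambda>s. b + (c - b) / (1 + s)) \<longlongrightarrow> b + 0) at_top"
    by (intro tendsto_intros) real_asymp
  then have "((\<lambda>s. ln (b + (c - b) / (1 + s))) \<longlongrightarrow> ln b) at_top"
    using assms by (auto intro!: tendsto_ln)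
  moreover have "eventually (\<lambda>s. ln (b + (c - b) / (1 + s)) = ln (s * b + c) - ln (1 + s)) at_top"
    using eventually_ge_at_top[of 0]
  proof eventually_elim
    case (elim s)
    have "s * b + c > 0" using elim assms by (intro add_nonneg_pos mult_nonneg_nonneg) auto
    moreover have "b + (c - b) / (1 + s) = (s * b + c) / (1 + s)"
      using elim by (simp add: divide_simps) (simp add: algebra_simps)
    ultimately show ?case using elim by (simp add: ln_div)
  qed
  ultimately show ?thesis by (rule Lim_transform_eventually)
qed

lemma primA_limit:
  assumes "b > 0" "c > 0" "c' > 0"
  shows "(primA b c c' \<longlongrightarrow> 0) at_top"
proof (cases "c = c'")
  case True
  have "((\<lambda>s. - b / (s * b + c)) \<longlongrightarrow> 0) at_top" using assms by real_asymp
  then show ?thesis using True by (simp add: primA_def[abs_def])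
next
  case False
  have "((\<lambda>s. b / (c' - c) * ((ln (s * b + c) - ln (1 + s)) - (ln (s * b + c') - ln (1 + s)))) \<longlongrightarrow>
     b / (c' - c) * (ln b - ln b)) at_top"
    by (intro tendsto_intros ln_affine_limit assms)
  then show ?thesis using False by (simp add: primA_def[abs_def])
qed

lemma primB_limit:
  assumes "b > 0" "b' > 0" "c > 0"
  shows "((\<lambda>s. primB b b' c s - primB b b' c 0 - ln (1 + s)) \<longlongrightarrow> limB b b' - ln c) at_top"
proof (cases "b = b'")
  case True
  have "((\<lambda>s. c / (s * b + c)) \<longlongrightarrow> 0) at_top" using assms by real_asymp
  then have "((\<lambda>s. (ln (s * b + c) - ln (1 + s)) - c / (s * b + c) - (ln c - 1)) \<longlongrightarrow> ln b - 0 - (ln c - 1)) at_top"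
    by (intro tendsto_intros ln_affine_limit assms)
  then show ?thesis using True assms
    by (simp add: primB_def[abs_def] limB_def algebra_simps)
next
  case False
  have "((\<lambda>s. (b * (ln (s * b + c) - ln (1 + s)) - b' * (ln (s * b' + c) - ln (1 + s))) / (b - b') - ln c)
     \<longlongrightarrow> (b * ln b - b' * ln b') / (b - b') - ln c) at_top"
    using False by (intro tendsto_intros ln_affine_limit assms) auto
  moreover have "(b * (L - x) - b' * (L' - x)) / (b - b') - l = (b * L - b' * L') / (b - b') - l - x" for L L' x l :: real
    using False by (simp add: divide_simps) (simp add: algebra_simps)
  moreover have "(b * l - b' * l) / (b - b') = l" for l :: real
    using False by (simp add: left_diff_distrib[symmetric])
  ultimately show ?thesis using False by (simp add: primB_def[abs_def] limB_def)
qed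

lemma congruence_sum:
  fixes p :: "'i \<Rightarrow> 'i \<Rightarrow> real"
  shows "(\<Sum>k\<in>I. t k * (\<Sum>j\<in>I. (\<Sum>i\<in>I. p k i * x i j) * (\<Sum>i\<in>I. p k i * y i j)))
    = (\<Sum>i\<in>I. \<Sum>i'\<in>I. (\<Sum>k\<in>I. t k * p k i * p k i') * (\<Sum>j\<in>I. x i j * y i' j))"
proof -
  have "(\<Sum>k\<in>I. t k * (\<Sum>j\<in>I. (\<Sum>i\<in>I. p k i * x i j) * (\<Sum>i\<in>I. p k i * y i j)))
    = (\<Sum>k\<in>I. \<Sum>j\<in>I. \<Sum>i\<in>I. \<Sum>i'\<in>I. t k * p k i * p k i' * (x i j * y i' j))"
    by (subst sum_distrib_left, intro sum.cong refl, subst sum_product)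
       (simp add: sum_distrib_left mult_ac)
  also have "\<dots> = (\<Sum>k\<in>I. \<Sum>i\<in>I. \<Sum>i'\<in>I. \<Sum>j\<in>I. t k * p k i * p k i' * (x i j * y i' j))"
    by (rule sum.cong[OF refl]) (subst sum.swap, rule sum.cong[OF refl], rule sum.swap)
  also have "\<dots> = (\<Sum>i\<in>I. \<Sum>i'\<in>I. \<Sum>k\<in>I. \<Sum>j\<in>I. t k * p k i * p k i' * (x i j * y i' j))"
    by (subst sum.swap) (rule sum.cong[OF refl], rule sum.swap)
  also have "\<dots> = (\<Sum>i\<in>I. \<Sum>i'\<in>I. (\<Sum>k\<in>I. t k * p k i * p k i') * (\<Sum>j\<in>I. x i j * y i' j))"
    by (simp add: sum_product)
  finally show ?thesis .
qed

text \<open>Both sides are the trace of \<open>T x y^T\<close>, where \<open>T\<close> has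
  eigenvectors \<open>p k\<close> and eigenvalues \<open>t k\<close>; the change of basis
  \<open>q\<close> on the other side drops out by Parseval.\<close>

lemma conj_sum_rows:
  fixes p q :: "'i \<Rightarrow> 'i \<Rightarrow> real"
  assumes "finite I" "orthobasis I q"
  shows "(\<Sum>k\<in>I. \<Sum>l\<in>I. t k * ((\<Sum>i\<in>I. \<Sum>j\<in>I. p k i * x i j * q l j) * (\<Sum>i\<in>I. \<Sum>j\<in>I. p k i * y i j * q l j)))
    = (\<Sum>i\<in>I. \<Sum>i'\<in>I. (\<Sum>k\<in>I. t k * p k i * p k i') * (\<Sum>j\<in>I. x i j * y i' j))"
proof -
  have sw: "(\<Sum>i\<in>I. \<Sum>j\<in>I. p k i * x i j * q l j) = (\<Sum>j\<in>I. q l j * (\<Sum>i\<in>I. p k i * x i j))" for k l x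
    by (subst sum.swap) (simp add: sum_distrib_left mult_ac)
  show ?thesis
    unfolding sw sum_distrib_left[symmetric] parseval[OF assms] congruence_sum ..
qed

lemma conj_sum_cols:
  fixes p q :: "'i \<Rightarrow> 'i \<Rightarrow> real"
  assumes "finite I" "orthobasis I p"
  shows "(\<Sum>k\<in>I. \<Sum>l\<in>I. a l * ((\<Sum>i\<in>I. \<Sum>j\<in>I. p k i * x i j * q l j) * (\<Sum>i\<in>I. \<Sum>j\<in>I. p k i * y i j * q l j)))
    = (\<Sum>j\<in>I. \<Sum>j'\<in>I. (\<Sum>l\<in>I. a l * q l j * q l j') * (\<Sum>i\<in>I. x i j * y i j'))"
proof -
  have sw: "(\<Sum>i\<in>I. \<Sum>j\<in>I. p k i * x i j * q l j) = (\<Sum>j\<in>I. \<Sum>i\<in>I. q l j * x i j * p k i)" for k l x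
    by (subst sum.swap) (simp add: mult_ac)
  show ?thesis
    unfolding sw by (subst sum.swap) (rule conj_sum_rows[OF assms])
qed

text \<open>
  The tangent inequality for the jointly convex relative entropy \<open>tr T (log T - log A)\<close> at a second pair of
  matrices, with all four diagonalised: \<open>t\<close>, \<open>a\<close> are the eigenvalues of the pair, \<open>b\<close>, \<open>c\<close> those of the point of
  tangency, and \<open>p\<close>, \<open>q\<close>, \<open>v\<close> the changes of basis. It is the integral over \<open>s \<ge> 0\<close> of
  \<open>x\<^sup>2 / d \<ge> 2 x z - d z\<^sup>2\<close> with \<open>x = t u\<close> and \<open>d = s t + a\<close>; instead of integrating, the proof shows that
  the difference \<open>F\<close> of the primitives is nondecreasing and takes its limit.
\<close>

lemma entropy_tangent_scalar:
  fixes p q v :: "'i \<Rightarrow> 'i \<Rightarrow> real" and t a b c :: "'i \<Rightarrow> real"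
  assumes I: "finite I"
    and p: "orthobasis I p" and q: "orthobasis I q" and v: "orthobasis I v"
    and pos: "\<And>i. i \<in> I \<Longrightarrow> t i > 0" "\<And>i. i \<in> I \<Longrightarrow> a i > 0"
      "\<And>i. i \<in> I \<Longrightarrow> b i > 0" "\<And>i. i \<in> I \<Longrightarrow> c i > 0"
  defines "u \<equiv> \<lambda>k l. \<Sum>i\<in>I. \<Sum>j\<in>I. p k i * v i j * q l j"
  defines "T \<equiv> \<lambda>i i'. \<Sum>k\<in>I. t k * p k i * p k i'"
  defines "A \<equiv> \<lambda>j j'. \<Sum>l\<in>I. a l * q l j * q l j'"
  shows "(\<Sum>i\<in>I. T i i * (ln (b i) + 1)) \<le> (\<Sum>k\<in>I. \<Sum>l\<in>I. t k * (ln (t k) - ln (a l)) * (u k l * u k l))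
     + (\<Sum>i\<in>I. \<Sum>i'\<in>I. T i i' * (\<Sum>j\<in>I. v i j * v i' j * ln (c j)))
     + (\<Sum>j\<in>I. \<Sum>j'\<in>I. A j j' * (\<Sum>i\<in>I. v i j * v i j' * (b i * log_slope (c j) (c j'))))"
proof -
  define F where "F s = (\<Sum>k\<in>I. \<Sum>l\<in>I. t k * (ln (s * t k + a l) - ln (a l)) * (u k l * u k l))
     - (\<Sum>i\<in>I. \<Sum>i'\<in>I. T i i' * (\<Sum>j\<in>I. v i j * v i' j * (primB (b i) (b i') (c j) s - primB (b i) (b i') (c j) 0)))
     + (\<Sum>j\<in>I. \<Sum>j'\<in>I. A j j' * (\<Sum>i\<in>I. v i j * v i j' * (primA (b i) (c j) (c j') s - primA (b i) (c j) (c j') 0)))"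
    for s
  define r where "r s i j = b i / (s * b i + c j)" for s i j
  \<comment> \<open>This is \<open>z = x / d\<close> at the point of tangency, in the eigenbases
    there; with this choice the quadratic bound is an equality at that point.\<close>
  define y where "y s i j = v i j * r s i j" for s i j
  define F' where "F' s = (\<Sum>k\<in>I. \<Sum>l\<in>I. t k * (t k / (s * t k + a l)) * (u k l * u k l))
     - (\<Sum>i\<in>I. \<Sum>i'\<in>I. T i i' * (\<Sum>j\<in>I. v i j * v i' j * (r s i j + r s i' j - s * r s i j * r s i' j)))
     + (\<Sum>j\<in>I. \<Sum>j'\<in>I. A j j' * (\<Sum>i\<in>I. v i j * v i j' * (r s i j * r s i j')))" for s
  have F0: "F 0 = 0" by (simp add: F_def)
  have dF: "(F has_real_derivative F' s) (at s)" if s: "s \<ge> 0" for s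
  proof -
    have l: "((\<lambda>s. ln (s * t k + a l) - ln (a l)) has_real_derivative t k / (s * t k + a l)) (at s)"
      if "k \<in> I" "l \<in> I" for k l
    proof -
      have "s * t k + a l > 0" using pos s that by (intro add_nonneg_pos mult_nonneg_nonneg) (auto simp: less_imp_le)
      then show ?thesis by (auto intro!: derivative_eq_intros)
    qed
    have dA: "((\<lambda>s. primA (b i) (c j) (c j') s - primA (b i) (c j) (c j') 0) has_real_derivative r s i j * r s i j') (at s)"
      if "i \<in> I" "j \<in> I" "j' \<in> I" for i j j'
      using DERIV_diff[OF primA_deriv[of "b i" "c j" "c j'" s] DERIV_const] pos s that by (simp add: r_def)
    have dB: "((\<lambda>s. primB (b i) (b i') (c j) s - primB (b i) (b i') (c j) 0) has_real_derivative
        (r s i j + r s i' j - s * r s i j * r s i' j)) (at s)"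
      if "i \<in> I" "i' \<in> I" "j \<in> I" for i i' j
      using DERIV_diff[OF primB_deriv[of "b i" "b i'" "c j" s] DERIV_const] pos s that by (simp add: r_def)
    show ?thesis unfolding F_def F'_def
      by (rule DERIV_add[OF DERIV_diff]; intro DERIV_sum DERIV_cmult DERIV_cmult_right l dA dB)
  qed
  have F'_nonneg: "F' s \<ge> 0" if s: "s \<ge> 0" for s
  proof -
    define z where "z k l = (\<Sum>i\<in>I. \<Sum>j\<in>I. p k i * y s i j * q l j)" for k l
    have B: "(\<Sum>i\<in>I. \<Sum>i'\<in>I. T i i' * (\<Sum>j\<in>I. v i j * v i' j * (r s i j + r s i' j - s * r s i j * r s i' j)))
      = (\<Sum>i\<in>I. \<Sum>i'\<in>I. T i i' * (\<Sum>j\<in>I. v i j * y s i' j)) + (\<Sum>i\<in>I. \<Sum>i'\<in>I. T i i' * (\<Sum>j\<in>I. y s i j * v i' j))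
       - s * (\<Sum>i\<in>I. \<Sum>i'\<in>I. T i i' * (\<Sum>j\<in>I. y s i j * y s i' j))"
      unfolding sum_distrib_left sum.distrib[symmetric] sum_subtractf[symmetric] y_def
      by (intro sum.cong refl) (simp add: algebra_simps)
    have A: "(\<Sum>j\<in>I. \<Sum>j'\<in>I. A j j' * (\<Sum>i\<in>I. v i j * v i j' * (r s i j * r s i j')))
      = (\<Sum>j\<in>I. \<Sum>j'\<in>I. A j j' * (\<Sum>i\<in>I. y s i j * y s i j'))"
      unfolding y_def by (intro sum.cong refl) (simp add: algebra_simps)
    have CR: "(\<Sum>i\<in>I. \<Sum>i'\<in>I. T i i' * (\<Sum>j\<in>I. x i j * x' i' j)) = (\<Sum>k\<in>I. \<Sum>l\<in>I.
        t k * ((\<Sum>i\<in>I. \<Sum>j\<in>I. p k i * x i j * q l j) * (\<Sum>i\<in>I. \<Sum>j\<in>I. p k i * x' i j * q l j)))" for x x'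
      unfolding T_def by (rule conj_sum_rows[OF I q, symmetric])
    have CC: "(\<Sum>j\<in>I. \<Sum>j'\<in>I. A j j' * (\<Sum>i\<in>I. x i j * x' i j')) = (\<Sum>k\<in>I. \<Sum>l\<in>I.
        a l * ((\<Sum>i\<in>I. \<Sum>j\<in>I. p k i * x i j * q l j) * (\<Sum>i\<in>I. \<Sum>j\<in>I. p k i * x' i j * q l j)))" for x x'
      unfolding A_def by (rule conj_sum_cols[OF I p, symmetric])
    have u_eq: "(\<Sum>i\<in>I. \<Sum>j\<in>I. p k i * v i j * q l j) = u k l" for k l
      by (simp add: u_def)
    \<comment> \<open>Moved to the eigenbases of the second pair, all groups of terms become sums
      over \<open>k\<close> and \<open>l\<close>, and each summand is a square divided by
      \<open>s * t k + a l\<close>.\<close>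
    have F'_eq: "F' s = (\<Sum>k\<in>I. \<Sum>l\<in>I. t k * (t k / (s * t k + a l)) * (u k l * u k l) - t k * (u k l * z k l)
         - t k * (z k l * u k l) + s * (t k * (z k l * z k l)) + a l * (z k l * z k l))"
      unfolding F'_def A B CR CC
      unfolding u_eq z_def[symmetric]
      by (simp only: sum.distrib sum_subtractf sum_distrib_left)
    show ?thesis unfolding F'_eq
    proof (intro sum_nonneg)
      fix k l assume kl: "k \<in> I" "l \<in> I"
      have d: "s * t k + a l > 0" using pos s kl by (intro add_nonneg_pos mult_nonneg_nonneg) (auto simp: less_imp_le)
      have "t k * (t k / (s * t k + a l)) * (u k l * u k l) - t k * (u k l * z k l)
         - t k * (z k l * u k l) + s * (t k * (z k l * z k l)) + a l * (z k l * z k l)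
        = (t k * u k l - (s * t k + a l) * z k l)\<^sup>2 / (s * t k + a l)"
        using d by (simp add: divide_simps) (simp add: algebra_simps power2_eq_square)
      then show "0 \<le> t k * (t k / (s * t k + a l)) * (u k l * u k l) - t k * (u k l * z k l)
         - t k * (z k l * u k l) + s * (t k * (z k l * z k l)) + a l * (z k l * z k l)"
        using d by simp
    qed
  qed
  have F_nonneg: "F s \<ge> 0" if "s \<ge> 0" for s
    using DERIV_nonneg_imp_nondecreasing[of 0 s F] dF F'_nonneg F0 that by (metis order_trans)
  have vrow: "(\<Sum>j\<in>I. v i j * v i' j) = (if i = i' then 1 else 0)" if "i \<in> I" "i' \<in> I" for i i'
    using orthobasis_rows[OF v that] .
  have Tdiag: "(\<Sum>i\<in>I. \<Sum>i'\<in>I. T i i' * ((if i = i' then 1 else 0) * g i i')) = (\<Sum>i\<in>I. T i i * g i i)" for g :: "'i \<Rightarrow> 'i \<Rightarrow> real"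
  proof (rule sum.cong[OF refl])
    fix i assume "i \<in> I"
    have "(\<Sum>i'\<in>I. T i i' * ((if i = i' then 1 else 0) * g i i')) = (\<Sum>i'\<in>I. (if i = i' then 1 else 0) * (T i i' * g i i'))"
      by (simp add: mult_ac)
    then show "(\<Sum>i'\<in>I. T i i' * ((if i = i' then 1 else 0) * g i i')) = T i i * g i i"
      using sum_delta_mult_left[OF I \<open>i \<in> I\<close>] by metis
  qed
  have uT: "(\<Sum>k\<in>I. \<Sum>l\<in>I. t k * (u k l * u k l)) = (\<Sum>i\<in>I. T i i)"
  proof -
    have "(\<Sum>k\<in>I. \<Sum>l\<in>I. t k * (u k l * u k l)) = (\<Sum>i\<in>I. \<Sum>i'\<in>I. T i i' * (\<Sum>j\<in>I. v i j * v i' j))"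
      unfolding u_def T_def by (rule conj_sum_rows[OF I q])
    also have "\<dots> = (\<Sum>i\<in>I. \<Sum>i'\<in>I. T i i' * ((if i = i' then 1 else 0) * 1))"
      by (intro sum.cong refl) (simp add: vrow)
    finally show ?thesis by (simp only: Tdiag) simp
  qed
  \<comment> \<open>\<open>G\<close> equals \<open>F\<close>: the inserted \<open>ln (1 + s)\<close>
    appears in two groups with the same total weight, the trace of \<open>T\<close>, and cancels.
    Unlike in \<open>F\<close>, every single term of \<open>G\<close> has a finite limit.\<close>
  define G where "G s = (\<Sum>k\<in>I. \<Sum>l\<in>I. t k * (ln (s * t k + a l) - ln (1 + s) - ln (a l)) * (u k l * u k l))
     - (\<Sum>i\<in>I. \<Sum>i'\<in>I. T i i' * (\<Sum>j\<in>I. v i j * v i' j * (primB (b i) (b i') (c j) s - primB (b i) (b i') (c j) 0 - ln (1 + s))))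
     + (\<Sum>j\<in>I. \<Sum>j'\<in>I. A j j' * (\<Sum>i\<in>I. v i j * v i j' * (primA (b i) (c j) (c j') s - primA (b i) (c j) (c j') 0)))"
    for s
  have FG: "F s = G s" for s
  proof -
    have "(\<Sum>i\<in>I. \<Sum>i'\<in>I. T i i' * (\<Sum>j\<in>I. v i j * v i' j * ln (1 + s)))
      = (\<Sum>i\<in>I. \<Sum>i'\<in>I. T i i' * ((if i = i' then 1 else 0) * ln (1 + s)))"
      by (intro sum.cong refl) (simp add: sum_distrib_right[symmetric] vrow)
    then have 1: "(\<Sum>i\<in>I. \<Sum>i'\<in>I. T i i' * (\<Sum>j\<in>I. v i j * v i' j * ln (1 + s))) = ln (1 + s) * (\<Sum>i\<in>I. T i i)"
      by (simp only: Tdiag) (simp add: sum_distrib_left mult_ac)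
    have 2: "(\<Sum>k\<in>I. \<Sum>l\<in>I. t k * ln (1 + s) * (u k l * u k l)) = ln (1 + s) * (\<Sum>i\<in>I. T i i)"
      unfolding uT[symmetric] by (simp add: sum_distrib_left mult_ac)
    have "G s = F s - (\<Sum>k\<in>I. \<Sum>l\<in>I. t k * ln (1 + s) * (u k l * u k l))
       + (\<Sum>i\<in>I. \<Sum>i'\<in>I. T i i' * (\<Sum>j\<in>I. v i j * v i' j * ln (1 + s)))"
      unfolding G_def F_def by (simp add: algebra_simps sum.distrib sum_subtractf)
    then show ?thesis using 1 2 by simp
  qed
  define L where "L = (\<Sum>k\<in>I. \<Sum>l\<in>I. t k * (ln (t k) - ln (a l)) * (u k l * u k l))
     - (\<Sum>i\<in>I. \<Sum>i'\<in>I. T i i' * (\<Sum>j\<in>I. v i j * v i' j * (limB (b i) (b i') - ln (c j))))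
     + (\<Sum>j\<in>I. \<Sum>j'\<in>I. A j j' * (\<Sum>i\<in>I. v i j * v i j' * (0 - primA (b i) (c j) (c j') 0)))"
  have "(G \<longlongrightarrow> L) at_top"
    unfolding G_def[abs_def] L_def
    by (intro tendsto_add tendsto_diff tendsto_sum tendsto_mult tendsto_const ln_affine_limit primA_limit primB_limit)
       (use pos in auto)
  moreover have "eventually (\<lambda>s. G s \<ge> 0) at_top"
    using eventually_ge_at_top[of 0] by eventually_elim (simp add: FG[symmetric] F_nonneg)
  ultimately have "L \<ge> 0" by (rule tendsto_lowerbound) simp
  moreover have "(\<Sum>i\<in>I. \<Sum>i'\<in>I. T i i' * (\<Sum>j\<in>I. v i j * v i' j * (limB (b i) (b i') - ln (c j))))
     = (\<Sum>i\<in>I. T i i * (ln (b i) + 1)) - (\<Sum>i\<in>I. \<Sum>i'\<in>I. T i i' * (\<Sum>j\<in>I. v i j * v i' j * ln (c j)))"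
  proof -
    have "(\<Sum>i\<in>I. \<Sum>i'\<in>I. T i i' * (\<Sum>j\<in>I. v i j * v i' j * limB (b i) (b i')))
      = (\<Sum>i\<in>I. \<Sum>i'\<in>I. T i i' * ((if i = i' then 1 else 0) * limB (b i) (b i')))"
      by (intro sum.cong refl) (simp add: sum_distrib_right[symmetric] vrow)
    also have "\<dots> = (\<Sum>i\<in>I. T i i * (ln (b i) + 1))"
      by (simp only: Tdiag) (simp add: limB_def)
    finally show ?thesis by (simp add: algebra_simps sum.distrib sum_subtractf)
  qed
  moreover have "(\<Sum>j\<in>I. \<Sum>j'\<in>I. A j j' * (\<Sum>i\<in>I. v i j * v i j' * (0 - primA (b i) (c j) (c j') 0)))
     = (\<Sum>j\<in>I. \<Sum>j'\<in>I. A j j' * (\<Sum>i\<in>I. v i j * v i j' * (b i * log_slope (c j) (c j'))))"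
    by (intro sum.cong arg_cong2[of _ _ _ _ "(*)"] refl) (simp add: primA_0 pos)
  ultimately show ?thesis unfolding L_def by linarith
qed

subsection \<open>Lieb concavity of the trace exponential\<close>

lemma parseval':
  assumes "finite I" "orthobasis I e"
  shows "(\<Sum>k\<in>I. (\<Sum>i\<in>I. x i * e k i) * (\<Sum>i\<in>I. y i * e k i)) = (\<Sum>i\<in>I. x i * y i)"
  using parseval[OF assms, of x y] by (simp add: mult.commute)

lemma orthobasis_gram:
  assumes "finite I" "orthobasis I e" "orthobasis I g"
  shows "orthobasis I (\<lambda>k l. \<Sum>i\<in>I. e k i * g l i)"
  unfolding orthobasis_def parseval'[OF assms(1,3)] parseval[OF assms(1,2)]
  using assms by (simp add: orthobasis_rows)

definition trace_prod :: "'i set \<Rightarrow> ('i \<Rightarrow> 'i \<Rightarrow> real) \<Rightarrow> ('i \<Rightarrow> 'i \<Rightarrow> real) \<Rightarrow> real" where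
  "trace_prod I X Y = (\<Sum>i\<in>I. \<Sum>j\<in>I. X i j * Y i j)"

lemma trace_prod_add: "trace_prod I X (\<lambda>i j. Y i j + Z i j) = trace_prod I X Y + trace_prod I X Z"
  by (simp add: trace_prod_def sum.distrib algebra_simps)

lemma trace_prod_cong:
  "(\<And>i j. i \<in> I \<Longrightarrow> j \<in> I \<Longrightarrow> Y i j = Z i j) \<Longrightarrow> trace_prod I X Y = trace_prod I X Z"
  unfolding trace_prod_def by (intro sum.cong) auto

lemma sum_swap3:
  "(\<Sum>i\<in>I. \<Sum>j\<in>J. \<Sum>p\<in>K. f i j p) = (\<Sum>p\<in>K. \<Sum>i\<in>I. \<Sum>j\<in>J. f i j p)"
  by (subst (2) sum.swap) (subst sum.swap, rule refl)

lemma bilin_spec: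
  "bilin I (spec_mat I f a) x y = (\<Sum>l\<in>I. a l * ((\<Sum>i\<in>I. f l i * x i) * (\<Sum>j\<in>I. f l j * y j)))"
proof -
  have "bilin I (spec_mat I f a) x y = (\<Sum>i\<in>I. \<Sum>j\<in>I. \<Sum>l\<in>I. a l * (f l i * x i) * (f l j * y j))"
    unfolding bilin_def spec_mat_def sum_distrib_left sum_distrib_right
    by (intro sum.cong refl) (simp add: mult_ac)
  also have "\<dots> = (\<Sum>l\<in>I. \<Sum>i\<in>I. \<Sum>j\<in>I. a l * (f l i * x i) * (f l j * y j))"
    by (subst (2) sum.swap) (subst sum.swap, rule refl)
  also have "\<dots> = (\<Sum>l\<in>I. a l * ((\<Sum>i\<in>I. f l i * x i) * (\<Sum>j\<in>I. f l j * y j)))"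
    by (subst sum_product) (simp add: sum_distrib_left mult_ac)
  finally show ?thesis .
qed

lemma trace_prod_spec:
  "trace_prod I X (spec_mat I f x) = (\<Sum>l\<in>I. x l * bilin I X (f l) (f l))"
proof -
  have "trace_prod I X (spec_mat I f x) = (\<Sum>i\<in>I. \<Sum>j\<in>I. \<Sum>l\<in>I. x l * (f l i * X i j * f l j))"
    unfolding trace_prod_def spec_mat_def sum_distrib_left
    by (intro sum.cong refl) (simp add: mult_ac)
  also have "\<dots> = (\<Sum>l\<in>I. \<Sum>i\<in>I. \<Sum>j\<in>I. x l * (f l i * X i j * f l j))"
    by (subst (2) sum.swap) (subst sum.swap, rule refl)
  finally show ?thesis by (simp add: bilin_def sum_distrib_left)
qed

lemma trace_prod_spec_spec:
  "trace_prod I (spec_mat I e t) (spec_mat I f x)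
    = (\<Sum>k\<in>I. t k * (\<Sum>l\<in>I. x l * ((\<Sum>i\<in>I. e k i * f l i) * (\<Sum>i\<in>I. e k i * f l i))))"
  unfolding trace_prod_spec bilin_spec sum_distrib_left
  by (subst sum.swap) (simp add: mult_ac)

lemma bilin_spec_eigenvectors:
  assumes "finite I" "orthobasis I h" "p \<in> I" "q \<in> I"
  shows "bilin I (spec_mat I h c) (h p) (h q) = (if p = q then c p else 0)"
proof -
  have "bilin I (spec_mat I h c) (h p) (h q) = (\<Sum>l\<in>I. c l * ((if l = p then 1 else 0) * (if l = q then 1 else 0)))"
    unfolding bilin_spec using assms by (intro sum.cong refl) (simp add: orthobasis_rows)
  also have "\<dots> = (\<Sum>l\<in>I. if l = p then (if p = q then c p else 0) else 0)"
    by (intro sum.cong) auto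
  finally show ?thesis using assms by simp
qed

lemma trace_spec:
  assumes "orthobasis I e"
  shows "(\<Sum>i\<in>I. spec_mat I e l i i) = (\<Sum>k\<in>I. l k)"
  unfolding spec_mat_def
  by (subst sum.swap) (use orthobasis_rows[OF assms] in \<open>simp add: sum_distrib_left[symmetric] mult.assoc\<close>)

text \<open>
  With \<open>log T = H + log A\<close> and \<open>log B = H + log C\<close> every term of the entropy tangent inequality except
  \<open>tr T\<close> and the linear functional of \<open>A\<close> cancels.
\<close>

lemma exp_log_tangent:
  fixes H :: "'i \<Rightarrow> 'i \<Rightarrow> real"
  assumes I: "finite I"
    and ob: "orthobasis I e" "orthobasis I f" "orthobasis I g" "orthobasis I h"
    and pos: "\<And>i. i \<in> I \<Longrightarrow> t i > 0" "\<And>i. i \<in> I \<Longrightarrow> a i > 0"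
      "\<And>i. i \<in> I \<Longrightarrow> b i > 0" "\<And>i. i \<in> I \<Longrightarrow> c i > 0"
    and T: "\<And>i j. i \<in> I \<Longrightarrow> j \<in> I \<Longrightarrow> spec_mat I e (\<lambda>k. ln (t k)) i j = H i j + spec_mat I f (\<lambda>k. ln (a k)) i j"
    and B: "\<And>i j. i \<in> I \<Longrightarrow> j \<in> I \<Longrightarrow> spec_mat I g (\<lambda>k. ln (b k)) i j = H i j + spec_mat I h (\<lambda>k. ln (c k)) i j"
  shows "(\<Sum>k\<in>I. t k) \<le> (\<Sum>p\<in>I. \<Sum>q\<in>I. bilin I (spec_mat I f a) (h p) (h q) *
           (bilin I (spec_mat I g b) (h p) (h q) * log_slope (c p) (c q)))"
proof -
  define p where "p = (\<lambda>k l. \<Sum>i\<in>I. e k i * g l i)"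
  define q where "q = (\<lambda>k l. \<Sum>i\<in>I. f k i * h l i)"
  define v where "v = (\<lambda>k l. \<Sum>i\<in>I. g k i * h l i)"
  have opq: "orthobasis I p" "orthobasis I q" "orthobasis I v"
    unfolding p_def q_def v_def using I ob by (auto intro: orthobasis_gram)
  have pv: "(\<Sum>i\<in>I. p k i * v i j) = (\<Sum>i\<in>I. e k i * h j i)" for k j
    using parseval'[OF I ob(3), of "e k" "h j"] by (simp add: p_def v_def mult.commute)
  have hq: "(\<Sum>j\<in>I. (\<Sum>i\<in>I. e k i * h j i) * q l j) = (\<Sum>i\<in>I. e k i * f l i)" for k l
    using parseval'[OF I ob(4), of "e k" "f l"] by (simp add: q_def)
  \<comment> \<open>The three changes of basis compose to the one between \<open>e\<close> and
    \<open>f\<close>, so the first double sum becomes a difference of traces against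
    \<open>T\<close>.\<close>
  have u: "(\<Sum>i\<in>I. \<Sum>j\<in>I. p k i * v i j * q l j) = (\<Sum>i\<in>I. e k i * f l i)" for k l
  proof -
    have "(\<Sum>i\<in>I. \<Sum>j\<in>I. p k i * v i j * q l j) = (\<Sum>j\<in>I. (\<Sum>i\<in>I. p k i * v i j) * q l j)"
      by (subst sum.swap) (simp add: sum_distrib_right)
    then show ?thesis by (simp only: pv hq)
  qed
  let ?T = "spec_mat I e t"
  have row1: "(\<Sum>l\<in>I. x * ((\<Sum>i\<in>I. e k i * f l i) * (\<Sum>i\<in>I. e k i * f l i))) = x"
    if "orthobasis I f" "k \<in> I" for x k f
    unfolding sum_distrib_left[symmetric] parseval'[OF I that(1)] using orthobasis_rows[OF ob(1) that(2) that(2)] by simp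
  have tt: "trace_prod I ?T (spec_mat I e (\<lambda>k. ln (t k))) = (\<Sum>k\<in>I. t k * ln (t k))"
    unfolding trace_prod_spec using I ob by (intro sum.cong refl) (simp add: bilin_spec_eigenvectors)
  have S1: "(\<Sum>k\<in>I. \<Sum>l\<in>I. t k * (ln (t k) - ln (a l)) * ((\<Sum>i\<in>I. e k i * f l i) * (\<Sum>i\<in>I. e k i * f l i)))
    = trace_prod I ?T (spec_mat I e (\<lambda>k. ln (t k))) - trace_prod I ?T (spec_mat I f (\<lambda>k. ln (a k)))"
  proof -
    have "(\<Sum>k\<in>I. \<Sum>l\<in>I. t k * (ln (t k) - ln (a l)) * ((\<Sum>i\<in>I. e k i * f l i) * (\<Sum>i\<in>I. e k i * f l i)))
      = (\<Sum>k\<in>I. \<Sum>l\<in>I. t k * ln (t k) * ((\<Sum>i\<in>I. e k i * f l i) * (\<Sum>i\<in>I. e k i * f l i)))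
       - trace_prod I ?T (spec_mat I f (\<lambda>k. ln (a k)))"
      unfolding trace_prod_spec_spec sum_distrib_left[of "t _"] sum_subtractf[symmetric]
      by (intro sum.cong refl) (simp add: algebra_simps)
    then show ?thesis unfolding tt by (simp add: row1[OF ob(2)])
  qed
  have S2: "(\<Sum>i\<in>I. (\<Sum>k\<in>I. t k * p k i * p k i) * (ln (b i) + 1))
     = trace_prod I ?T (spec_mat I g (\<lambda>k. ln (b k))) + (\<Sum>k\<in>I. t k)"
  proof -
    have "(\<Sum>i\<in>I. (\<Sum>k\<in>I. t k * p k i * p k i) * (ln (b i) + 1))
      = (\<Sum>k\<in>I. t k * (\<Sum>i\<in>I. ln (b i) * (p k i * p k i))) + (\<Sum>k\<in>I. t k * (\<Sum>i\<in>I. 1 * (p k i * p k i)))"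
      unfolding sum_distrib_left sum_distrib_right sum.distrib[symmetric]
      by (subst sum.swap) (intro sum.cong refl, simp add: algebra_simps)
    also have "(\<Sum>k\<in>I. t k * (\<Sum>i\<in>I. 1 * (p k i * p k i))) = (\<Sum>k\<in>I. t k)"
      unfolding p_def by (intro sum.cong refl) (subst row1[OF ob(3)], auto)
    finally show ?thesis by (simp only: trace_prod_spec_spec p_def)
  qed
  have S3: "(\<Sum>i\<in>I. \<Sum>i'\<in>I. (\<Sum>k\<in>I. t k * p k i * p k i') * (\<Sum>j\<in>I. v i j * v i' j * ln (c j)))
    = trace_prod I ?T (spec_mat I h (\<lambda>k. ln (c k)))"
  proof -
    have "(\<Sum>i\<in>I. \<Sum>i'\<in>I. (\<Sum>k\<in>I. t k * p k i * p k i') * (\<Sum>j\<in>I. v i j * (v i' j * ln (c j))))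
      = (\<Sum>k\<in>I. t k * (\<Sum>j\<in>I. (\<Sum>i\<in>I. p k i * v i j) * (\<Sum>i\<in>I. p k i * (v i j * ln (c j)))))"
      by (rule congruence_sum[symmetric])
    moreover have "(\<Sum>i\<in>I. p k i * (v i j * x)) = x * (\<Sum>i\<in>I. e k i * h j i)" for k j x
      unfolding pv[symmetric] by (simp add: sum_distrib_left mult_ac)
    ultimately show ?thesis unfolding trace_prod_spec_spec by (simp add: pv mult_ac)
  qed
  have S4: "(\<Sum>j\<in>I. \<Sum>j'\<in>I. (\<Sum>l\<in>I. a l * q l j * q l j') * (\<Sum>i\<in>I. v i j * v i j' * (b i * log_slope (c j) (c j'))))
    = (\<Sum>p\<in>I. \<Sum>q\<in>I. bilin I (spec_mat I f a) (h p) (h q) *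
           (bilin I (spec_mat I g b) (h p) (h q) * log_slope (c p) (c q)))"
  proof (intro sum.cong refl)
    fix j j'
    have "bilin I (spec_mat I f a) (h j) (h j') = (\<Sum>l\<in>I. a l * q l j * q l j')"
      unfolding bilin_spec q_def by (simp only: mult.assoc)
    moreover have "bilin I (spec_mat I g b) (h j) (h j') = (\<Sum>i\<in>I. b i * (v i j * v i j'))"
      unfolding bilin_spec v_def ..
    moreover have "(\<Sum>i\<in>I. v i j * v i j' * (b i * x)) = (\<Sum>i\<in>I. b i * (v i j * v i j')) * x" for x
      unfolding sum_distrib_right by (intro sum.cong refl) (simp add: mult_ac)
    ultimately show "(\<Sum>l\<in>I. a l * q l j * q l j') * (\<Sum>i\<in>I. v i j * v i j' * (b i * log_slope (c j) (c j')))
      = bilin I (spec_mat I f a) (h j) (h j') * (bilin I (spec_mat I g b) (h j) (h j') * log_slope (c j) (c j'))"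
      by (simp only: mult.assoc)
  qed
  have "trace_prod I ?T (spec_mat I g (\<lambda>k. ln (b k))) + (\<Sum>k\<in>I. t k) \<le>
     trace_prod I ?T (spec_mat I e (\<lambda>k. ln (t k))) - trace_prod I ?T (spec_mat I f (\<lambda>k. ln (a k)))
     + trace_prod I ?T (spec_mat I h (\<lambda>k. ln (c k))) +
     (\<Sum>p\<in>I. \<Sum>q\<in>I. bilin I (spec_mat I f a) (h p) (h q) *
           (bilin I (spec_mat I g b) (h p) (h q) * log_slope (c p) (c q)))"
    using entropy_tangent_scalar[of I p q v t a b c, OF I opq pos] unfolding u S1 S2 S3 S4 .
  moreover have "trace_prod I ?T (spec_mat I e (\<lambda>k. ln (t k))) = trace_prod I ?T H + trace_prod I ?T (spec_mat I f (\<lambda>k. ln (a k)))"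
    unfolding trace_prod_add[symmetric] by (intro trace_prod_cong T)
  moreover have "trace_prod I ?T (spec_mat I g (\<lambda>k. ln (b k))) = trace_prod I ?T H + trace_prod I ?T (spec_mat I h (\<lambda>k. ln (c k)))"
    unfolding trace_prod_add[symmetric] by (intro trace_prod_cong B)
  ultimately show ?thesis by linarith
qed

section \<open>The trace of the exponential as a power series\<close>

fun mat_pow :: "'i set \<Rightarrow> ('i \<Rightarrow> 'i \<Rightarrow> real) \<Rightarrow> nat \<Rightarrow> 'i \<Rightarrow> 'i \<Rightarrow> real" where
  "mat_pow I S 0 i j = (if i = j then 1 else 0)"
| "mat_pow I S (Suc k) i j = (\<Sum>m\<in>I. S i m * mat_pow I S k m j)"

text \<open>A series in the matrix entries, so that measurability follows without a measurable
  choice of eigenvectors; \<open>trace_exp_spec\<close> recovers the sum over eigenvalues.\<close>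

definition trace_exp :: "'i set \<Rightarrow> ('i \<Rightarrow> 'i \<Rightarrow> real) \<Rightarrow> real" where
  "trace_exp I S = (\<Sum>k. (\<Sum>i\<in>I. mat_pow I S k i i) / fact k)"

lemma spec_mult:
  assumes "finite I" "orthobasis I e"
  shows "(\<Sum>m\<in>I. spec_mat I e x i m * spec_mat I e y m j) = spec_mat I e (\<lambda>k. x k * y k) i j"
proof -
  have "(\<Sum>m\<in>I. spec_mat I e x i m * spec_mat I e y m j)
    = (\<Sum>m\<in>I. \<Sum>k\<in>I. \<Sum>l\<in>I. (x k * e k i * (y l * e l j)) * (e k m * e l m))"
    unfolding spec_mat_def sum_product by (intro sum.cong refl) (simp add: mult_ac)
  also have "\<dots> = (\<Sum>k\<in>I. \<Sum>l\<in>I. (x k * e k i * (y l * e l j)) * (\<Sum>m\<in>I. e k m * e l m))"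
    unfolding sum_distrib_left
    by (subst sum.swap) (rule sum.cong[OF refl], rule sum.swap)
  also have "\<dots> = (\<Sum>k\<in>I. \<Sum>l\<in>I. if k = l then x k * e k i * (y k * e k j) else 0)"
    using assms by (intro sum.cong refl) (simp add: orthobasis_rows)
  also have "\<dots> = spec_mat I e (\<lambda>k. x k * y k) i j"
    using assms by (simp add: spec_mat_def mult_ac)
  finally show ?thesis .
qed

lemma spec_one:
  assumes "orthobasis I e" "i \<in> I" "j \<in> I"
  shows "spec_mat I e (\<lambda>_. 1) i j = (if i = j then 1 else 0)"
  using assms by (simp add: spec_mat_def orthobasis_cols)

lemma mat_pow_spec:
  assumes "finite I" "orthobasis I e" and S: "\<And>i j. i \<in> I \<Longrightarrow> j \<in> I \<Longrightarrow> S i j = spec_mat I e l i j"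
    and "i \<in> I" "j \<in> I"
  shows "mat_pow I S n i j = spec_mat I e (\<lambda>k. l k ^ n) i j"
  using assms(4,5)
proof (induction n arbitrary: i j)
  case 0
  then show ?case using assms by (simp add: spec_one)
next
  case (Suc n)
  have "mat_pow I S (Suc n) i j = (\<Sum>m\<in>I. spec_mat I e l i m * spec_mat I e (\<lambda>k. l k ^ n) m j)"
    using Suc by (simp add: S cong: sum.cong)
  then show ?case using spec_mult[OF assms(1,2)] by simp
qed

lemma trace_exp_spec:
  assumes "finite I" "orthobasis I e" and S: "\<And>i j. i \<in> I \<Longrightarrow> j \<in> I \<Longrightarrow> S i j = spec_mat I e l i j"
  shows "trace_exp I S = (\<Sum>k\<in>I. exp (l k))"
proof -
  have "(\<Sum>i\<in>I. mat_pow I S n i i) / fact n = (\<Sum>k\<in>I. l k ^ n / fact n)" for n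
  proof -
    have "(\<Sum>i\<in>I. mat_pow I S n i i) = (\<Sum>i\<in>I. spec_mat I e (\<lambda>k. l k ^ n) i i)"
      using mat_pow_spec[OF assms] by (intro sum.cong refl) blast
    then show ?thesis by (simp add: trace_spec[OF assms(2)] sum_divide_distrib)
  qed
  moreover have "(\<lambda>n. \<Sum>k\<in>I. l k ^ n / fact n) sums (\<Sum>k\<in>I. exp (l k))"
    by (intro sums_sum) (use exp_converges[of "l _"] in \<open>simp add: divide_inverse mult.commute\<close>)
  ultimately show ?thesis unfolding trace_exp_def by (simp add: sums_unique[symmetric])
qed

lemma trace_exp_cong:
  assumes "\<And>i j. i \<in> I \<Longrightarrow> j \<in> I \<Longrightarrow> S i j = S' i j"
  shows "trace_exp I S = trace_exp I S'"
proof -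
  have "i \<in> I \<Longrightarrow> j \<in> I \<Longrightarrow> mat_pow I S n i j = mat_pow I S' n i j" for i j n
    by (induction n arbitrary: i j) (auto simp: assms intro!: sum.cong)
  then show ?thesis unfolding trace_exp_def by (simp cong: sum.cong)
qed

lemma trace_exp_measurable:
  assumes "\<And>i j. i \<in> I \<Longrightarrow> j \<in> I \<Longrightarrow> (\<lambda>x. S x i j) \<in> borel_measurable M"
  shows "(\<lambda>x. trace_exp I (S x)) \<in> borel_measurable M"
proof -
  have "i \<in> I \<Longrightarrow> j \<in> I \<Longrightarrow> (\<lambda>x. mat_pow I (S x) n i j) \<in> borel_measurable M" for i j n
    by (induction n arbitrary: i j) (auto intro!: borel_measurable_sum borel_measurable_times assms)
  then show ?thesis unfolding trace_exp_def
    by (intro borel_measurable_suminf borel_measurable_divide borel_measurable_sum) auto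
qed

lemma trace_exp_nonneg:
  assumes "finite I" "\<And>i j. i \<in> I \<Longrightarrow> j \<in> I \<Longrightarrow> S i j = S j i"
  shows "trace_exp I S \<ge> 0"
proof -
  obtain e l where "orthobasis I e" "\<forall>i\<in>I. \<forall>j\<in>I. S i j = spec_mat I e l i j"
    using spectral_theorem[of I S] assms by blast
  then show ?thesis using assms(1) by (subst trace_exp_spec[of I e S l]) (auto intro: sum_nonneg)
qed

lemma spec_mat_sym: "spec_mat I e l i j = spec_mat I e l j i"
  by (simp add: spec_mat_def mult_ac)

text \<open>The bound in \<open>exp_log_tangent\<close> is linear in the matrix \<open>A\<close>,
  hence a pairing with a fixed \<open>D\<close>: the matrix \<open>exp (H + log C)\<close> in the
  eigenbasis of \<open>C\<close>, multiplied entrywise by \<open>log_slope\<close>. At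
  \<open>A = C\<close> only the diagonal survives, where \<open>log_slope\<close> is
  \<open>1 / c p\<close> and cancels the eigenvalue.\<close>

lemma trace_exp_log_tangent:
  fixes H :: "'i \<Rightarrow> 'i \<Rightarrow> real"
  assumes I: "finite I" and H: "\<And>i j. i \<in> I \<Longrightarrow> j \<in> I \<Longrightarrow> H i j = H j i"
    and h: "orthobasis I h" and c: "\<And>i. i \<in> I \<Longrightarrow> c i > 0"
  obtains D where
    "\<And>f a. orthobasis I f \<Longrightarrow> (\<And>i. i \<in> I \<Longrightarrow> a i > 0) \<Longrightarrow>
       trace_exp I (\<lambda>i j. H i j + spec_mat I f (\<lambda>k. ln (a k)) i j) \<le> trace_prod I D (spec_mat I f a)"
    "trace_prod I D (spec_mat I h c) = trace_exp I (\<lambda>i j. H i j + spec_mat I h (\<lambda>k. ln (c k)) i j)"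
proof -
  have "\<exists>g l. orthobasis I g \<and> (\<forall>i\<in>I. \<forall>j\<in>I. H i j + spec_mat I h (\<lambda>k. ln (c k)) i j = spec_mat I g l i j)"
    using H by (intro spectral_theorem[OF I]) (simp add: spec_mat_sym)
  then obtain g l where g: "orthobasis I g"
    and B: "\<And>i j. i \<in> I \<Longrightarrow> j \<in> I \<Longrightarrow> H i j + spec_mat I h (\<lambda>k. ln (c k)) i j = spec_mat I g l i j"
    by blast
  define W where "W p q = bilin I (spec_mat I g (\<lambda>k. exp (l k))) (h p) (h q) * log_slope (c p) (c q)" for p q
  define D where "D i j = (\<Sum>p\<in>I. \<Sum>q\<in>I. h p i * h q j * W p q)" for i j
  have tD: "trace_prod I D A = (\<Sum>p\<in>I. \<Sum>q\<in>I. bilin I A (h p) (h q) * W p q)" for A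
  proof -
    have "trace_prod I D A = (\<Sum>i\<in>I. \<Sum>j\<in>I. \<Sum>p\<in>I. \<Sum>q\<in>I. h p i * A i j * h q j * W p q)"
      unfolding trace_prod_def D_def sum_distrib_right by (intro sum.cong refl) (simp add: mult_ac)
    also have "\<dots> = (\<Sum>p\<in>I. \<Sum>q\<in>I. \<Sum>i\<in>I. \<Sum>j\<in>I. h p i * A i j * h q j * W p q)"
      by (rule trans[OF sum_swap3]) (intro sum.cong refl sum_swap3)
    finally show ?thesis unfolding bilin_def sum_distrib_right .
  qed
  show ?thesis
  proof (rule that)
    fix f a assume f: "orthobasis I f" and a: "\<And>i. i \<in> I \<Longrightarrow> a i > (0::real)"
    have "\<exists>e m. orthobasis I e \<and> (\<forall>i\<in>I. \<forall>j\<in>I. H i j + spec_mat I f (\<lambda>k. ln (a k)) i j = spec_mat I e m i j)"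
      using H by (intro spectral_theorem[OF I]) (simp add: spec_mat_sym)
    then obtain e m where e: "orthobasis I e"
      and T: "\<And>i j. i \<in> I \<Longrightarrow> j \<in> I \<Longrightarrow> H i j + spec_mat I f (\<lambda>k. ln (a k)) i j = spec_mat I e m i j"
      by blast
    have "trace_exp I (\<lambda>i j. H i j + spec_mat I f (\<lambda>k. ln (a k)) i j) = (\<Sum>k\<in>I. exp (m k))"
      by (rule trace_exp_spec[OF I e]) (rule T)
    also have "\<dots> \<le> (\<Sum>p\<in>I. \<Sum>q\<in>I. bilin I (spec_mat I f a) (h p) (h q) *
           (bilin I (spec_mat I g (\<lambda>k. exp (l k))) (h p) (h q) * log_slope (c p) (c q)))"
      by (rule exp_log_tangent[OF I e f g h, where H = H]) (use a c B T in auto)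
    also have "\<dots> = trace_prod I D (spec_mat I f a)"
      unfolding tD W_def ..
    finally show "trace_exp I (\<lambda>i j. H i j + spec_mat I f (\<lambda>k. ln (a k)) i j) \<le> trace_prod I D (spec_mat I f a)" .
  next
    have "trace_prod I D (spec_mat I h c) = (\<Sum>p\<in>I. \<Sum>q\<in>I. if p = q then c p * W p p else 0)"
      unfolding tD using I h by (intro sum.cong refl) (simp add: bilin_spec_eigenvectors)
    also have "\<dots> = (\<Sum>p\<in>I. bilin I (spec_mat I g (\<lambda>k. exp (l k))) (h p) (h p))"
      using I c by (auto simp: W_def log_slope_def intro!: sum.cong) (metis less_irrefl)
    also have "\<dots> = trace_prod I (spec_mat I g (\<lambda>k. exp (l k))) (spec_mat I h (\<lambda>_. 1))"
      unfolding trace_prod_spec by simp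
    also have "\<dots> = (\<Sum>i\<in>I. \<Sum>j\<in>I. spec_mat I g (\<lambda>k. exp (l k)) i j * (if i = j then 1 else 0))"
      unfolding trace_prod_def using h by (intro sum.cong refl) (simp add: spec_one)
    also have "\<dots> = (\<Sum>i\<in>I. spec_mat I g (\<lambda>k. exp (l k)) i i)"
      using I by (simp add: if_distrib[of "\<lambda>x. _ * x"] cong: if_cong)
    also have "\<dots> = (\<Sum>k\<in>I. exp (l k))" by (rule trace_spec[OF g])
    also have "\<dots> = trace_exp I (\<lambda>i j. H i j + spec_mat I h (\<lambda>k. ln (c k)) i j)"
      by (rule trace_exp_spec[OF I g, symmetric]) (rule B)
    finally show "trace_prod I D (spec_mat I h c) = trace_exp I (\<lambda>i j. H i j + spec_mat I h (\<lambda>k. ln (c k)) i j)" .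
  qed
qed

subsection \<open>Matrix Laplace transform of a sum of rank-one projections\<close>

lemma bilin_integral:
  assumes "\<And>i j. i \<in> I \<Longrightarrow> j \<in> I \<Longrightarrow> integrable N (\<lambda>x. V x i * V x j)"
  shows "bilin I (\<lambda>i j. \<integral>x. V x i * V x j \<partial>N) y y = (\<integral>x. (\<Sum>i\<in>I. V x i * y i)\<^sup>2 \<partial>N)"
    and "integrable N (\<lambda>x. (\<Sum>i\<in>I. V x i * y i)\<^sup>2)"
proof -
  have sq: "(\<Sum>i\<in>I. V x i * y i)\<^sup>2 = (\<Sum>i\<in>I. \<Sum>j\<in>I. (y i * y j) * (V x i * V x j))" for x
    unfolding power2_eq_square sum_product by (intro sum.cong refl) simp
  have int: "integrable N (\<lambda>x. (y i * y j) * (V x i * V x j))" if "i \<in> I" "j \<in> I" for i j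
    using assms that by (intro integrable_mult_right) auto
  have "(\<integral>x. (\<Sum>i\<in>I. V x i * y i)\<^sup>2 \<partial>N) = (\<Sum>i\<in>I. \<integral>x. (\<Sum>j\<in>I. (y i * y j) * (V x i * V x j)) \<partial>N)"
    unfolding sq by (intro Bochner_Integration.integral_sum Bochner_Integration.integrable_sum int)
  also have "\<dots> = (\<Sum>i\<in>I. \<Sum>j\<in>I. \<integral>x. (y i * y j) * (V x i * V x j) \<partial>N)"
    by (intro sum.cong refl Bochner_Integration.integral_sum int)
  also have "\<dots> = bilin I (\<lambda>i j. \<integral>x. V x i * V x j \<partial>N) y y"
    by (simp add: bilin_def mult_ac)
  finally show "bilin I (\<lambda>i j. \<integral>x. V x i * V x j \<partial>N) y y = (\<integral>x. (\<Sum>i\<in>I. V x i * y i)\<^sup>2 \<partial>N)" ..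
  show "integrable N (\<lambda>x. (\<Sum>i\<in>I. V x i * y i)\<^sup>2)"
    unfolding sq using int by (intro Bochner_Integration.integrable_sum) auto
qed

text \<open>\<open>L\<close> plays the role of the logarithm of the expected exponential of
  \<open>t v v^T\<close>. Quantifying over all \<open>H\<close> lets samples be integrated out one
  by one, with the rest of the sum absorbed in \<open>H\<close>; the bound on quadratic forms is the
  part that can be added over samples.\<close>

definition mgf_dominated ::
    "'i set \<Rightarrow> real \<Rightarrow> 'b measure \<Rightarrow> ('b \<Rightarrow> 'i \<Rightarrow> real) \<Rightarrow> ('i \<Rightarrow> 'i \<Rightarrow> real) \<Rightarrow> bool" where
  "mgf_dominated I t N V L \<longleftrightarrow> (\<forall>i j. L i j = L j i) \<and>
    (\<forall>y. bilin I L y y \<le> (exp t - 1) * bilin I (\<lambda>i j. \<integral>x. V x i * V x j \<partial>N) y y) \<and>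
    (\<forall>H. (\<forall>i\<in>I. \<forall>j\<in>I. H i j = H j i) \<longrightarrow>
       (\<integral>\<^sup>+x. ennreal (trace_exp I (\<lambda>i j. H i j + t * (V x i * V x j))) \<partial>N)
       \<le> ennreal (trace_exp I (\<lambda>i j. H i j + L i j)))"

text \<open>A unit or zero vector makes \<open>v v^T\<close> a projection, so
  \<open>exp (t v v^T) = 1 + c v v^T\<close> is affine in it. The tangent functional taken at the
  expectation \<open>1 + c M\<close> therefore integrates exactly, and
  \<open>L = ln (1 + c M)\<close> works; \<open>ln (1 + x) <= x\<close> gives the bound on
  forms.\<close>

lemma rank_one_mgf_step:
  fixes V :: "'b \<Rightarrow> 'i \<Rightarrow> real" and t :: real
  assumes I: "finite I" and N: "prob_space N"
    and V: "\<And>i. i \<in> I \<Longrightarrow> (\<lambda>x. V x i) \<in> borel_measurable N"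
    and unit: "\<And>x. x \<in> space N \<Longrightarrow> (\<Sum>i\<in>I. (V x i)\<^sup>2) \<in> {0, 1}"
  shows "\<exists>L. mgf_dominated I t N V L"
proof -
  interpret prob_space N by fact
  define c where "c = exp t - 1"
  define M where "M i j = (\<integral>x. V x i * V x j \<partial>N)" for i j
  have Vb: "\<bar>V x i\<bar> \<le> 1" if "x \<in> space N" "i \<in> I" for x i
  proof -
    have "(V x i)\<^sup>2 \<le> (\<Sum>i\<in>I. (V x i)\<^sup>2)" using I that by (intro member_le_sum) auto
    also have "\<dots> \<le> 1" using unit[OF that(1)] by auto
    finally show ?thesis by (simp add: abs_square_le_1)
  qed
  have int: "integrable N (\<lambda>x. V x i * V x j)" if "i \<in> I" "j \<in> I" for i j
  proof (rule integrable_const_bound[where B = 1])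
    show "AE x in N. norm (V x i * V x j) \<le> 1"
      using Vb that by (auto simp: abs_mult intro!: AE_I2 mult_le_one)
  qed (use V that in auto)
  have "M i j = M j i" for i j by (simp add: M_def mult.commute)
  then obtain h m where h: "orthobasis I h" and Mh: "\<And>i j. i \<in> I \<Longrightarrow> j \<in> I \<Longrightarrow> M i j = spec_mat I h m i j"
    using spectral_theorem[OF I, of M] by blast
  have Mbil: "bilin I M y y = (\<integral>x. (\<Sum>i\<in>I. V x i * y i)\<^sup>2 \<partial>N)" for y
    unfolding M_def[abs_def] by (rule bilin_integral(1)[OF int])
  have m01: "0 \<le> m k" "m k \<le> 1" if k: "k \<in> I" for k
  proof -
    have "m k = bilin I M (h k) (h k)"
      using bilin_spec_eigenvectors[OF I h k k, of m] bilin_cong[of I "h k" "h k" "h k" "h k" M "spec_mat I h m"] Mh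
      by simp
    also have "\<dots> = (\<integral>x. (\<Sum>i\<in>I. V x i * h k i)\<^sup>2 \<partial>N)" by (rule Mbil)
    finally have mk: "m k = (\<integral>x. (\<Sum>i\<in>I. V x i * h k i)\<^sup>2 \<partial>N)" .
    show "0 \<le> m k" unfolding mk by simp
    have "(\<Sum>i\<in>I. V x i * h k i)\<^sup>2 \<le> 1" if x: "x \<in> space N" for x
    proof -
      have "(\<Sum>i\<in>I. V x i * h k i)\<^sup>2 \<le> (\<Sum>k\<in>I. (\<Sum>i\<in>I. V x i * h k i)\<^sup>2)"
        using I k by (intro member_le_sum) auto
      also have "\<dots> = (\<Sum>i\<in>I. (V x i)\<^sup>2)"
        using parseval'[OF I h, of "V x" "V x"] by (simp add: power2_eq_square)
      finally show ?thesis using unit[OF x] by auto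
    qed
    then have "(\<integral>x. (\<Sum>i\<in>I. V x i * h k i)\<^sup>2 \<partial>N) \<le> (\<integral>x. 1 \<partial>N)"
      by (intro integral_mono bilin_integral(2) int) auto
    then show "m k \<le> 1" unfolding mk by (simp add: prob_space)
  qed
  \<comment> \<open>For negative \<open>t\<close> the factor \<open>c\<close> is negative too; as a
    convex combination of 1 and \<open>exp t\<close> the eigenvalue is still positive.\<close>
  have cpos: "1 + c * m k > 0" if "k \<in> I" for k
  proof -
    have "1 + c * m k = (1 - m k) + exp t * m k" by (simp add: c_def algebra_simps)
    moreover have "exp t * m k \<ge> 0" "m k = 1 \<longrightarrow> exp t * m k > 0" using m01[OF that] by auto
    ultimately show ?thesis using m01(2)[OF that] by (cases "m k = 1") linarith+
  qed
  define L where "L = spec_mat I h (\<lambda>k. ln (1 + c * m k))"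
  have "mgf_dominated I t N V L"
    unfolding mgf_dominated_def
  proof (intro conjI allI impI)
    show "L i j = L j i" for i j unfolding L_def by (rule spec_mat_sym)
    show "bilin I L y y \<le> (exp t - 1) * bilin I (\<lambda>i j. \<integral>x. V x i * V x j \<partial>N) y y" for y
    proof -
      have "bilin I (\<lambda>i j. \<integral>x. V x i * V x j \<partial>N) y y = bilin I (spec_mat I h m) y y"
        using Mh by (intro bilin_cong) (auto simp: M_def)
      moreover have "bilin I L y y \<le> c * bilin I (spec_mat I h m) y y"
        unfolding L_def bilin_spec sum_distrib_left[of c]
      proof (rule sum_mono)
        fix k assume "k \<in> I"
        then have "ln (1 + c * m k) \<le> c * m k" using ln_le_minus_one[OF cpos] by simp
        then show "ln (1 + c * m k) * ((\<Sum>i\<in>I. h k i * y i) * (\<Sum>i\<in>I. h k i * y i))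
          \<le> c * (m k * ((\<Sum>i\<in>I. h k i * y i) * (\<Sum>i\<in>I. h k i * y i)))"
          unfolding mult.assoc[symmetric, of c] by (rule mult_right_mono) simp
      qed
      ultimately show ?thesis by (simp add: c_def)
    qed
    fix H :: "'i \<Rightarrow> 'i \<Rightarrow> real" assume "\<forall>i\<in>I. \<forall>j\<in>I. H i j = H j i"
    then have H: "\<And>i j. i \<in> I \<Longrightarrow> j \<in> I \<Longrightarrow> H i j = H j i" by blast
    obtain D where D1: "\<And>f a. orthobasis I f \<Longrightarrow> (\<And>i. i \<in> I \<Longrightarrow> a i > 0) \<Longrightarrow>
       trace_exp I (\<lambda>i j. H i j + spec_mat I f (\<lambda>k. ln (a k)) i j) \<le> trace_prod I D (spec_mat I f a)"
      and D2: "trace_prod I D (spec_mat I h (\<lambda>k. 1 + c * m k)) = trace_exp I (\<lambda>i j. H i j + L i j)"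
      using trace_exp_log_tangent[of I H h "\<lambda>k. 1 + c * m k", OF I H h cpos] unfolding L_def by blast
    define Q where "Q x = trace_prod I D (\<lambda>i j. (if i = j then 1 else 0) + c * (V x i * V x j))" for x
    have lin: "spec_mat I f (\<lambda>k. 1 + c * l k) i j = (if i = j then 1 else 0) + c * spec_mat I f l i j"
      if "orthobasis I f" "i \<in> I" "j \<in> I" for f l i j
      unfolding spec_one[OF that, symmetric]
      by (simp add: spec_mat_def sum_distrib_left sum.distrib[symmetric] algebra_simps)
    have le: "trace_exp I (\<lambda>i j. H i j + t * (V x i * V x j)) \<le> Q x" if x: "x \<in> space N" for x
    proof -
      obtain f l where f: "orthobasis I f" and P: "\<And>i j. i \<in> I \<Longrightarrow> j \<in> I \<Longrightarrow> V x i * V x j = spec_mat I f l i j"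
        using spectral_theorem[OF I, of "\<lambda>i j. V x i * V x j"] by (auto simp: mult.commute)
      have sq: "V x i * V x j = spec_mat I f (\<lambda>k. l k * l k) i j" if ij: "i \<in> I" "j \<in> I" for i j
      proof -
        have "spec_mat I f (\<lambda>k. l k * l k) i j = (\<Sum>n\<in>I. (V x i * V x n) * (V x n * V x j))"
          unfolding spec_mult[OF I f, symmetric] using ij by (intro sum.cong) (auto simp: P)
        also have "\<dots> = V x i * V x j * (\<Sum>n\<in>I. (V x n)\<^sup>2)"
          by (simp add: sum_distrib_left power2_eq_square mult_ac)
        also have "\<dots> = V x i * V x j"
          using unit[OF x] I ij by (auto simp: sum_nonneg_eq_0_iff)
        finally show ?thesis by simp
      qed
      \<comment> \<open>An idempotent symmetric matrix has eigenvalues 0 and 1 only, and there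
        \<open>ln (1 + c * x)\<close> agrees with \<open>t * x\<close>.\<close>
      have l01: "l k = 0 \<or> l k = 1" if k: "k \<in> I" for k
      proof -
        have "bilin I (spec_mat I f l) (f k) (f k) = bilin I (spec_mat I f (\<lambda>k. l k * l k)) (f k) (f k)"
          using P sq by (intro bilin_cong) auto
        then show ?thesis using k by (simp add: bilin_spec_eigenvectors[OF I f])
      qed
      have ln_eq: "ln (1 + c * l k) = t * l k" "1 + c * l k > 0" if "k \<in> I" for k
        using l01[OF that] by (auto simp: c_def)
      have "spec_mat I f (\<lambda>k. ln (1 + c * l k)) i j = t * (V x i * V x j)" if "i \<in> I" "j \<in> I" for i j
        unfolding P[OF that] by (simp add: spec_mat_def sum_distrib_left ln_eq mult_ac cong: sum.cong)
      then have "trace_exp I (\<lambda>i j. H i j + t * (V x i * V x j))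
          = trace_exp I (\<lambda>i j. H i j + spec_mat I f (\<lambda>k. ln (1 + c * l k)) i j)"
        by (intro trace_exp_cong) simp
      also have "\<dots> \<le> trace_prod I D (spec_mat I f (\<lambda>k. 1 + c * l k))"
        by (rule D1[OF f ln_eq(2)])
      also have "\<dots> = Q x" unfolding Q_def by (intro trace_prod_cong) (simp add: lin[OF f] P)
      finally show ?thesis .
    qed
    have nonneg: "trace_exp I (\<lambda>i j. H i j + t * (V x i * V x j)) \<ge> 0" for x
      using H by (intro trace_exp_nonneg[OF I]) (simp add: mult.commute)
    have int': "integrable N (\<lambda>x. D i j * ((if i = j then 1 else 0) + c * (V x i * V x j)))"
      if "i \<in> I" "j \<in> I" for i j
      by (intro integrable_mult_right Bochner_Integration.integrable_add integrable_const int that)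
    have intQ: "integrable N Q"
      unfolding Q_def[abs_def] trace_prod_def
      by (intro Bochner_Integration.integrable_sum int')
    have "(\<integral>x. Q x \<partial>N) = (\<Sum>i\<in>I. \<integral>x. (\<Sum>j\<in>I. D i j * ((if i = j then 1 else 0) + c * (V x i * V x j))) \<partial>N)"
      unfolding Q_def trace_prod_def
      by (intro Bochner_Integration.integral_sum Bochner_Integration.integrable_sum int')
    also have "\<dots> = (\<Sum>i\<in>I. \<Sum>j\<in>I. \<integral>x. D i j * ((if i = j then 1 else 0) + c * (V x i * V x j)) \<partial>N)"
      by (intro sum.cong refl Bochner_Integration.integral_sum int')
    also have "\<dots> = trace_prod I D (\<lambda>i j. (if i = j then 1 else 0) + c * M i j)"
      unfolding trace_prod_def M_def using int
    proof (intro sum.cong refl)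
      fix i j assume "i \<in> I" "j \<in> I"
      then have "(\<integral>x. ((if i = j then 1 else 0) + c * (V x i * V x j)) \<partial>N)
          = (\<integral>x. (if i = j then 1 else 0) \<partial>N) + (\<integral>x. c * (V x i * V x j) \<partial>N)"
        using int by (intro Bochner_Integration.integral_add) auto
      then show "(\<integral>x. D i j * ((if i = j then 1 else 0) + c * (V x i * V x j)) \<partial>N)
          = D i j * ((if i = j then 1 else 0) + c * (\<integral>x. V x i * V x j \<partial>N))"
        by (simp add: prob_space)
    qed
    also have "\<dots> = trace_prod I D (spec_mat I h (\<lambda>k. 1 + c * m k))"
      by (intro trace_prod_cong) (simp add: lin[OF h] Mh)
    finally have EQ: "(\<integral>x. Q x \<partial>N) = trace_exp I (\<lambda>i j. H i j + L i j)" using D2 by simp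
    have "(\<integral>\<^sup>+x. ennreal (trace_exp I (\<lambda>i j. H i j + t * (V x i * V x j))) \<partial>N) \<le> (\<integral>\<^sup>+x. ennreal (Q x) \<partial>N)"
      by (intro nn_integral_mono ennreal_leI le)
    also have "\<dots> = ennreal (\<integral>x. Q x \<partial>N)"
      using intQ le nonneg by (intro nn_integral_eq_integral AE_I2) (auto intro: order_trans)
    finally show "(\<integral>\<^sup>+x. ennreal (trace_exp I (\<lambda>i j. H i j + t * (V x i * V x j))) \<partial>N)
       \<le> ennreal (trace_exp I (\<lambda>i j. H i j + L i j))" unfolding EQ .
  qed
  then show ?thesis by blast
qed

lemma trace_exp_le:
  assumes I: "finite I" and S: "\<And>i j. i \<in> I \<Longrightarrow> j \<in> I \<Longrightarrow> S i j = S j i"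
    and B: "\<And>y. bilin I S y y \<le> B * (\<Sum>i\<in>I. (y i)\<^sup>2)"
  shows "trace_exp I S \<le> real (card I) * exp B"
proof -
  obtain e l where e: "orthobasis I e" and l: "\<And>i j. i \<in> I \<Longrightarrow> j \<in> I \<Longrightarrow> S i j = spec_mat I e l i j"
    using spectral_theorem[of I S] I S by blast
  have "l k \<le> B" if k: "k \<in> I" for k
  proof -
    have "l k = bilin I S (e k) (e k)"
      using bilin_spec_eigenvectors[OF I e k k, of l] bilin_cong[of I "e k" "e k" "e k" "e k" S "spec_mat I e l"] l
      by simp
    also have "\<dots> \<le> B * (\<Sum>i\<in>I. (e k i)\<^sup>2)" by (rule B)
    finally show ?thesis using orthobasis_rows[OF e k k] by (simp add: power2_eq_square)
  qed
  then have "(\<Sum>k\<in>I. exp (l k)) \<le> (\<Sum>k\<in>I. exp B)" by (intro sum_mono) simp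
  then show ?thesis by (subst trace_exp_spec[OF I e l]) auto
qed

lemma trace_exp_ge:
  assumes I: "finite I" and e: "orthobasis I e" and l: "\<And>i j. i \<in> I \<Longrightarrow> j \<in> I \<Longrightarrow> S i j = spec_mat I e l i j"
    and k: "k \<in> I" "l k \<ge> B"
  shows "trace_exp I S \<ge> exp B"
proof -
  have "exp B \<le> exp (l k)" using k by simp
  also have "\<dots> \<le> (\<Sum>k\<in>I. exp (l k))" using I k by (intro member_le_sum) auto
  also have "\<dots> = trace_exp I S" using trace_exp_spec[OF I e l] by simp
  finally show ?thesis .
qed

text \<open>Induction over the samples: fixing the newest one moves its term into \<open>H\<close>,
  the induction hypothesis integrates the others, and the one-sample bound then replaces the
  remaining random term by its \<open>L\<close>.\<close>

lemma rank_one_mgf_product: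
  fixes V :: "'k \<Rightarrow> 'b \<Rightarrow> 'i \<Rightarrow> real" and t :: real
  assumes I: "finite I" and J: "finite J" and N: "\<And>k. prob_space (N k)"
    and V: "\<And>k i. k \<in> J \<Longrightarrow> i \<in> I \<Longrightarrow> (\<lambda>x. V k x i) \<in> borel_measurable (N k)"
    and L: "\<And>k i j. L k i j = L k j i"
    and step: "\<And>k H. k \<in> J \<Longrightarrow> (\<And>i j. i \<in> I \<Longrightarrow> j \<in> I \<Longrightarrow> H i j = H j i) \<Longrightarrow>
       (\<integral>\<^sup>+x. ennreal (trace_exp I (\<lambda>i j. H i j + t * (V k x i * V k x j))) \<partial>N k)
       \<le> ennreal (trace_exp I (\<lambda>i j. H i j + L k i j))"
    and H: "\<And>i j. i \<in> I \<Longrightarrow> j \<in> I \<Longrightarrow> H i j = H j i"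
  shows "(\<integral>\<^sup>+\<omega>. ennreal (trace_exp I (\<lambda>i j. H i j + (\<Sum>k\<in>J. t * (V k (\<omega> k) i * V k (\<omega> k) j)))) \<partial>Pi\<^sub>M J N)
     \<le> ennreal (trace_exp I (\<lambda>i j. H i j + (\<Sum>k\<in>J. L k i j)))"
  using J V step H
proof (induction J arbitrary: H rule: finite_induct)
  case empty
  interpret product_prob_space N "{}" by (intro product_prob_spaceI N)
  show ?case by (simp add: PiM_empty nn_integral_count_space_finite)
next
  case (insert k J)
  interpret product_prob_space N "insert k J" by (intro product_prob_spaceI N)
  have meas: "(\<lambda>\<omega>. V k' (\<omega> k') i) \<in> borel_measurable (Pi\<^sub>M (insert k J) N)" if "k' \<in> insert k J" "i \<in> I" for k' i
    using insert.prems(1)[OF that] that(1) by measurable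
  have "(\<integral>\<^sup>+\<omega>. ennreal (trace_exp I (\<lambda>i j. H i j + (\<Sum>k\<in>insert k J. t * (V k (\<omega> k) i * V k (\<omega> k) j)))) \<partial>Pi\<^sub>M (insert k J) N)
    = (\<integral>\<^sup>+y. (\<integral>\<^sup>+\<omega>. ennreal (trace_exp I (\<lambda>i j. H i j + (\<Sum>k'\<in>insert k J. t * (V k' ((\<omega> (k := y)) k') i * V k' ((\<omega> (k := y)) k') j)))) \<partial>Pi\<^sub>M J N) \<partial>N k)"
    using insert.hyps
    by (intro product_nn_integral_insert_rev measurable_compose[OF _ measurable_ennreal] trace_exp_measurable
        borel_measurable_add borel_measurable_sum borel_measurable_times meas) auto
  also have "\<dots> = (\<integral>\<^sup>+y. (\<integral>\<^sup>+\<omega>. ennreal (trace_exp I (\<lambda>i j. (H i j + t * (V k y i * V k y j)) + (\<Sum>k'\<in>J. t * (V k' (\<omega> k') i * V k' (\<omega> k') j)))) \<partial>Pi\<^sub>M J N) \<partial>N k)"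
  proof -
    have "(\<Sum>k'\<in>J. t * (V k' ((\<omega> (k := y)) k') i * V k' ((\<omega> (k := y)) k') j)) = (\<Sum>k'\<in>J. t * (V k' (\<omega> k') i * V k' (\<omega> k') j))" for \<omega> y i j
      using insert.hyps by (intro sum.cong) auto
    then show ?thesis using insert.hyps by (simp add: add.assoc)
  qed
  also have "\<dots> \<le> (\<integral>\<^sup>+y. ennreal (trace_exp I (\<lambda>i j. (H i j + t * (V k y i * V k y j)) + (\<Sum>k'\<in>J. L k' i j))) \<partial>N k)"
  proof (intro nn_integral_mono insert.IH)
    show "H i j + t * (V k y i * V k y j) = H j i + t * (V k y j * V k y i)" if "i \<in> I" "j \<in> I" for y i j
      using insert.prems(3)[OF that] by (simp add: mult.commute)
  qed (blast intro: insert.prems(1), rule insert.prems(2), blast+)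
  also have "\<dots> = (\<integral>\<^sup>+y. ennreal (trace_exp I (\<lambda>i j. (H i j + (\<Sum>k'\<in>J. L k' i j)) + t * (V k y i * V k y j))) \<partial>N k)"
    by (simp add: add_ac)
  also have "\<dots> \<le> ennreal (trace_exp I (\<lambda>i j. (H i j + (\<Sum>k'\<in>J. L k' i j)) + L k i j))"
    using insert.prems(3) L by (intro insert.prems(2)) (auto intro!: arg_cong2[of _ _ _ _ "(+)"] sum.cong)
  also have "\<dots> = ennreal (trace_exp I (\<lambda>i j. H i j + (\<Sum>k\<in>insert k J. L k i j)))"
    using insert.hyps by (simp add: add_ac)
  finally show ?case .
qed

text \<open>The single \<open>L k\<close> stay unknown: only the sum of their quadratic forms
  enters. It is at most \<open>exp t - 1\<close> times the total second moment, which isotropy makes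
  a multiple of the identity. The argument covers both signs of \<open>t\<close>.\<close>

theorem rank_one_mgf_bound:
  fixes V :: "'k \<Rightarrow> 'b \<Rightarrow> 'i \<Rightarrow> real" and t :: real
  assumes I: "finite I" and J: "finite J" and N: "\<And>k. prob_space (N k)"
    and V: "\<And>k i. k \<in> J \<Longrightarrow> i \<in> I \<Longrightarrow> (\<lambda>x. V k x i) \<in> borel_measurable (N k)"
    and unit: "\<And>k x. k \<in> J \<Longrightarrow> x \<in> space (N k) \<Longrightarrow> (\<Sum>i\<in>I. (V k x i)\<^sup>2) \<in> {0, 1}"
    and iso: "\<And>i j. i \<in> I \<Longrightarrow> j \<in> I \<Longrightarrow>
       (\<Sum>k\<in>J. \<integral>x. V k x i * V k x j \<partial>N k) = (if i = j then \<tau> else 0)"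
  shows "(\<integral>\<^sup>+\<omega>. ennreal (trace_exp I (\<lambda>i j. \<Sum>k\<in>J. t * (V k (\<omega> k) i * V k (\<omega> k) j))) \<partial>Pi\<^sub>M J N)
     \<le> ennreal (real (card I) * exp ((exp t - 1) * \<tau>))"
proof -
  have "\<exists>L. mgf_dominated I t (N k) (V k) L" if "k \<in> J" for k
    using rank_one_mgf_step[OF I N V[OF that] unit[OF that]] .
  then obtain L0 where "\<And>k. k \<in> J \<Longrightarrow> mgf_dominated I t (N k) (V k) (L0 k)"
    by metis
  note L0 = this[unfolded mgf_dominated_def]
  \<comment> \<open>Extended by zero because the product lemma demands symmetry at every index, not
    only on \<open>J\<close>.\<close>
  define L where "L k = (if k \<in> J then L0 k else (\<lambda>_ _. 0))" for k
  have Lsym: "L k i j = L k j i" for k i j using L0[of k] by (auto simp: L_def)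
  have "(\<integral>\<^sup>+\<omega>. ennreal (trace_exp I (\<lambda>i j. 0 + (\<Sum>k\<in>J. t * (V k (\<omega> k) i * V k (\<omega> k) j)))) \<partial>Pi\<^sub>M J N)
     \<le> ennreal (trace_exp I (\<lambda>i j. 0 + (\<Sum>k\<in>J. L k i j)))"
  proof (rule rank_one_mgf_product[OF I J N V Lsym])
    fix k and H :: "'i \<Rightarrow> 'i \<Rightarrow> real"
    assume k: "k \<in> J" and H: "\<And>i j. i \<in> I \<Longrightarrow> j \<in> I \<Longrightarrow> H i j = H j i"
    then show "(\<integral>\<^sup>+x. ennreal (trace_exp I (\<lambda>i j. H i j + t * (V k x i * V k x j))) \<partial>N k)
       \<le> ennreal (trace_exp I (\<lambda>i j. H i j + L k i j))"
      using L0[OF k] by (simp add: L_def)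
  qed auto
  also have "\<dots> \<le> ennreal (real (card I) * exp ((exp t - 1) * \<tau>))"
  proof (intro ennreal_leI trace_exp_le[OF I])
    show "0 + (\<Sum>k\<in>J. L k i j) = 0 + (\<Sum>k\<in>J. L k j i)" for i j
      by (simp add: Lsym[of _ i j])
    have bsum: "bilin I (\<lambda>i j. \<Sum>k\<in>J. S k i j) y y = (\<Sum>k\<in>J. bilin I (S k) y y)" for S :: "'k \<Rightarrow> 'i \<Rightarrow> 'i \<Rightarrow> real" and y
      unfolding bilin_def sum_distrib_left sum_distrib_right by (rule sum_swap3)
    fix y
    have "bilin I (\<lambda>i j. 0 + (\<Sum>k\<in>J. L k i j)) y y = (\<Sum>k\<in>J. bilin I (L k) y y)"
      by (simp add: bsum)
    also have "\<dots> \<le> (\<Sum>k\<in>J. (exp t - 1) * bilin I (\<lambda>i j. \<integral>x. V k x i * V k x j \<partial>N k) y y)"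
      using L0 by (intro sum_mono) (simp add: L_def)
    also have "\<dots> = (exp t - 1) * bilin I (\<lambda>i j. \<Sum>k\<in>J. \<integral>x. V k x i * V k x j \<partial>N k) y y"
      by (simp add: bsum sum_distrib_left)
    also have "bilin I (\<lambda>i j. \<Sum>k\<in>J. \<integral>x. V k x i * V k x j \<partial>N k) y y = bilin I (\<lambda>i j. if i = j then \<tau> else 0) y y"
      by (intro bilin_cong iso) auto
    also have "\<dots> = \<tau> * (\<Sum>i\<in>I. (y i)\<^sup>2)"
    proof -
      have "y i * (if i = j then \<tau> else 0) * y j = (if i = j then y i * \<tau> * y i else 0)" for i j by simp
      then show ?thesis using I
        by (simp add: bilin_def sum_distrib_left power2_eq_square mult_ac)
    qed
    finally show "bilin I (\<lambda>i j. 0 + (\<Sum>k\<in>J. L k i j)) y y \<le> (exp t - 1) * \<tau> * (\<Sum>i\<in>I. (y i)\<^sup>2)"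
      by (simp add: mult.assoc)
  qed
  finally show ?thesis by simp
qed

subsection \<open>Spectral norm, second moments and label counts\<close>

lemma norm_spec_mat_vec:
  assumes I: "finite I" and e: "orthobasis I e"
    and A: "\<And>i j. i \<in> I \<Longrightarrow> j \<in> I \<Longrightarrow> A i j = spec_mat I e l i j"
  shows "(\<Sum>i\<in>I. (\<Sum>j\<in>I. A i j * v j)\<^sup>2) = (\<Sum>k\<in>I. (l k)\<^sup>2 * (\<Sum>j\<in>I. e k j * v j)\<^sup>2)"
proof -
  have et: "orthobasis I (\<lambda>i k. e k i)" using e orthobasis_transpose by blast
  have Av: "(\<Sum>j\<in>I. A i j * v j) = (\<Sum>k\<in>I. e k i * (l k * (\<Sum>j\<in>I. e k j * v j)))" if "i \<in> I" for i
  proof -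
    have "(\<Sum>j\<in>I. A i j * v j) = (\<Sum>j\<in>I. \<Sum>k\<in>I. e k i * (l k * (e k j * v j)))"
      using A[OF that] by (intro sum.cong) (auto simp: spec_mat_def sum_distrib_right sum_distrib_left mult_ac)
    then show ?thesis by (subst (asm) sum.swap) (simp add: sum_distrib_left)
  qed
  have "(\<Sum>i\<in>I. (\<Sum>j\<in>I. A i j * v j)\<^sup>2)
    = (\<Sum>i\<in>I. (\<Sum>k\<in>I. e k i * (l k * (\<Sum>j\<in>I. e k j * v j))) * (\<Sum>k\<in>I. e k i * (l k * (\<Sum>j\<in>I. e k j * v j))))"
    unfolding power2_eq_square by (intro sum.cong arg_cong2[of _ _ _ _ "(*)"] Av) auto
  also have "\<dots> = (\<Sum>k\<in>I. (l k * (\<Sum>j\<in>I. e k j * v j)) * (l k * (\<Sum>j\<in>I. e k j * v j)))"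
    by (rule parseval[OF I et])
  finally show ?thesis by (simp add: power2_eq_square mult_ac)
qed

lemma spec_norm_le_iff:
  assumes e: "orthobasis {1..n} e" and r: "0 \<le> r"
    and A: "\<And>i j. i \<in> {1..n} \<Longrightarrow> j \<in> {1..n} \<Longrightarrow> A i j = spec_mat {1..n} e l i j"
  shows "spec_norm n A \<le> r \<longleftrightarrow> (\<forall>k\<in>{1..n}. \<bar>l k\<bar> \<le> r)"
proof -
  let ?I = "{1..n}"
  let ?B = "{v :: nat \<Rightarrow> real. (\<Sum>j=1..n. (v j)\<^sup>2) \<le> 1}"
  let ?f = "\<lambda>v :: nat \<Rightarrow> real. sqrt (\<Sum>i=1..n. (\<Sum>j=1..n. A i j * v j)\<^sup>2)"
  note N = norm_spec_mat_vec[OF finite_atLeastAtMost e A]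
  have pars: "(\<Sum>k\<in>?I. (\<Sum>j\<in>?I. e k j * v j)\<^sup>2) = (\<Sum>j\<in>?I. (v j)\<^sup>2)" for v
    using parseval[OF finite_atLeastAtMost e, of v v] by (simp add: power2_eq_square)
  have bound: "?f v \<le> R" if "\<And>k. k \<in> ?I \<Longrightarrow> \<bar>l k\<bar> \<le> R" "0 \<le> R" "v \<in> ?B" for v R
  proof -
    have "(\<Sum>k\<in>?I. (l k)\<^sup>2 * (\<Sum>j\<in>?I. e k j * v j)\<^sup>2) \<le> (\<Sum>k\<in>?I. R\<^sup>2 * (\<Sum>j\<in>?I. e k j * v j)\<^sup>2)"
      using that(1,2) by (intro sum_mono mult_right_mono) (auto simp: abs_le_square_iff[symmetric])
    also have "\<dots> = R\<^sup>2 * (\<Sum>j\<in>?I. (v j)\<^sup>2)" by (simp only: sum_distrib_left[symmetric] pars)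
    also have "\<dots> \<le> R\<^sup>2 * 1" using that(3) by (intro mult_left_mono) auto
    finally have "sqrt (\<Sum>k\<in>?I. (l k)\<^sup>2 * (\<Sum>j\<in>?I. e k j * v j)\<^sup>2) \<le> R"
      using that(2) by (intro real_le_lsqrt) auto
    then show ?thesis by (simp only: N)
  qed
  \<comment> \<open>A real supremum says something only for a bounded set; the sum of the absolute
    eigenvalues is a crude common bound.\<close>
  have bdd: "bdd_above (?f ` ?B)"
  proof (rule bdd_aboveI2)
    fix v assume v: "v \<in> ?B"
    show "?f v \<le> (\<Sum>k\<in>?I. \<bar>l k\<bar>)"
      by (rule bound[OF _ _ v]) (auto intro: member_le_sum sum_nonneg)
  qed
  show ?thesis
  proof
    assume le: "spec_norm n A \<le> r"
    show "\<forall>k\<in>?I. \<bar>l k\<bar> \<le> r"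
    proof
      fix k assume k: "k \<in> ?I"
      have "e k \<in> ?B" using orthobasis_rows[OF e k k] by (simp add: power2_eq_square)
      then have "?f (e k) \<le> spec_norm n A"
        unfolding spec_norm_def by (intro cSUP_upper bdd)
      moreover have "(\<Sum>k'\<in>?I. (l k')\<^sup>2 * (\<Sum>j\<in>?I. e k' j * e k j)\<^sup>2) = (\<Sum>k'\<in>?I. if k' = k then (l k)\<^sup>2 else 0)"
        using k orthobasis_rows[OF e] by (intro sum.cong) auto
      then have "?f (e k) = \<bar>l k\<bar>" using k by (simp only: N) simp
      ultimately show "\<bar>l k\<bar> \<le> r" using le by simp
    qed
  next
    assume "\<forall>k\<in>?I. \<bar>l k\<bar> \<le> r"
    then show "spec_norm n A \<le> r"
      unfolding spec_norm_def using r by (intro cSUP_least bound) (auto intro: exI[of _ "\<lambda>_. 0"])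
  qed
qed

text \<open>Serves measurability: traces of even powers are polynomials in the entries, so the event
  becomes a countable intersection. If some eigenvalue exceeds 1/2 in modulus, the powers of
  \<open>4 * (l k)^2\<close> outgrow \<open>n\<close> and the bound fails for large
  \<open>N\<close>.\<close>

lemma spec_norm_le_half_iff:
  assumes sym: "\<And>i j. i \<in> {1..n} \<Longrightarrow> j \<in> {1..n} \<Longrightarrow> A i j = A j i"
  shows "spec_norm n A \<le> 1/2 \<longleftrightarrow> (\<forall>N. (\<Sum>i=1..n. mat_pow {1..n} A (2 * N) i i) \<le> real n * (1/4) ^ N)"
proof -
  let ?I = "{1..n}"
  obtain e l where e: "orthobasis ?I e" and A: "\<And>i j. i \<in> ?I \<Longrightarrow> j \<in> ?I \<Longrightarrow> A i j = spec_mat ?I e l i j"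
    using spectral_theorem[of ?I A] sym by blast
  have tr: "(\<Sum>i=1..n. mat_pow ?I A (2 * N) i i) = (\<Sum>k\<in>?I. ((l k)\<^sup>2) ^ N)" for N
  proof -
    have "(\<Sum>i=1..n. mat_pow ?I A (2 * N) i i) = (\<Sum>i=1..n. spec_mat ?I e (\<lambda>k. l k ^ (2 * N)) i i)"
      using mat_pow_spec[OF finite_atLeastAtMost e A] by (intro sum.cong refl) blast
    then show ?thesis using trace_spec[OF e] by (simp add: power_mult)
  qed
  have half: "spec_norm n A \<le> 1/2 \<longleftrightarrow> (\<forall>k\<in>?I. \<bar>l k\<bar> \<le> 1/2)"
    by (rule spec_norm_le_iff[OF e _ A]) auto
  show ?thesis unfolding half tr
  proof (intro iffI allI ballI)
    fix N assume "\<forall>k\<in>?I. \<bar>l k\<bar> \<le> 1/2"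
    then have "(l k)\<^sup>2 \<le> 1/4" if "k \<in> ?I" for k
      using that abs_le_square_iff[of "l k" "1/2"] by (auto simp: power2_eq_square)
    then have "(\<Sum>k\<in>?I. ((l k)\<^sup>2) ^ N) \<le> (\<Sum>k\<in>?I. (1/4) ^ N)"
      by (intro sum_mono power_mono) auto
    then show "(\<Sum>k\<in>?I. ((l k)\<^sup>2) ^ N) \<le> real n * (1/4) ^ N" by simp
  next
    fix k assume le: "\<forall>N. (\<Sum>k\<in>?I. ((l k)\<^sup>2) ^ N) \<le> real n * (1/4) ^ N" and k: "k \<in> ?I"
    show "\<bar>l k\<bar> \<le> 1/2"
    proof (rule ccontr)
      assume "\<not> \<bar>l k\<bar> \<le> 1/2"
      then have "4 * (l k)\<^sup>2 > 1"
        using abs_le_square_iff[of "l k" "1/2"] by (auto simp: power2_eq_square)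
      then obtain N where N: "(4 * (l k)\<^sup>2) ^ N > real n" using real_arch_pow by blast
      have "((l k)\<^sup>2) ^ N \<le> (\<Sum>k\<in>?I. ((l k)\<^sup>2) ^ N)" using k by (intro member_le_sum) auto
      also have "\<dots> \<le> real n * (1/4) ^ N" using le by blast
      finally have "(4 * (l k)\<^sup>2) ^ N \<le> real n"
        by (simp add: power_mult_distrib power_one_over field_simps)
      then show False using N by simp
    qed
  qed
qed

lemma mat_pow_measurable:
  assumes "\<And>i j. i \<in> I \<Longrightarrow> j \<in> I \<Longrightarrow> (\<lambda>x. S x i j) \<in> borel_measurable M" "i \<in> I" "j \<in> I"
  shows "(\<lambda>x. mat_pow I (S x) k i j) \<in> borel_measurable M"
  using assms(2,3)
  by (induction k arbitrary: i j) (auto intro!: borel_measurable_sum borel_measurable_times assms(1))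

text \<open>By independence the left side is the squared mean plus the variances, each at most a
  second moment. The shift \<open>a\<close> is general so that the induction can absorb the sample
  that is held fixed.\<close>

lemma second_moment_sum_le:
  fixes Y :: "'k \<Rightarrow> 'b \<Rightarrow> real"
  assumes J: "finite J" and N: "\<And>k. prob_space (N k)"
    and Y: "\<And>k. k \<in> J \<Longrightarrow> Y k \<in> borel_measurable (N k)"
    and Y2: "\<And>k. k \<in> J \<Longrightarrow> integrable (N k) (\<lambda>x. (Y k x)\<^sup>2)"
  shows "(\<integral>\<^sup>+\<omega>. ennreal ((a + (\<Sum>k\<in>J. Y k (\<omega> k)))\<^sup>2) \<partial>Pi\<^sub>M J N)
    \<le> ennreal ((a + (\<Sum>k\<in>J. \<integral>x. Y k x \<partial>N k))\<^sup>2 + (\<Sum>k\<in>J. \<integral>x. (Y k x)\<^sup>2 \<partial>N k))"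
  using J Y Y2
proof (induction J arbitrary: a rule: finite_induct)
  case empty
  then show ?case by (simp add: PiM_empty nn_integral_count_space_finite)
next
  case (insert k J)
  interpret product_prob_space N "insert k J" by (intro product_prob_spaceI N)
  have meas: "(\<lambda>\<omega>. Y k' (\<omega> k')) \<in> borel_measurable (Pi\<^sub>M (insert k J) N)" if "k' \<in> insert k J" for k'
    using insert.prems(1)[OF that] that by measurable
  define s where "s = (\<Sum>k\<in>J. \<integral>x. Y k x \<partial>N k)"
  define v where "v = (\<Sum>k\<in>J. \<integral>x. (Y k x)\<^sup>2 \<partial>N k)"
  have v0: "v \<ge> 0" unfolding v_def by (intro sum_nonneg) simp
  have Yk2: "integrable (N k) (\<lambda>x. (Y k x)\<^sup>2)" and Ykm: "Y k \<in> borel_measurable (N k)"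
    using insert.prems by auto
  have Yk: "integrable (N k) (Y k)"
    by (rule finite_measure.square_integrable_imp_integrable[OF prob_space.finite_measure[OF N]])
       (use Yk2 Ykm in auto)
  have "(\<integral>\<^sup>+\<omega>. ennreal ((a + (\<Sum>k\<in>insert k J. Y k (\<omega> k)))\<^sup>2) \<partial>Pi\<^sub>M (insert k J) N)
    = (\<integral>\<^sup>+y. (\<integral>\<^sup>+\<omega>. ennreal ((a + (\<Sum>k'\<in>insert k J. Y k' ((\<omega> (k := y)) k')))\<^sup>2) \<partial>Pi\<^sub>M J N) \<partial>N k)"
    using insert.hyps
    by (intro product_nn_integral_insert_rev measurable_compose[OF _ measurable_ennreal] borel_measurable_power
        borel_measurable_add borel_measurable_sum meas) auto
  also have "\<dots> = (\<integral>\<^sup>+y. (\<integral>\<^sup>+\<omega>. ennreal (((a + Y k y) + (\<Sum>k'\<in>J. Y k' (\<omega> k')))\<^sup>2) \<partial>Pi\<^sub>M J N) \<partial>N k)"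
  proof -
    have "(\<Sum>k'\<in>J. Y k' ((\<omega> (k := y)) k')) = (\<Sum>k'\<in>J. Y k' (\<omega> k'))" for \<omega> y
      using insert.hyps by (intro sum.cong) auto
    then show ?thesis using insert.hyps by (simp add: add.assoc)
  qed
  also have "\<dots> \<le> (\<integral>\<^sup>+y. ennreal (((a + Y k y) + s)\<^sup>2 + v) \<partial>N k)"
    unfolding s_def v_def using insert.prems by (intro nn_integral_mono insert.IH) auto
  also have "\<dots> = ennreal (\<integral>y. ((a + Y k y) + s)\<^sup>2 + v \<partial>N k)"
  proof (rule nn_integral_eq_integral)
    have "integrable (N k) (\<lambda>y. ((a + s)\<^sup>2 + v) + (2 * (a + s)) * Y k y + (Y k y)\<^sup>2)"
      using Yk Yk2 by auto
    then show "integrable (N k) (\<lambda>y. ((a + Y k y) + s)\<^sup>2 + v)"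
      by (simp add: power2_eq_square algebra_simps)
  qed (use v0 in auto)
  also have "(\<integral>y. ((a + Y k y) + s)\<^sup>2 + v \<partial>N k) = (\<integral>y. ((a + s)\<^sup>2 + v) + (2 * (a + s)) * Y k y + (Y k y)\<^sup>2 \<partial>N k)"
    by (intro Bochner_Integration.integral_cong) (auto simp: power2_eq_square algebra_simps)
  also have "\<dots> = (a + s)\<^sup>2 + v + 2 * (a + s) * (\<integral>x. Y k x \<partial>N k) + (\<integral>x. (Y k x)\<^sup>2 \<partial>N k)"
    using Yk Yk2 by (simp add: prob_space.prob_space[OF N])
  also have "ennreal \<dots> \<le> ennreal ((a + ((\<integral>x. Y k x \<partial>N k) + s))\<^sup>2 + ((\<integral>x. (Y k x)\<^sup>2 \<partial>N k) + v))"
    by (rule ennreal_leI) (simp add: power2_eq_square algebra_simps)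
  finally show ?case using insert.hyps by (simp add: s_def v_def)
qed

text \<open>Pigeonhole: the classes with labels in \<open>{1..n}\<close> together contain
  \<open>\<tau> * n\<close> samples, which is all of them.\<close>

lemma label_range:
  fixes lab :: "nat \<Rightarrow> nat"
  assumes cnt: "\<And>j. j \<in> {1..n} \<Longrightarrow> card {i \<in> {1..\<tau> * n}. lab i = j} = \<tau>"
  shows "lab ` {1..\<tau> * n} \<subseteq> {1..n}"
proof -
  let ?U = "\<Union>j\<in>{1..n}. {i \<in> {1..\<tau> * n}. lab i = j}"
  have "card ?U = (\<Sum>j\<in>{1..n}. card {i \<in> {1..\<tau> * n}. lab i = j})"
    by (rule card_UN_disjoint) auto
  also have "\<dots> = card {1..\<tau> * n}" using cnt by simp
  finally have "?U = {1..\<tau> * n}" by (intro card_subset_eq) auto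
  then show ?thesis by blast
qed

lemma label_sum:
  fixes lab :: "nat \<Rightarrow> nat" and F :: "nat \<Rightarrow> real"
  assumes cnt: "\<And>j. j \<in> {1..n} \<Longrightarrow> card {i \<in> {1..\<tau> * n}. lab i = j} = \<tau>"
  shows "(\<Sum>i\<in>{1..\<tau> * n}. F (lab i)) = real \<tau> * (\<Sum>j\<in>{1..n}. F j)"
proof -
  have "(\<Sum>i\<in>{1..\<tau> * n}. F (lab i)) = (\<Sum>j\<in>{1..n}. \<Sum>i\<in>{i \<in> {1..\<tau> * n}. lab i = j}. F (lab i))"
    by (rule sum.group[symmetric]) (use label_range[OF cnt] in auto)
  also have "\<dots> = (\<Sum>j\<in>{1..n}. real \<tau> * F j)"
  proof (intro sum.cong refl)
    fix j assume j: "j \<in> {1..n}"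
    have "(\<Sum>i\<in>{i \<in> {1..\<tau> * n}. lab i = j}. F (lab i)) = (\<Sum>i\<in>{i \<in> {1..\<tau> * n}. lab i = j}. F j)"
      by (intro sum.cong) auto
    then show "(\<Sum>i\<in>{i \<in> {1..\<tau> * n}. lab i = j}. F (lab i)) = real \<tau> * F j"
      using cnt[OF j] by simp
  qed
  finally show ?thesis by (simp add: sum_distrib_left)
qed

section \<open>Square-integrable functions\<close>

lemma L2set_mult_integrable:
  assumes "f \<in> L2set \<rho>" "g \<in> L2set \<rho>"
  shows "integrable \<rho> (\<lambda>x. f x * g x)"
proof (rule Bochner_Integration.integrable_bound)
  show "integrable \<rho> (\<lambda>x. (f x)\<^sup>2 + (g x)\<^sup>2)" using assms by (auto simp: L2set_def)
  show "(\<lambda>x. f x * g x) \<in> borel_measurable \<rho>" using assms by (auto simp: L2set_def)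
  have "\<bar>a * b\<bar> \<le> a\<^sup>2 + b\<^sup>2" for a b :: real
  proof -
    have "0 \<le> (\<bar>a\<bar> - \<bar>b\<bar>)\<^sup>2" by simp
    then have "2 * \<bar>a * b\<bar> \<le> a\<^sup>2 + b\<^sup>2" by (simp add: power2_diff abs_mult)
    then show ?thesis by (smt (verit) abs_ge_zero)
  qed
  then show "AE x in \<rho>. norm (f x * g x) \<le> norm ((f x)\<^sup>2 + (g x)\<^sup>2)"
    by (auto intro: order_trans)
qed

lemma L2set_add: "f \<in> L2set \<rho> \<Longrightarrow> g \<in> L2set \<rho> \<Longrightarrow> (\<lambda>x. f x + g x) \<in> L2set \<rho>"
  using L2set_mult_integrable[of f \<rho> g] by (auto simp: L2set_def power2_sum mult.assoc)

lemma L2set_scale: "f \<in> L2set \<rho> \<Longrightarrow> (\<lambda>x. c * f x) \<in> L2set \<rho>"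
  by (auto simp: L2set_def power_mult_distrib)

lemma L2set_zero: "(\<lambda>x. 0) \<in> L2set \<rho>" by (simp add: L2set_def)

lemma L2set_sum: "(\<And>i. i \<in> I \<Longrightarrow> f i \<in> L2set \<rho>) \<Longrightarrow> (\<lambda>x. \<Sum>i\<in>I. f i x) \<in> L2set \<rho>"
  by (induction I rule: infinite_finite_induct) (auto intro: L2set_add L2set_zero)

lemma L2norm_sq: "(L2norm \<rho> f)\<^sup>2 = (\<integral>x. (f x)\<^sup>2 \<partial>\<rho>)"
  by (simp add: L2norm_def)

subsection \<open>Gram matrices of stratified samples\<close>

text \<open>
  One level of the construction. The index set \<open>J\<close> may contain samples of finer levels, which the level
  ignores; off \<open>J\<close> the measures \<open>N\<close> are arbitrary probability measures.
\<close>

locale stratified_sampling = prob_space \<rho> for \<rho> :: "'a measure" +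
  fixes \<psi> :: "nat \<Rightarrow> 'a \<Rightarrow> real" and n \<tau> :: nat and lab :: "nat \<Rightarrow> nat"
    and J :: "nat set" and N :: "nat \<Rightarrow> 'a measure"
  assumes onb: "L2_onb \<rho> \<psi>"
    and n_pos: "1 \<le> n" and tau_pos: "1 \<le> \<tau>"
    and nonvanishing: "\<And>x. x \<in> space \<rho> \<Longrightarrow> \<exists>i\<in>{1..n}. \<psi> i x \<noteq> 0"
    and J: "finite J" "{1..\<tau> * n} \<subseteq> J"
    and counts: "\<And>j. j \<in> {1..n} \<Longrightarrow> card {i \<in> {1..\<tau> * n}. lab i = j} = \<tau>"
    and N_prob: "\<And>k. prob_space (N k)"
    and N_sets: "\<And>k. sets (N k) = sets \<rho>"
    and N_chi: "\<And>k. k \<in> {1..\<tau> * n} \<Longrightarrow> N k = chi \<rho> \<psi> (lab k)"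
begin

abbreviation "P \<equiv> Pi\<^sub>M J N"

text \<open>The reciprocal of the Christoffel function of the space, and \<open>n\<close> times the
  density of the uniform mixture of the \<open>chi j\<close>.\<close>

definition christoffel :: "'a \<Rightarrow> real" where "christoffel x = (\<Sum>i=1..n. (\<psi> i x)\<^sup>2)"

definition good :: "(nat \<Rightarrow> 'a) \<Rightarrow> bool" where
  "good \<omega> \<longleftrightarrow> spec_norm n (\<lambda>p q. gram \<psi> n (\<tau> * n) \<omega> p q - idm p q) \<le> 1/2"

text \<open>The normalised vector of basis values. It is zero for samples beyond the level, so that
  sums over all of \<open>J\<close> see only the samples of this level.\<close>

definition feature :: "nat \<Rightarrow> 'a \<Rightarrow> nat \<Rightarrow> real" where
  "feature k x p = (if k \<in> {1..\<tau> * n} then \<psi> p x / sqrt (christoffel x) else 0)"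

definition trace_mgf :: "real \<Rightarrow> (nat \<Rightarrow> 'a) \<Rightarrow> real" where
  "trace_mgf t \<omega> = trace_exp {1..n} (\<lambda>p q. \<Sum>k\<in>J. t * (feature k (\<omega> k) p * feature k (\<omega> k) q))"

sublocale PP: product_prob_space N J by (intro product_prob_spaceI N_prob)

lemma psi_L2: "i \<ge> 1 \<Longrightarrow> \<psi> i \<in> L2set \<rho>"
  using onb by (auto simp: L2_onb_def)

lemma psi_meas [measurable]: "i \<ge> 1 \<Longrightarrow> \<psi> i \<in> borel_measurable \<rho>"
  using psi_L2 by (auto simp: L2set_def)

lemma psi_ortho: "i \<ge> 1 \<Longrightarrow> j \<ge> 1 \<Longrightarrow> (\<integral>x. \<psi> i x * \<psi> j x \<partial>\<rho>) = (if i = j then 1 else 0)"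
  using onb by (auto simp: L2_onb_def)

lemma psi_integrable: "i \<ge> 1 \<Longrightarrow> j \<ge> 1 \<Longrightarrow> integrable \<rho> (\<lambda>x. \<psi> i x * \<psi> j x)"
  using psi_L2 L2set_mult_integrable by blast

lemma christoffel_meas [measurable]: "christoffel \<in> borel_measurable \<rho>"
  unfolding christoffel_def[abs_def] by (intro borel_measurable_sum borel_measurable_power psi_meas) auto

lemma christoffel_nonneg: "christoffel x \<ge> 0" unfolding christoffel_def by (intro sum_nonneg) auto

lemma christoffel_pos: "x \<in> space \<rho> \<Longrightarrow> christoffel x > 0"
proof -
  assume "x \<in> space \<rho>"
  then obtain i where i: "i \<in> {1..n}" "\<psi> i x \<noteq> 0" using nonvanishing by blast
  then have "0 < (\<psi> i x)\<^sup>2" by simp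
  also have "\<dots> \<le> christoffel x" unfolding christoffel_def using i by (intro member_le_sum) auto
  finally show ?thesis .
qed

lemma wt_eq: "wt \<psi> n x = real n / christoffel x" by (simp add: wt_def christoffel_def)

lemma N_space: "space (N k) = space \<rho>" using N_sets by (rule sets_eq_imp_space_eq)

lemma N_meas: "f \<in> borel_measurable \<rho> \<Longrightarrow> f \<in> borel_measurable (N k)"
  using measurable_cong_sets[OF N_sets refl] by blast

lemma component_meas: "f \<in> borel_measurable \<rho> \<Longrightarrow> k \<in> J \<Longrightarrow> (\<lambda>\<omega>. f (\<omega> k)) \<in> borel_measurable P"
  by (rule measurable_compose[of "\<lambda>\<omega>. \<omega> k" P "N k"]) (auto intro: measurable_component_singleton N_meas)

lemma space_P_component: "\<omega> \<in> space P \<Longrightarrow> k \<in> J \<Longrightarrow> \<omega> k \<in> space \<rho>"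
  using N_space by (auto simp: space_PiM PiE_def Pi_def)

lemma lab_in: "k \<in> {1..\<tau> * n} \<Longrightarrow> lab k \<in> {1..n}"
  using label_range[OF counts] by blast

lemma chi_integral:
  assumes "j \<ge> 1" "f \<in> borel_measurable \<rho>"
  shows "(\<integral>x. f x \<partial>chi \<rho> \<psi> j) = (\<integral>x. (\<psi> j x)\<^sup>2 * f x \<partial>\<rho>)"
    and "integrable (chi \<rho> \<psi> j) f \<longleftrightarrow> integrable \<rho> (\<lambda>x. (\<psi> j x)\<^sup>2 * f x)"
  unfolding chi_def using assms by (subst integral_density integrable_density; auto)+

lemma psi_sq_F_integrable:
  assumes F: "F \<in> borel_measurable \<rho>" and int: "integrable \<rho> (\<lambda>x. christoffel x * F x)" and j: "j \<in> {1..n}"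
  shows "integrable \<rho> (\<lambda>x. (\<psi> j x)\<^sup>2 * F x)"
proof (rule Bochner_Integration.integrable_bound[OF int])
  show "(\<lambda>x. (\<psi> j x)\<^sup>2 * F x) \<in> borel_measurable \<rho>" using F j by auto
  have "(\<psi> j x)\<^sup>2 \<le> christoffel x" for x unfolding christoffel_def using j by (intro member_le_sum) auto
  then show "AE x in \<rho>. norm ((\<psi> j x)\<^sup>2 * F x) \<le> norm (christoffel x * F x)"
    by (intro AE_I2) (auto simp: abs_mult christoffel_nonneg intro: mult_right_mono)
qed

lemma N_integrable:
  assumes "F \<in> borel_measurable \<rho>" "integrable \<rho> (\<lambda>x. christoffel x * F x)" "k \<in> {1..\<tau> * n}"
  shows "integrable (N k) F"
  using psi_sq_F_integrable[OF assms(1,2) lab_in[OF assms(3)]] assms lab_in[OF assms(3)]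
  by (simp add: N_chi chi_integral)

text \<open>Each label occurs \<tau> times and the densities of the \<open>chi j\<close> add up to
  \<open>christoffel\<close>, so in the mean stratified samples act like samples from the
  mixture.\<close>

lemma stratified_mean:
  assumes F: "F \<in> borel_measurable \<rho>" and int: "integrable \<rho> (\<lambda>x. christoffel x * F x)"
  shows "(\<Sum>k\<in>{1..\<tau> * n}. \<integral>x. F x \<partial>N k) = real \<tau> * (\<integral>x. christoffel x * F x \<partial>\<rho>)"
proof -
  have "(\<Sum>k\<in>{1..\<tau> * n}. \<integral>x. F x \<partial>N k) = (\<Sum>k\<in>{1..\<tau> * n}. \<integral>x. (\<psi> (lab k) x)\<^sup>2 * F x \<partial>\<rho>)"
    using lab_in F by (intro sum.cong refl) (simp add: N_chi chi_integral)
  also have "\<dots> = real \<tau> * (\<Sum>j\<in>{1..n}. \<integral>x. (\<psi> j x)\<^sup>2 * F x \<partial>\<rho>)"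
    by (rule label_sum[OF counts])
  also have "(\<Sum>j\<in>{1..n}. \<integral>x. (\<psi> j x)\<^sup>2 * F x \<partial>\<rho>) = (\<integral>x. (\<Sum>j\<in>{1..n}. (\<psi> j x)\<^sup>2 * F x) \<partial>\<rho>)"
    by (rule Bochner_Integration.integral_sum[symmetric]) (rule psi_sq_F_integrable[OF F int])
  finally show ?thesis by (simp add: christoffel_def sum_distrib_right)
qed

lemma feature_meas: "p \<in> {1..n} \<Longrightarrow> (\<lambda>x. feature k x p) \<in> borel_measurable \<rho>"
  unfolding feature_def by (cases "k \<in> {1..\<tau> * n}") auto

lemma feature_mult: "feature k x p * feature k x q = (if k \<in> {1..\<tau> * n} then \<psi> p x * \<psi> q x / christoffel x else 0)"
  using christoffel_nonneg[of x] by (simp add: feature_def)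

lemma gram_feature: "(\<Sum>k\<in>J. feature k (\<omega> k) p * feature k (\<omega> k) q) = real \<tau> * gram \<psi> n (\<tau> * n) \<omega> p q"
proof -
  have "(\<Sum>k\<in>J. feature k (\<omega> k) p * feature k (\<omega> k) q) = (\<Sum>k\<in>{1..\<tau> * n}. \<psi> p (\<omega> k) * \<psi> q (\<omega> k) / christoffel (\<omega> k))"
    using J by (intro sum.mono_neutral_cong_right) (auto simp: feature_mult)
  also have "\<dots> = real \<tau> * gram \<psi> n (\<tau> * n) \<omega> p q"
    using n_pos tau_pos by (simp add: gram_def wt_eq sum_distrib_left)
  finally show ?thesis .
qed

text \<open>The normalisation cancels \<open>christoffel\<close> exactly and leaves the
  orthonormality relations. This is the effect of the weight in \<open>gram\<close>; unweighted
  products would leave integrals of four basis functions.\<close>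

lemma isotropy:
  assumes "p \<in> {1..n}" "q \<in> {1..n}"
  shows "(\<Sum>k\<in>J. \<integral>x. feature k x p * feature k x q \<partial>N k) = (if p = q then real \<tau> else 0)"
proof -
  have SF: "christoffel x * (\<psi> p x * \<psi> q x / christoffel x) = \<psi> p x * \<psi> q x" if "x \<in> space \<rho>" for x
    using christoffel_pos[OF that] by simp
  have int: "integrable \<rho> (\<lambda>x. christoffel x * (\<psi> p x * \<psi> q x / christoffel x))"
    using psi_integrable[of p q] assms by (subst Bochner_Integration.integrable_cong[OF refl SF]) auto
  have "(\<Sum>k\<in>J. \<integral>x. feature k x p * feature k x q \<partial>N k) = (\<Sum>k\<in>{1..\<tau> * n}. \<integral>x. \<psi> p x * \<psi> q x / christoffel x \<partial>N k)"
    using J by (intro sum.mono_neutral_cong_right) (auto simp: feature_mult)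
  also have "\<dots> = real \<tau> * (\<integral>x. christoffel x * (\<psi> p x * \<psi> q x / christoffel x) \<partial>\<rho>)"
    using assms by (intro stratified_mean int) auto
  also have "(\<integral>x. christoffel x * (\<psi> p x * \<psi> q x / christoffel x) \<partial>\<rho>) = (\<integral>x. \<psi> p x * \<psi> q x \<partial>\<rho>)"
    by (intro Bochner_Integration.integral_cong SF refl)
  finally show ?thesis using assms by (simp add: psi_ortho)
qed

lemma feature_unit: "x \<in> space \<rho> \<Longrightarrow> (\<Sum>p\<in>{1..n}. (feature k x p)\<^sup>2) \<in> {0, 1}"
proof -
  assume x: "x \<in> space \<rho>"
  have "(\<Sum>p\<in>{1..n}. (feature k x p)\<^sup>2) = (if k \<in> {1..\<tau> * n} then (\<Sum>p\<in>{1..n}. (\<psi> p x)\<^sup>2) / christoffel x else 0)"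
    unfolding power2_eq_square feature_mult by (cases "k \<in> {1..\<tau> * n}") (simp_all only: if_True if_False sum_divide_distrib sum.neutral_const)
  then show ?thesis using christoffel_pos[OF x] by (simp add: christoffel_def)
qed

lemma feature_component_meas: "p \<in> {1..n} \<Longrightarrow> k \<in> J \<Longrightarrow> (\<lambda>\<omega>. feature k (\<omega> k) p) \<in> borel_measurable P"
  by (rule component_meas[OF feature_meas])

lemma trace_mgf_meas: "trace_mgf t \<in> borel_measurable P"
  unfolding trace_mgf_def[abs_def]
  by (intro trace_exp_measurable borel_measurable_sum borel_measurable_times feature_component_meas) auto

lemma trace_mgf_integral_le:
  "(\<integral>\<^sup>+\<omega>. ennreal (trace_mgf t \<omega>) \<partial>P) \<le> ennreal (real n * exp ((exp t - 1) * real \<tau>))"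
  unfolding trace_mgf_def
  using rank_one_mgf_bound[of "{1..n}" J N feature "real \<tau>" t] J N_prob N_meas[OF feature_meas] feature_unit isotropy
  by (simp add: N_space)

lemma trace_mgf_tail:
  "PP.P.prob {\<omega> \<in> space P. exp B \<le> trace_mgf t \<omega>} \<le> real n * exp ((exp t - 1) * real \<tau> - B)"
proof -
  have "emeasure P {\<omega> \<in> space P. 1 \<le> ennreal (exp (- B)) * ennreal (trace_mgf t \<omega>)}
      \<le> ennreal (exp (- B)) * (\<integral>\<^sup>+\<omega>. ennreal (trace_mgf t \<omega>) * indicator (space P) \<omega> \<partial>P)"
    by (rule nn_integral_Markov_inequality)
       (auto intro!: borel_measurable_times_ennreal measurable_compose[OF trace_mgf_meas measurable_ennreal])
  also have "(\<integral>\<^sup>+\<omega>. ennreal (trace_mgf t \<omega>) * indicator (space P) \<omega> \<partial>P) = (\<integral>\<^sup>+\<omega>. ennreal (trace_mgf t \<omega>) \<partial>P)"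
    by (intro nn_integral_cong) simp
  also have "ennreal (exp (- B)) * (\<integral>\<^sup>+\<omega>. ennreal (trace_mgf t \<omega>) \<partial>P)
      \<le> ennreal (exp (- B)) * ennreal (real n * exp ((exp t - 1) * real \<tau>))"
    by (intro mult_left_mono trace_mgf_integral_le) simp
  also have "\<dots> = ennreal (real n * exp ((exp t - 1) * real \<tau> - B))"
    by (simp add: ennreal_mult[symmetric] exp_diff exp_minus divide_inverse mult_ac)
  finally have le: "emeasure P {\<omega> \<in> space P. 1 \<le> ennreal (exp (- B)) * ennreal (trace_mgf t \<omega>)}
      \<le> ennreal (real n * exp ((exp t - 1) * real \<tau> - B))" .
  have iff: "1 \<le> ennreal (exp (- B)) * ennreal (trace_mgf t \<omega>) \<longleftrightarrow> exp B \<le> trace_mgf t \<omega>" for \<omega>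
  proof -
    have "ennreal (exp (- B)) * ennreal (trace_mgf t \<omega>) = ennreal (exp (- B) * trace_mgf t \<omega>)"
      by (simp add: ennreal_mult')
    moreover have "1 \<le> exp (- B) * trace_mgf t \<omega> \<longleftrightarrow> exp B \<le> trace_mgf t \<omega>"
      by (simp add: exp_minus field_simps)
    ultimately show ?thesis by (auto simp: ennreal_le_iff2 ennreal_1[symmetric] simp del: ennreal_1)
  qed
  show ?thesis using le unfolding iff PP.P.emeasure_eq_measure by (subst (asm) ennreal_le_iff) auto
qed

lemma gram_sym: "gram \<psi> n m \<omega> p q = gram \<psi> n m \<omega> q p"
  by (simp add: gram_def mult_ac)

lemma gram_error_sym: "gram \<psi> n m \<omega> p q - idm p q = gram \<psi> n m \<omega> q p - idm q p"
  by (simp add: gram_sym[of _ \<omega> p] idm_def)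

lemma gram_error_spec:
  obtains e l where "orthobasis {1..n} e"
    "\<And>p q. p \<in> {1..n} \<Longrightarrow> q \<in> {1..n} \<Longrightarrow> gram \<psi> n (\<tau> * n) \<omega> p q - idm p q = spec_mat {1..n} e l p q"
    "good \<omega> \<longleftrightarrow> (\<forall>k\<in>{1..n}. \<bar>l k\<bar> \<le> 1/2)"
proof -
  obtain e l where e: "orthobasis {1..n} e" and
    l: "\<And>p q. p \<in> {1..n} \<Longrightarrow> q \<in> {1..n} \<Longrightarrow> gram \<psi> n (\<tau> * n) \<omega> p q - idm p q = spec_mat {1..n} e l p q"
    using spectral_theorem[of "{1..n}" "\<lambda>p q. gram \<psi> n (\<tau> * n) \<omega> p q - idm p q", OF _ gram_error_sym] by blast
  moreover have "good \<omega> \<longleftrightarrow> (\<forall>k\<in>{1..n}. \<bar>l k\<bar> \<le> 1/2)"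
    unfolding good_def by (rule spec_norm_le_iff[OF e _ l]) auto
  ultimately show ?thesis using that by blast
qed

lemma spec_shift:
  assumes "orthobasis I e" "p \<in> I" "q \<in> I"
  shows "spec_mat I e (\<lambda>k. 1 + l k) p q = idm p q + spec_mat I e l p q"
proof -
  have "spec_mat I e (\<lambda>k. 1 + l k) p q = spec_mat I e (\<lambda>_. 1) p q + spec_mat I e l p q"
    by (simp add: spec_mat_def sum.distrib algebra_simps)
  then show ?thesis by (simp add: spec_one[OF assms] idm_def)
qed

text \<open>An eigenvalue of \<tau> times the Gram matrix above \<open>3/2 * \<tau>\<close> or below
  \<open>1/2 * \<tau>\<close> is visible in the trace because all other terms are positive. Positive
  \<open>t\<close> detects large eigenvalues, negative \<open>t\<close> small ones.\<close>

lemma not_good_imp: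
  assumes "\<not> good \<omega>"
  shows "exp (ln (3/2) * (3/2 * real \<tau>)) \<le> trace_mgf (ln (3/2)) \<omega> \<or> exp (- ln 2 * (1/2 * real \<tau>)) \<le> trace_mgf (- ln 2) \<omega>"
proof -
  obtain e l where e: "orthobasis {1..n} e" and
    l: "\<And>p q. p \<in> {1..n} \<Longrightarrow> q \<in> {1..n} \<Longrightarrow> gram \<psi> n (\<tau> * n) \<omega> p q - idm p q = spec_mat {1..n} e l p q"
    and g: "good \<omega> \<longleftrightarrow> (\<forall>k\<in>{1..n}. \<bar>l k\<bar> \<le> 1/2)"
    using gram_error_spec[of \<omega>] by blast
  then obtain k where k: "k \<in> {1..n}" "\<bar>l k\<bar> > 1/2" using assms by auto
  have TS: "(\<Sum>k\<in>J. t * (feature k (\<omega> k) p * feature k (\<omega> k) q)) = spec_mat {1..n} e (\<lambda>k. t * (real \<tau> * (1 + l k))) p q"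
    if "p \<in> {1..n}" "q \<in> {1..n}" for p q t
  proof -
    have "(\<Sum>k\<in>J. t * (feature k (\<omega> k) p * feature k (\<omega> k) q)) = t * (real \<tau> * gram \<psi> n (\<tau> * n) \<omega> p q)"
      by (simp add: sum_distrib_left[symmetric] gram_feature)
    also have "gram \<psi> n (\<tau> * n) \<omega> p q = spec_mat {1..n} e (\<lambda>k. 1 + l k) p q"
      using l[OF that] spec_shift[OF e that] by simp
    finally show ?thesis by (simp add: spec_mat_def sum_distrib_left mult_ac)
  qed
  have trace_mgf: "exp B \<le> trace_mgf t \<omega>" if "t * (real \<tau> * (1 + l k)) \<ge> B" for B t
    unfolding trace_mgf_def by (rule trace_exp_ge[OF finite_atLeastAtMost e TS k(1)]) (use that in auto)
  consider "l k > 1/2" | "l k < - (1/2)" using k(2) by linarith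
  then show ?thesis
  proof cases
    case 1
    then have "3/2 * real \<tau> \<le> (1 + l k) * real \<tau>" by (intro mult_right_mono) auto
    then have "ln (3/2) * (3/2 * real \<tau>) \<le> ln (3/2) * ((1 + l k) * real \<tau>)" by (intro mult_left_mono) auto
    then show ?thesis by (intro disjI1 trace_mgf) (simp add: mult_ac)
  next
    case 2
    then have "(1 + l k) * real \<tau> \<le> 1/2 * real \<tau>" by (intro mult_right_mono) auto
    then have "ln 2 * ((1 + l k) * real \<tau>) \<le> ln 2 * (1/2 * real \<tau>)" by (intro mult_left_mono) auto
    then show ?thesis by (intro disjI2 trace_mgf) (simp add: mult_ac)
  qed
qed

lemma gram_meas: "p \<in> {1..n} \<Longrightarrow> q \<in> {1..n} \<Longrightarrow> (\<lambda>\<omega>. gram \<psi> n (\<tau> * n) \<omega> p q) \<in> borel_measurable P"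
proof -
  assume pq: "p \<in> {1..n}" "q \<in> {1..n}"
  have "(\<lambda>x. wt \<psi> n x * \<psi> p x * \<psi> q x) \<in> borel_measurable \<rho>"
    unfolding wt_eq using pq by auto
  from component_meas[OF this]
  have "(\<lambda>\<omega>. \<Sum>j=1..\<tau> * n. wt \<psi> n (\<omega> j) * \<psi> p (\<omega> j) * \<psi> q (\<omega> j)) \<in> borel_measurable P"
    using J by (intro borel_measurable_sum) auto
  then show ?thesis unfolding gram_def by simp
qed

lemma good_sets: "{\<omega> \<in> space P. good \<omega>} \<in> sets P"
proof -
  have m: "(\<lambda>\<omega>. \<Sum>i=1..n. mat_pow {1..n} (\<lambda>p q. gram \<psi> n (\<tau> * n) \<omega> p q - idm p q) (2 * M) i i) \<in> borel_measurable P" for M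
    by (intro borel_measurable_sum mat_pow_measurable borel_measurable_diff gram_meas) auto
  have "good \<omega> \<longleftrightarrow> (\<forall>M. (\<Sum>i=1..n. mat_pow {1..n} (\<lambda>p q. gram \<psi> n (\<tau> * n) \<omega> p q - idm p q) (2 * M) i i)
      \<le> real n * (1/4) ^ M)" for \<omega>
    unfolding good_def by (rule spec_norm_le_half_iff) (rule gram_error_sym)
  then show ?thesis
    using m by (auto intro!: sets.sets_Collect_countable_All borel_measurable_le)
qed

lemma prob_not_good:
  "PP.P.prob {\<omega> \<in> space P. \<not> good \<omega>}
    \<le> real n * (exp (- (theta * real \<tau>)) + exp (- ((1 - ln 2) / 2 * real \<tau>)))"
proof -
  let ?A = "{\<omega> \<in> space P. exp (ln (3/2) * (3/2 * real \<tau>)) \<le> trace_mgf (ln (3/2)) \<omega>}"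
  let ?B = "{\<omega> \<in> space P. exp (- ln 2 * (1/2 * real \<tau>)) \<le> trace_mgf (- ln 2) \<omega>}"
  have sets: "?A \<in> sets P" "?B \<in> sets P" using trace_mgf_meas by (auto intro!: borel_measurable_le)
  have "PP.P.prob {\<omega> \<in> space P. \<not> good \<omega>} \<le> PP.P.prob (?A \<union> ?B)"
    using sets not_good_imp by (intro PP.P.finite_measure_mono) blast+
  also have "\<dots> \<le> PP.P.prob ?A + PP.P.prob ?B" using sets by (intro measure_Un_le)
  also have "\<dots> \<le> real n * exp ((exp (ln (3/2)) - 1) * real \<tau> - ln (3/2) * (3/2 * real \<tau>))
     + real n * exp ((exp (- ln 2) - 1) * real \<tau> - (- ln 2 * (1/2 * real \<tau>)))"
    by (intro add_mono trace_mgf_tail)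
  also have "(exp (ln (3/2)) - 1) * real \<tau> - ln (3/2) * (3/2 * real \<tau>) = - (theta * real \<tau>)"
    by (simp add: theta_def field_simps)
  also have "(exp (- ln 2) - 1) * real \<tau> - (- ln 2 * (1/2 * real \<tau>)) = - ((1 - ln 2) / 2 * real \<tau>)"
    by (simp add: exp_minus field_simps)
  finally show ?thesis by (simp add: distrib_left)
qed

text \<open>With one basis function the weight is the reciprocal of its square, so every summand of
  the Gram matrix is 1.\<close>

lemma good_if_n_1:
  assumes "n = 1" "\<omega> \<in> space P"
  shows "good \<omega>"
proof -
  have S1: "christoffel x = (\<psi> 1 x)\<^sup>2" for x unfolding christoffel_def using assms(1) by simp
  have "feature k (\<omega> k) 1 * feature k (\<omega> k) 1 = (if k \<in> {1..\<tau> * n} then 1 else 0)" if "k \<in> J" for k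
    using christoffel_pos[OF space_P_component[OF assms(2) that]] unfolding feature_mult S1
    by (auto simp: power2_eq_square)
  then have "(\<Sum>k\<in>J. feature k (\<omega> k) 1 * feature k (\<omega> k) 1) = (\<Sum>k\<in>{1..\<tau> * n}. 1)"
    using J by (intro sum.mono_neutral_cong_right) auto
  then have "gram \<psi> n (\<tau> * n) \<omega> 1 1 = 1" using tau_pos assms(1) unfolding gram_feature by simp
  then have "mat_pow {1..n} (\<lambda>p q. gram \<psi> n (\<tau> * n) \<omega> p q - idm p q) (2 * M) 1 1 \<le> (1/4) ^ M" for M
    using assms(1) by (cases M) (auto simp: idm_def)
  then show ?thesis
    unfolding good_def using assms(1)
    by (subst spec_norm_le_half_iff[OF gram_error_sym]) auto
qed

subsection \<open>Weighted least squares\<close>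

definition coef :: "('a \<Rightarrow> real) \<Rightarrow> nat \<Rightarrow> real" where
  "coef u p = (\<integral>x. u x * \<psi> p x \<partial>\<rho>)"

definition resid :: "('a \<Rightarrow> real) \<Rightarrow> 'a \<Rightarrow> real" where
  "resid u x = u x - (\<Sum>p=1..n. coef u p * \<psi> p x)"

text \<open>Discrete inner products of the residual with the basis: the right-hand side of the
  normal equations for the correction to the orthogonal projection.\<close>

definition noise :: "('a \<Rightarrow> real) \<Rightarrow> (nat \<Rightarrow> 'a) \<Rightarrow> nat \<Rightarrow> real" where
  "noise u \<omega> p = (1 / real (\<tau> * n)) * (\<Sum>j=1..\<tau> * n. wt \<psi> n (\<omega> j) * \<psi> p (\<omega> j) * resid u (\<omega> j))"

lemma span_L2: "(\<lambda>x. \<Sum>p=1..n. d p * \<psi> p x) \<in> L2set \<rho>"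
  by (intro L2set_sum L2set_scale psi_L2) auto

lemma span_inner:
  assumes f: "f \<in> L2set \<rho>"
  shows "(\<integral>x. f x * (\<Sum>p=1..n. d p * \<psi> p x) \<partial>\<rho>) = (\<Sum>p=1..n. d p * (\<integral>x. f x * \<psi> p x \<partial>\<rho>))"
proof -
  have "(\<integral>x. f x * (\<Sum>p=1..n. d p * \<psi> p x) \<partial>\<rho>) = (\<integral>x. (\<Sum>p=1..n. d p * (f x * \<psi> p x)) \<partial>\<rho>)"
    by (intro Bochner_Integration.integral_cong) (auto simp: sum_distrib_left mult_ac)
  also have "\<dots> = (\<Sum>p=1..n. \<integral>x. d p * (f x * \<psi> p x) \<partial>\<rho>)"
    by (intro Bochner_Integration.integral_sum integrable_mult_right L2set_mult_integrable f psi_L2) auto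
  finally show ?thesis by simp
qed

lemma span_psi: "q \<in> {1..n} \<Longrightarrow> (\<integral>x. (\<Sum>p=1..n. d p * \<psi> p x) * \<psi> q x \<partial>\<rho>) = d q"
proof -
  assume q: "q \<in> {1..n}"
  have "(\<integral>x. (\<Sum>p=1..n. d p * \<psi> p x) * \<psi> q x \<partial>\<rho>) = (\<integral>x. \<psi> q x * (\<Sum>p=1..n. d p * \<psi> p x) \<partial>\<rho>)"
    by (simp add: mult.commute)
  also have "\<dots> = (\<Sum>p=1..n. d p * (if q = p then 1 else 0))"
    using q by (subst span_inner) (auto simp: psi_L2 psi_ortho intro!: sum.cong)
  finally show ?thesis using q by (simp add: if_distrib[of "\<lambda>x. _ * x"] cong: if_cong)
qed

lemma resid_L2: "u \<in> L2set \<rho> \<Longrightarrow> resid u \<in> L2set \<rho>"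
  using L2set_add[OF _ L2set_scale[OF span_L2, of "-1"], of u "coef u"] by (simp add: resid_def[abs_def])

lemma resid_ortho:
  assumes u: "u \<in> L2set \<rho>" and q: "q \<in> {1..n}"
  shows "(\<integral>x. resid u x * \<psi> q x \<partial>\<rho>) = 0"
proof -
  have "(\<integral>x. resid u x * \<psi> q x \<partial>\<rho>) = (\<integral>x. u x * \<psi> q x - (\<Sum>p=1..n. coef u p * \<psi> p x) * \<psi> q x \<partial>\<rho>)"
    by (simp add: resid_def left_diff_distrib)
  also have "\<dots> = (\<integral>x. u x * \<psi> q x \<partial>\<rho>) - (\<integral>x. (\<Sum>p=1..n. coef u p * \<psi> p x) * \<psi> q x \<partial>\<rho>)"
    using q by (intro Bochner_Integration.integral_diff L2set_mult_integrable u span_L2 psi_L2) auto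
  finally show ?thesis by (simp only: span_psi[OF q]) (simp add: coef_def)
qed

lemma resid_pythagoras:
  assumes u: "u \<in> L2set \<rho>"
  shows "(\<integral>x. (resid u x + (\<Sum>p=1..n. d p * \<psi> p x))\<^sup>2 \<partial>\<rho>) = (\<integral>x. (resid u x)\<^sup>2 \<partial>\<rho>) + (\<Sum>p=1..n. (d p)\<^sup>2)"
proof -
  let ?h = "\<lambda>x. \<Sum>p=1..n. d p * \<psi> p x"
  have ints: "integrable \<rho> (\<lambda>x. resid u x * resid u x)" "integrable \<rho> (\<lambda>x. resid u x * ?h x)" "integrable \<rho> (\<lambda>x. ?h x * ?h x)"
    by (intro L2set_mult_integrable resid_L2 u span_L2)+
  have "(\<integral>x. (resid u x + ?h x)\<^sup>2 \<partial>\<rho>)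
     = (\<integral>x. (resid u x * resid u x + 2 * (resid u x * ?h x)) + ?h x * ?h x \<partial>\<rho>)"
    by (intro Bochner_Integration.integral_cong) (auto simp: power2_eq_square algebra_simps)
  also have "\<dots> = (\<integral>x. resid u x * resid u x \<partial>\<rho>) + 2 * (\<integral>x. resid u x * ?h x \<partial>\<rho>) + (\<integral>x. ?h x * ?h x \<partial>\<rho>)"
    using ints by simp
  also have "(\<integral>x. resid u x * ?h x \<partial>\<rho>) = 0"
    using span_inner[OF resid_L2[OF u]] resid_ortho[OF u] by simp
  also have "(\<integral>x. ?h x * ?h x \<partial>\<rho>) = (\<Sum>p=1..n. (d p)\<^sup>2)"
    unfolding span_inner[OF span_L2] by (intro sum.cong refl) (simp only: span_psi power2_eq_square)
  finally show ?thesis by (simp add: power2_eq_square)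
qed

lemma diff_span: "u x - (\<Sum>p=1..n. c p * \<psi> p x) = resid u x + (\<Sum>p=1..n. (coef u p - c p) * \<psi> p x)"
  by (simp add: resid_def left_diff_distrib sum_subtractf)

lemma resid_le_best_err:
  assumes u: "u \<in> L2set \<rho>"
  shows "(\<integral>x. (resid u x)\<^sup>2 \<partial>\<rho>) \<le> (best_err \<rho> \<psi> n u)\<^sup>2"
proof -
  have "L2norm \<rho> (resid u) \<le> best_err \<rho> \<psi> n u"
    unfolding best_err_def
  proof (rule cINF_greatest)
    show "Vspace \<psi> n \<noteq> {}" by (auto simp: Vspace_def)
    fix v assume "v \<in> Vspace \<psi> n"
    then obtain c where v: "v = (\<lambda>x. \<Sum>p=1..n. c p * \<psi> p x)" by (auto simp: Vspace_def)
    show "L2norm \<rho> (resid u) \<le> L2norm \<rho> (\<lambda>x. u x - v x)"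
      unfolding v diff_span L2norm_def resid_pythagoras[OF u]
      by (auto intro: sum_nonneg)
  qed
  then have "(L2norm \<rho> (resid u))\<^sup>2 \<le> (best_err \<rho> \<psi> n u)\<^sup>2"
    by (intro power_mono) (auto simp: L2norm_def)
  then show ?thesis by (simp add: L2norm_sq)
qed

text \<open>Discrete Pythagoras: the hypothesis says that \<open>r\<close> is orthogonal to the
  space in the weighted sample inner product, so the cross term vanishes.\<close>

lemma disc_norm_expand:
  assumes r: "\<And>p. p \<in> {1..n} \<Longrightarrow> (\<Sum>j=1..m. wt \<psi> n (\<omega> j) * \<psi> p (\<omega> j) * r (\<omega> j)) = 0"
  shows "(1 / real m) * (\<Sum>j=1..m. wt \<psi> n (\<omega> j) * (r (\<omega> j) + (\<Sum>p=1..n. z p * \<psi> p (\<omega> j)))\<^sup>2)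
    = (1 / real m) * (\<Sum>j=1..m. wt \<psi> n (\<omega> j) * (r (\<omega> j))\<^sup>2) + bilin {1..n} (gram \<psi> n m \<omega>) z z"
proof -
  let ?h = "\<lambda>j. \<Sum>p=1..n. z p * \<psi> p (\<omega> j)"
  have "(\<Sum>j=1..m. wt \<psi> n (\<omega> j) * (r (\<omega> j) + ?h j)\<^sup>2)
    = (\<Sum>j=1..m. wt \<psi> n (\<omega> j) * (r (\<omega> j))\<^sup>2) + 2 * (\<Sum>j=1..m. wt \<psi> n (\<omega> j) * r (\<omega> j) * ?h j)
      + (\<Sum>j=1..m. wt \<psi> n (\<omega> j) * (?h j * ?h j))"
    unfolding sum_distrib_left[of 2] sum.distrib[symmetric]
    by (intro sum.cong refl) (simp only: power2_eq_square, simp only: algebra_simps)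
  also have "(\<Sum>j=1..m. wt \<psi> n (\<omega> j) * r (\<omega> j) * ?h j)
      = (\<Sum>p=1..n. z p * (\<Sum>j=1..m. wt \<psi> n (\<omega> j) * \<psi> p (\<omega> j) * r (\<omega> j)))"
    unfolding sum_distrib_left by (subst sum.swap) (intro sum.cong refl, simp add: mult_ac)
  also have "\<dots> = 0" using r by simp
  also have "(\<Sum>j=1..m. wt \<psi> n (\<omega> j) * (?h j * ?h j))
      = (\<Sum>j=1..m. \<Sum>p=1..n. \<Sum>q=1..n. z p * (wt \<psi> n (\<omega> j) * \<psi> p (\<omega> j) * \<psi> q (\<omega> j)) * z q)"
    by (rule sum.cong[OF refl]) (subst sum_product, simp add: sum_distrib_left mult_ac)
  also have "\<dots> = (\<Sum>p=1..n. \<Sum>q=1..n. \<Sum>j=1..m. z p * (wt \<psi> n (\<omega> j) * \<psi> p (\<omega> j) * \<psi> q (\<omega> j)) * z q)"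
    by (rule sum_swap3[symmetric])
  finally show ?thesis
    by (simp add: distrib_left bilin_def gram_def sum_distrib_left sum_distrib_right mult_ac)
qed

text \<open>Let \<open>d\<close> solve the normal equations with right-hand side
  \<open>noise\<close>. The orthogonal projection plus the function with coefficients
  \<open>d\<close> minimises the discrete seminorm. On the good event the Gram matrix is at least
  1/2, so this minimiser is the only one and \<open>d\<close> is at most twice as long as the
  noise.\<close>

lemma least_squares_error:
  assumes u: "u \<in> L2set \<rho>" and g: "good \<omega>"
  shows "(L2norm \<rho> (\<lambda>x. u x - uW \<psi> n (\<tau> * n) \<omega> u x))\<^sup>2
    \<le> (\<integral>x. (resid u x)\<^sup>2 \<partial>\<rho>) + 4 * (\<Sum>p=1..n. (noise u \<omega> p)\<^sup>2)"
proof -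
  let ?I = "{1..n}" and ?m = "\<tau> * n"
  let ?G = "gram \<psi> n ?m \<omega>"
  have m_pos: "real ?m > 0" using n_pos tau_pos by simp
  obtain e l where e: "orthobasis ?I e" and
    l: "\<And>p q. p \<in> ?I \<Longrightarrow> q \<in> ?I \<Longrightarrow> ?G p q - idm p q = spec_mat ?I e l p q"
    and "good \<omega> \<longleftrightarrow> (\<forall>k\<in>?I. \<bar>l k\<bar> \<le> 1/2)"
    using gram_error_spec[of \<omega>] by blast
  then have l_half: "1 + l k \<ge> 1/2" if "k \<in> ?I" for k using g that by (fastforce simp: abs_le_iff)
  have G: "?G p q = spec_mat ?I e (\<lambda>k. 1 + l k) p q" if "p \<in> ?I" "q \<in> ?I" for p q
    using l[OF that] spec_shift[OF e that] by simp
  have pars: "(\<Sum>k\<in>?I. (\<Sum>j\<in>?I. e k j * v j)\<^sup>2) = (\<Sum>j\<in>?I. (v j)\<^sup>2)" for v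
    using parseval[OF finite_atLeastAtMost e, of v v] by (simp add: power2_eq_square)
  let ?b = "noise u \<omega>"
  \<comment> \<open>The inverse of the Gram matrix in its eigenbasis; its eigenvalues are at most
    2.\<close>
  define R where "R = spec_mat ?I e (\<lambda>k. 1 / (1 + l k))"
  define d where "d p = (\<Sum>q\<in>?I. R p q * ?b q)" for p
  have Gd: "(\<Sum>q\<in>?I. ?G p q * d q) = ?b p" if p: "p \<in> ?I" for p
  proof -
    have "(\<Sum>q\<in>?I. ?G p q * d q) = (\<Sum>q\<in>?I. \<Sum>q'\<in>?I. spec_mat ?I e (\<lambda>k. 1 + l k) p q * R q q' * ?b q')"
      unfolding d_def sum_distrib_left using p by (intro sum.cong refl) (simp add: G mult_ac)
    also have "\<dots> = (\<Sum>q'\<in>?I. (\<Sum>q\<in>?I. spec_mat ?I e (\<lambda>k. 1 + l k) p q * R q q') * ?b q')"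
      by (subst sum.swap) (simp add: sum_distrib_right)
    also have "\<dots> = (\<Sum>q'\<in>?I. (if p = q' then 1 else 0) * ?b q')"
    proof (intro sum.cong refl arg_cong2[of _ _ _ _ "(*)"])
      fix q' assume q': "q' \<in> ?I"
      have "(\<Sum>q\<in>?I. spec_mat ?I e (\<lambda>k. 1 + l k) p q * R q q') = spec_mat ?I e (\<lambda>k. (1 + l k) * (1 / (1 + l k))) p q'"
        unfolding R_def by (rule spec_mult[OF finite_atLeastAtMost e])
      also have "\<dots> = spec_mat ?I e (\<lambda>_. 1) p q'"
        unfolding spec_mat_def using l_half by (intro sum.cong refl) force
      also have "\<dots> = (if p = q' then 1 else 0)" by (rule spec_one[OF e p q'])
      finally show "(\<Sum>q\<in>?I. spec_mat ?I e (\<lambda>k. 1 + l k) p q * R q q') = (if p = q' then 1 else 0)" .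
    qed
    finally show ?thesis using sum_delta_mult_left[OF finite_atLeastAtMost p, of ?b] by simp
  qed
  have d_le: "(\<Sum>p\<in>?I. (d p)\<^sup>2) \<le> 4 * (\<Sum>p\<in>?I. (?b p)\<^sup>2)"
  proof -
    have "(\<Sum>p\<in>?I. (d p)\<^sup>2) = (\<Sum>k\<in>?I. (1 / (1 + l k))\<^sup>2 * (\<Sum>j\<in>?I. e k j * ?b j)\<^sup>2)"
      unfolding d_def by (rule norm_spec_mat_vec[OF finite_atLeastAtMost e]) (simp add: R_def)
    also have "\<dots> \<le> (\<Sum>k\<in>?I. 4 * (\<Sum>j\<in>?I. e k j * ?b j)\<^sup>2)"
    proof (intro sum_mono mult_right_mono)
      fix k assume "k \<in> ?I"
      then have "1 / (1 + l k) \<le> 2" "0 \<le> 1 / (1 + l k)" using l_half[of k] by (auto simp: field_simps)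
      then have "(1 / (1 + l k))\<^sup>2 \<le> 2\<^sup>2" by (intro power_mono)
      then show "(1 / (1 + l k))\<^sup>2 \<le> 4" by simp
    qed simp
    finally show ?thesis by (simp only: sum_distrib_left[symmetric] pars)
  qed
  define r where "r x = resid u x - (\<Sum>p=1..n. d p * \<psi> p x)" for x
  have r0: "(\<Sum>j=1..?m. wt \<psi> n (\<omega> j) * \<psi> p (\<omega> j) * r (\<omega> j)) = 0" if p: "p \<in> ?I" for p
  proof -
    have "(\<Sum>j=1..?m. wt \<psi> n (\<omega> j) * \<psi> p (\<omega> j) * r (\<omega> j))
      = (\<Sum>j=1..?m. wt \<psi> n (\<omega> j) * \<psi> p (\<omega> j) * resid u (\<omega> j))
       - (\<Sum>j=1..?m. \<Sum>q=1..n. (wt \<psi> n (\<omega> j) * \<psi> p (\<omega> j) * \<psi> q (\<omega> j)) * d q)"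
      unfolding r_def right_diff_distrib sum_subtractf sum_distrib_left by (simp add: mult_ac)
    also have "\<dots> = real ?m * ?b p - real ?m * (\<Sum>q\<in>?I. ?G p q * d q)"
    proof -
      have cancel: "real ?m * ((1 / real ?m) * x) = x" for x using m_pos by (simp del: of_nat_mult)
      have "real ?m * (\<Sum>q\<in>?I. ?G p q * d q) = (\<Sum>q\<in>?I. (real ?m * ?G p q) * d q)"
        by (simp only: sum_distrib_left mult.assoc)
      also have "\<dots> = (\<Sum>q=1..n. \<Sum>j=1..?m. (wt \<psi> n (\<omega> j) * \<psi> p (\<omega> j) * \<psi> q (\<omega> j)) * d q)"
        by (simp only: gram_def cancel sum_distrib_right)
      finally show ?thesis by (subst sum.swap) (simp only: noise_def cancel)
    qed
    finally show ?thesis by (simp only: Gd[OF p])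
  qed
  define v0 where "v0 x = (\<Sum>p=1..n. (coef u p + d p) * \<psi> p x)" for x
  have shift: "u x - (\<Sum>p=1..n. c p * \<psi> p x) = r x + (\<Sum>p=1..n. (coef u p + d p - c p) * \<psi> p x)" for c x
    unfolding diff_span[of u] r_def by (simp add: algebra_simps sum.distrib sum_subtractf)
  have cmp: "disc_norm \<psi> n ?m \<omega> (\<lambda>x. u x - (\<Sum>p=1..n. c p * \<psi> p x))
     = sqrt ((1 / real ?m) * (\<Sum>j=1..?m. wt \<psi> n (\<omega> j) * (r (\<omega> j))\<^sup>2)
         + bilin ?I ?G (\<lambda>p. coef u p + d p - c p) (\<lambda>p. coef u p + d p - c p))" for c
    unfolding disc_norm_def shift by (subst disc_norm_expand[OF r0]) auto
  have bil: "bilin ?I ?G z z \<ge> 1/2 * (\<Sum>p\<in>?I. (z p)\<^sup>2)" for z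
  proof -
    have "bilin ?I ?G z z = bilin ?I (spec_mat ?I e (\<lambda>k. 1 + l k)) z z" by (intro bilin_cong G) auto
    also have "\<dots> = (\<Sum>k\<in>?I. (1 + l k) * (\<Sum>j\<in>?I. e k j * z j)\<^sup>2)" by (simp add: bilin_spec power2_eq_square)
    also have "\<dots> \<ge> (\<Sum>k\<in>?I. 1/2 * (\<Sum>j\<in>?I. e k j * z j)\<^sup>2)"
      by (intro sum_mono mult_right_mono l_half) auto
    finally show ?thesis by (simp only: sum_distrib_left[symmetric] pars)
  qed
  have bil0: "bilin ?I ?G (\<lambda>p. coef u p + d p - (coef u p + d p)) (\<lambda>p. coef u p + d p - (coef u p + d p)) = 0"
    by (simp add: bilin_def)
  have v0: "v0 \<in> Vspace \<psi> n" unfolding Vspace_def v0_def[abs_def]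
    by (rule CollectI, rule exI[of _ "\<lambda>p. coef u p + d p"]) simp
  have "\<exists>v. v \<in> Vspace \<psi> n \<and>
      (\<forall>v'\<in>Vspace \<psi> n. disc_norm \<psi> n ?m \<omega> (\<lambda>x. u x - v x) \<le> disc_norm \<psi> n ?m \<omega> (\<lambda>x. u x - v' x))"
  proof (intro exI[of _ v0] conjI ballI v0)
    fix v' assume "v' \<in> Vspace \<psi> n"
    then obtain c where v': "v' = (\<lambda>x. \<Sum>p=1..n. c p * \<psi> p x)" by (auto simp: Vspace_def)
    have "0 \<le> bilin ?I ?G (\<lambda>p. coef u p + d p - c p) (\<lambda>p. coef u p + d p - c p)"
      by (rule order_trans[OF _ bil]) (auto intro: sum_nonneg)
    then show "disc_norm \<psi> n ?m \<omega> (\<lambda>x. u x - v0 x) \<le> disc_norm \<psi> n ?m \<omega> (\<lambda>x. u x - v' x)"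
      unfolding v' v0_def cmp bil0 by simp
  qed
  \<comment> \<open>Existence of a minimiser makes the choice in \<open>uW\<close> meaningful;
    comparing the chosen function with \<open>v0\<close> then forces equal coefficients.\<close>
  from someI_ex[OF this] have W: "uW \<psi> n ?m \<omega> u \<in> Vspace \<psi> n"
    "disc_norm \<psi> n ?m \<omega> (\<lambda>x. u x - uW \<psi> n ?m \<omega> u x) \<le> disc_norm \<psi> n ?m \<omega> (\<lambda>x. u x - v0 x)"
    using v0 unfolding uW_def by blast+
  obtain c where c: "uW \<psi> n ?m \<omega> u = (\<lambda>x. \<Sum>p=1..n. c p * \<psi> p x)" using W(1) by (auto simp: Vspace_def)
  have "bilin ?I ?G (\<lambda>p. coef u p + d p - c p) (\<lambda>p. coef u p + d p - c p) \<le> 0"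
    using W(2) unfolding c v0_def cmp bil0 by simp
  then have "(\<Sum>p\<in>?I. (coef u p + d p - c p)\<^sup>2) \<le> 0"
    using bil[of "\<lambda>p. coef u p + d p - c p"] by simp
  then have z0: "(\<Sum>p\<in>?I. (coef u p + d p - c p)\<^sup>2) = 0"
    by (intro antisym sum_nonneg) auto
  have cd: "coef u p - c p = - d p" if "p \<in> ?I" for p
  proof -
    have "(coef u p + d p - c p)\<^sup>2 = 0"
      using z0 that by (subst (asm) sum_nonneg_eq_0_iff) auto
    then show ?thesis by simp
  qed
  have "(L2norm \<rho> (\<lambda>x. u x - uW \<psi> n ?m \<omega> u x))\<^sup>2 = (\<integral>x. (resid u x)\<^sup>2 \<partial>\<rho>) + (\<Sum>p=1..n. (coef u p - c p)\<^sup>2)"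
    unfolding L2norm_sq c diff_span by (rule resid_pythagoras[OF u])
  also have "(\<Sum>p=1..n. (coef u p - c p)\<^sup>2) = (\<Sum>p=1..n. (d p)\<^sup>2)"
    by (intro sum.cong refl) (simp add: cd)
  finally show ?thesis using d_le by simp
qed

text \<open>The mean vanishes because the residual is orthogonal to the basis functions. Summed over
  \<open>p\<close>, the ratios of the squared basis functions to \<open>christoffel\<close> add up
  to 1, so the bound does not grow with the dimension.\<close>

lemma noise_second_moment:
  assumes u: "u \<in> L2set \<rho>"
  shows "(\<Sum>p=1..n. \<integral>\<^sup>+\<omega>. ennreal ((noise u \<omega> p)\<^sup>2) \<partial>P) \<le> ennreal ((\<integral>x. (resid u x)\<^sup>2 \<partial>\<rho>) / real \<tau>)"
proof -
  have rm [measurable]: "resid u \<in> borel_measurable \<rho>" using resid_L2[OF u] by (simp add: L2set_def)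
  define F where "F p x = (1 / real (\<tau> * n)) * (wt \<psi> n x * \<psi> p x * resid u x)" for p x
  have Fm: "F p \<in> borel_measurable \<rho>" if "p \<in> {1..n}" for p
    using that unfolding F_def[abs_def] wt_eq by auto
  have SF: "christoffel x * F p x = (1 / real \<tau>) * (resid u x * \<psi> p x)" if "x \<in> space \<rho>" for p x
    using christoffel_pos[OF that] n_pos tau_pos by (simp add: F_def wt_eq)
  have SF2: "christoffel x * (F p x)\<^sup>2 = (1 / real \<tau>)\<^sup>2 * ((\<psi> p x)\<^sup>2 / christoffel x) * (resid u x)\<^sup>2" if "x \<in> space \<rho>" for p x
    using christoffel_pos[OF that] n_pos tau_pos by (simp add: F_def wt_eq power2_eq_square mult_ac)
  have intSF: "integrable \<rho> (\<lambda>x. christoffel x * F p x)" if p: "p \<in> {1..n}" for p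
  proof -
    have "integrable \<rho> (\<lambda>x. (1 / real \<tau>) * (resid u x * \<psi> p x))"
      using p by (intro integrable_mult_right L2set_mult_integrable resid_L2 u psi_L2) auto
    then show ?thesis by (subst Bochner_Integration.integrable_cong[OF refl SF])
  qed
  have r2: "integrable \<rho> (\<lambda>x. (resid u x)\<^sup>2)" using resid_L2[OF u] by (simp add: L2set_def)
  have intSF2: "integrable \<rho> (\<lambda>x. christoffel x * (F p x)\<^sup>2)" if p: "p \<in> {1..n}" for p
  proof (rule Bochner_Integration.integrable_bound[OF integrable_mult_right[OF r2, of "(1 / real \<tau>)\<^sup>2"]])
    show "(\<lambda>x. christoffel x * (F p x)\<^sup>2) \<in> borel_measurable \<rho>" using Fm[OF p] by auto
    show "AE x in \<rho>. norm (christoffel x * (F p x)\<^sup>2) \<le> norm ((1 / real \<tau>)\<^sup>2 * (resid u x)\<^sup>2)"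
    proof (rule AE_I2)
      fix x assume x: "x \<in> space \<rho>"
      have "(\<psi> p x)\<^sup>2 \<le> christoffel x" unfolding christoffel_def using p by (intro member_le_sum) auto
      then have "(\<psi> p x)\<^sup>2 / christoffel x \<le> 1" using christoffel_pos[OF x] by simp
      then have "(1 / real \<tau>)\<^sup>2 * ((\<psi> p x)\<^sup>2 / christoffel x) * (resid u x)\<^sup>2 \<le> (1 / real \<tau>)\<^sup>2 * 1 * (resid u x)\<^sup>2"
        by (intro mult_right_mono mult_left_mono) auto
      then show "norm (christoffel x * (F p x)\<^sup>2) \<le> norm ((1 / real \<tau>)\<^sup>2 * (resid u x)\<^sup>2)"
        unfolding SF2[OF x] using christoffel_nonneg[of x] by simp
    qed
  qed
  have step: "(\<integral>\<^sup>+\<omega>. ennreal ((noise u \<omega> p)\<^sup>2) \<partial>P) \<le> ennreal (real \<tau> * (\<integral>x. christoffel x * (F p x)\<^sup>2 \<partial>\<rho>))"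
    if p: "p \<in> {1..n}" for p
  proof -
    define Y where "Y k x = (if k \<in> {1..\<tau> * n} then F p x else 0)" for k x
    have Ym: "Y k \<in> borel_measurable (N k)" for k
      unfolding Y_def using N_meas[OF Fm[OF p]] by (cases "k \<in> {1..\<tau> * n}") auto
    have Y2: "integrable (N k) (\<lambda>x. (Y k x)\<^sup>2)" for k
    proof (cases "k \<in> {1..\<tau> * n}")
      case True
      have "integrable (N k) (\<lambda>x. (F p x)\<^sup>2)"
        using Fm[OF p] by (intro N_integrable intSF2 p True) auto
      then show ?thesis using True by (simp add: Y_def)
    next
      case False
      then have "Y k = (\<lambda>_. 0)" by (auto simp: Y_def fun_eq_iff)
      then show ?thesis by simp
    qed
    have "(\<integral>\<^sup>+\<omega>. ennreal ((0 + (\<Sum>k\<in>J. Y k (\<omega> k)))\<^sup>2) \<partial>P)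
      \<le> ennreal ((0 + (\<Sum>k\<in>J. \<integral>x. Y k x \<partial>N k))\<^sup>2 + (\<Sum>k\<in>J. \<integral>x. (Y k x)\<^sup>2 \<partial>N k))"
      by (intro second_moment_sum_le J N_prob Ym Y2)
    also have "(\<Sum>k\<in>J. \<integral>x. Y k x \<partial>N k) = (\<Sum>k\<in>{1..\<tau> * n}. \<integral>x. F p x \<partial>N k)"
      using J by (intro sum.mono_neutral_cong_right) (auto simp: Y_def)
    also have "\<dots> = real \<tau> * (\<integral>x. christoffel x * F p x \<partial>\<rho>)" by (rule stratified_mean[OF Fm[OF p] intSF[OF p]])
    also have "(\<integral>x. christoffel x * F p x \<partial>\<rho>) = (\<integral>x. (1 / real \<tau>) * (resid u x * \<psi> p x) \<partial>\<rho>)"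
      by (intro Bochner_Integration.integral_cong refl SF)
    also have "\<dots> = 0" using resid_ortho[OF u p] by simp
    also have "(\<Sum>k\<in>J. \<integral>x. (Y k x)\<^sup>2 \<partial>N k) = (\<Sum>k\<in>{1..\<tau> * n}. \<integral>x. (F p x)\<^sup>2 \<partial>N k)"
      using J by (intro sum.mono_neutral_cong_right) (auto simp: Y_def)
    also have "\<dots> = real \<tau> * (\<integral>x. christoffel x * (F p x)\<^sup>2 \<partial>\<rho>)"
      using Fm[OF p] by (intro stratified_mean intSF2 p) auto
    finally have "(\<integral>\<^sup>+\<omega>. ennreal ((\<Sum>k\<in>J. Y k (\<omega> k))\<^sup>2) \<partial>P) \<le> ennreal (real \<tau> * (\<integral>x. christoffel x * (F p x)\<^sup>2 \<partial>\<rho>))"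
      by simp
    moreover have "(\<Sum>k\<in>J. Y k (\<omega> k)) = noise u \<omega> p" for \<omega>
    proof -
      have "(\<Sum>k\<in>J. Y k (\<omega> k)) = (\<Sum>k\<in>{1..\<tau> * n}. F p (\<omega> k))"
        using J by (intro sum.mono_neutral_cong_right) (auto simp: Y_def)
      then show ?thesis by (simp add: noise_def F_def sum_distrib_left)
    qed
    ultimately show ?thesis by simp
  qed
  have "(\<Sum>p=1..n. \<integral>\<^sup>+\<omega>. ennreal ((noise u \<omega> p)\<^sup>2) \<partial>P) \<le> (\<Sum>p=1..n. ennreal (real \<tau> * (\<integral>x. christoffel x * (F p x)\<^sup>2 \<partial>\<rho>)))"
    by (intro sum_mono step)
  also have "\<dots> = ennreal (\<Sum>p=1..n. real \<tau> * (\<integral>x. christoffel x * (F p x)\<^sup>2 \<partial>\<rho>))"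
    by (intro sum_ennreal mult_nonneg_nonneg integral_nonneg_AE) (auto simp: christoffel_nonneg)
  also have "(\<Sum>p=1..n. real \<tau> * (\<integral>x. christoffel x * (F p x)\<^sup>2 \<partial>\<rho>)) = real \<tau> * (\<integral>x. (\<Sum>p=1..n. christoffel x * (F p x)\<^sup>2) \<partial>\<rho>)"
    by (subst Bochner_Integration.integral_sum[OF intSF2]) (simp_all add: sum_distrib_left)
  also have "(\<integral>x. (\<Sum>p=1..n. christoffel x * (F p x)\<^sup>2) \<partial>\<rho>) = (\<integral>x. (1 / real \<tau>)\<^sup>2 * (resid u x)\<^sup>2 \<partial>\<rho>)"
  proof (intro Bochner_Integration.integral_cong refl)
    fix x assume x: "x \<in> space \<rho>"
    have "(\<Sum>p=1..n. christoffel x * (F p x)\<^sup>2) = (1 / real \<tau>)\<^sup>2 * ((\<Sum>p=1..n. (\<psi> p x)\<^sup>2) / christoffel x) * (resid u x)\<^sup>2"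
      unfolding SF2[OF x] by (simp add: sum_distrib_left sum_distrib_right sum_divide_distrib)
    also have "(\<Sum>p=1..n. (\<psi> p x)\<^sup>2) / christoffel x = 1" using christoffel_pos[OF x] by (simp add: christoffel_def)
    finally show "(\<Sum>p=1..n. christoffel x * (F p x)\<^sup>2) = (1 / real \<tau>)\<^sup>2 * (resid u x)\<^sup>2" by simp
  qed
  also have "real \<tau> * (\<integral>x. (1 / real \<tau>)\<^sup>2 * (resid u x)\<^sup>2 \<partial>\<rho>) = (\<integral>x. (resid u x)\<^sup>2 \<partial>\<rho>) / real \<tau>"
    using tau_pos by (simp add: power2_eq_square)
  finally show ?thesis .
qed

lemma noise_meas:
  assumes u: "u \<in> L2set \<rho>" and p: "p \<in> {1..n}"
  shows "(\<lambda>\<omega>. noise u \<omega> p) \<in> borel_measurable P"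
proof -
  have rm [measurable]: "resid u \<in> borel_measurable \<rho>" using resid_L2[OF u] by (simp add: L2set_def)
  have "(\<lambda>x. wt \<psi> n x * \<psi> p x * resid u x) \<in> borel_measurable \<rho>"
    unfolding wt_eq using p by auto
  from component_meas[OF this]
  have "(\<lambda>\<omega>. \<Sum>j=1..\<tau> * n. wt \<psi> n (\<omega> j) * \<psi> p (\<omega> j) * resid u (\<omega> j)) \<in> borel_measurable P"
    using J by (intro borel_measurable_sum) auto
  then show ?thesis unfolding noise_def by simp
qed

text \<open>The pointwise majorant is measurable, so the error itself, which contains a choice,
  enters only through monotonicity of the integral. On the bad event the estimator is 0 and the
  error is the norm of \<open>u\<close>.\<close>

theorem expected_error:
  assumes u: "u \<in> L2set \<rho>"
  shows "(\<integral>\<^sup>+\<omega>. ennreal ((L2norm \<rho> (\<lambda>x. u x - uC \<psi> n (\<tau> * n) \<omega> u x))\<^sup>2) \<partial>P)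
    \<le> ennreal ((1 + 4 / real \<tau>) * (best_err \<rho> \<psi> n u)\<^sup>2
         + PP.P.prob {\<omega> \<in> space P. \<not> good \<omega>} * (L2norm \<rho> u)\<^sup>2)"
proof -
  let ?r = "\<integral>x. (resid u x)\<^sup>2 \<partial>\<rho>" and ?bad = "{\<omega> \<in> space P. \<not> good \<omega>}"
  have bad: "?bad \<in> sets P"
  proof -
    have "?bad = space P - {\<omega> \<in> space P. good \<omega>}" by auto
    then show ?thesis using good_sets by auto
  qed
  have point: "ennreal ((L2norm \<rho> (\<lambda>x. u x - uC \<psi> n (\<tau> * n) \<omega> u x))\<^sup>2)
    \<le> ennreal ?r + 4 * (\<Sum>p=1..n. ennreal ((noise u \<omega> p)\<^sup>2)) + ennreal ((L2norm \<rho> u)\<^sup>2) * indicator ?bad \<omega>"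
    if w: "\<omega> \<in> space P" for \<omega>
  proof (cases "good \<omega>")
    case True
    have "ennreal ((L2norm \<rho> (\<lambda>x. u x - uC \<psi> n (\<tau> * n) \<omega> u x))\<^sup>2)
      \<le> ennreal (?r + 4 * (\<Sum>p=1..n. (noise u \<omega> p)\<^sup>2))"
      using least_squares_error[OF u True] True by (intro ennreal_leI) (simp add: uC_def good_def)
    also have "\<dots> = ennreal ?r + 4 * (\<Sum>p=1..n. ennreal ((noise u \<omega> p)\<^sup>2))"
      by (subst ennreal_plus) (auto simp: ennreal_mult' sum_ennreal intro: sum_nonneg)
    finally show ?thesis using True by simp
  next
    case False
    then have "uC \<psi> n (\<tau> * n) \<omega> u = (\<lambda>x. 0)" by (simp add: uC_def good_def)
    then show ?thesis using False w by simp
  qed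
  have "(\<integral>\<^sup>+\<omega>. ennreal ((L2norm \<rho> (\<lambda>x. u x - uC \<psi> n (\<tau> * n) \<omega> u x))\<^sup>2) \<partial>P)
    \<le> (\<integral>\<^sup>+\<omega>. ennreal ?r + 4 * (\<Sum>p=1..n. ennreal ((noise u \<omega> p)\<^sup>2)) + ennreal ((L2norm \<rho> u)\<^sup>2) * indicator ?bad \<omega> \<partial>P)"
    by (intro nn_integral_mono point)
  also have "\<dots> = ennreal ?r + 4 * (\<Sum>p=1..n. \<integral>\<^sup>+\<omega>. ennreal ((noise u \<omega> p)\<^sup>2) \<partial>P) + ennreal ((L2norm \<rho> u)\<^sup>2) * emeasure P ?bad"
  proof -
    note [measurable] = noise_meas[OF u] bad
    have nm: "(\<lambda>\<omega>. \<Sum>p=1..n. ennreal ((noise u \<omega> p)\<^sup>2)) \<in> borel_measurable P"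
      by (intro borel_measurable_sum) auto
    have "(\<integral>\<^sup>+\<omega>. (\<Sum>p=1..n. ennreal ((noise u \<omega> p)\<^sup>2)) \<partial>P) = (\<Sum>p=1..n. \<integral>\<^sup>+\<omega>. ennreal ((noise u \<omega> p)\<^sup>2) \<partial>P)"
      by (intro nn_integral_sum) auto
    then show ?thesis
      using nm bad by (subst nn_integral_add nn_integral_cmult nn_integral_cmult_indicator; (simp add: nn_integral_add nn_integral_cmult nn_integral_cmult_indicator PP.P.emeasure_space_1)?)
  qed
  also have "\<dots> \<le> ennreal ?r + 4 * ennreal (?r / real \<tau>) + ennreal ((L2norm \<rho> u)\<^sup>2) * ennreal (PP.P.prob ?bad)"
    unfolding PP.P.emeasure_eq_measure by (intro add_mono mult_left_mono noise_second_moment u) auto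
  also have "\<dots> = ennreal ((1 + 4 / real \<tau>) * ?r + PP.P.prob ?bad * (L2norm \<rho> u)\<^sup>2)"
  proof -
    have "4 * ennreal (?r / real \<tau>) = ennreal (4 * (?r / real \<tau>))" by (subst ennreal_mult') auto
    then show ?thesis by (simp add: ennreal_plus[symmetric] ennreal_mult[symmetric] algebra_simps del: ennreal_plus)
  qed
  also have "\<dots> \<le> ennreal ((1 + 4 / real \<tau>) * (best_err \<rho> \<psi> n u)\<^sup>2 + PP.P.prob ?bad * (L2norm \<rho> u)\<^sup>2)"
    by (intro ennreal_leI add_mono mult_left_mono resid_le_best_err u) auto
  finally show ?thesis .
qed

end

subsection \<open>Failure probabilities over all levels\<close>

lemma ln_three_halves_bounds: "ln (3/2 :: real) \<ge> 0.405" "ln (3/2 :: real) \<le> 0.4055"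
  using ln_approx_bounds[of "3/2" 2] by (simp_all add: eval_nat_numeral)

lemma ln_two_le: "ln (2 :: real) \<le> 0.6932"
  using ln_approx_bounds[of 2 3] by (simp add: eval_nat_numeral)

lemma theta_pos: "theta > 0"
  using ln_three_halves_bounds by (simp add: theta_def)

text \<open>The true ratio of the rates is about 1.418. With 7/5 and \<open>s > 1\<close> the lower
  tail of a level decays like \<open>n powr (1 - 14/5)\<close>, just fast enough for the sum over
  \<open>n >= 2\<close> to stay below 1.\<close>

lemma lower_rate_ge: "(1 - ln 2) / 2 \<ge> 7/5 * theta"
  using ln_three_halves_bounds ln_two_le by (simp add: theta_def)

text \<open>Mean value theorem for \<open>x powr (-4/5)\<close>; the right-hand side
  telescopes.\<close>

lemma powr_neg_step:
  fixes x :: real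
  assumes "x \<ge> 2"
  shows "x powr (-9/5) \<le> 5/4 * ((x - 1) powr (-4/5) - x powr (-4/5))"
proof -
  have "\<exists>z>x - 1. z < x \<and> x powr (-4/5) - (x - 1) powr (-4/5) = (x - (x - 1)) * (-4/5 * z powr (-4/5 - 1))"
    using assms by (intro MVT2) (auto intro!: derivative_eq_intros)
  then obtain z where z: "z > x - 1" "z < x" "x powr (-4/5) - (x - 1) powr (-4/5) = -4/5 * z powr (-9/5)"
    by auto
  have "x powr (-9/5) \<le> z powr (-9/5)" using z assms by (intro powr_mono2') auto
  then show ?thesis using z(3) by simp
qed

text \<open>Raising to the fifth power turns the comparison into one between rationals when
  \<open>x\<close> and \<open>c\<close> are numerals.\<close>

lemma powr_le_by_power:
  fixes x c :: real
  assumes "x > 0" "c > 0" "x ^ 4 * c ^ 5 \<ge> 1"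
  shows "x powr (-4/5) \<le> c"
proof (rule ccontr)
  assume "\<not> x powr (-4/5) \<le> c"
  then have "c ^ 5 < (x powr (-4/5)) ^ 5" using assms by (intro power_strict_mono) auto
  also have "(x powr (-4/5)) ^ 5 = x powr (-4)" using assms by (simp add: powr_power)
  also have "\<dots> = 1 / x ^ 4" using assms by (simp add: powr_minus divide_inverse powr_numeral)
  finally show False using assms by (simp add: field_simps)
qed

lemma sum_powr_neg_le_1:
  assumes "finite A" "A \<subseteq> {2..}"
  shows "(\<Sum>a\<in>A. real a powr (-9/5)) \<le> 1"
proof -
  have split: "real a powr (-9/5) = real a powr (-4/5) / real a" if "a > 0" for a :: nat
    using that powr_diff[of "real a" "-4/5" 1] by simp
  have v: "2 powr (-4/5) \<le> (0.58 :: real)" "3 powr (-4/5) \<le> (0.42 :: real)"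
    by (rule powr_le_by_power; simp add: eval_nat_numeral)+
  have two: "2 powr (-9/5) \<le> (0.29 :: real)" and three: "3 powr (-9/5) \<le> (0.14 :: real)"
    using split[of 2] split[of 3] v by auto
  \<comment> \<open>The terms 2 and 3 are estimated separately: with telescoping from 3 on, the
    bound would be \<open>2 powr (-9/5) + 5/4 * 2 powr (-4/5)\<close>, slightly above 1.\<close>
  have bound: "(\<Sum>a=2..M + 3. real a powr (-9/5)) \<le> 0.43 + 5/4 * (3 powr (-4/5) - real (M + 3) powr (-4/5))" for M
  proof (induction M)
    case 0
    have "{2..0 + 3} = {2, 3 :: nat}" by auto
    then show ?case using two three by simp
  next
    case (Suc M)
    have "(\<Sum>a=2..Suc M + 3. real a powr (-9/5)) = (\<Sum>a=2..M + 3. real a powr (-9/5)) + real (M + 4) powr (-9/5)"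
      by (simp add: numeral_eq_Suc)
    also have "real (M + 4) powr (-9/5) \<le> 5/4 * (real (M + 3) powr (-4/5) - real (M + 4) powr (-4/5))"
      using powr_neg_step[of "real (M + 4)"] by (simp add: algebra_simps)
    finally show ?case using Suc by (simp add: algebra_simps)
  qed
  obtain M where M: "A \<subseteq> {..M}" using assms(1) finite_nat_iff_bounded_le by blast
  have "(\<Sum>a\<in>A. real a powr (-9/5)) \<le> (\<Sum>a=2..M + 3. real a powr (-9/5))"
    using M assms by (intro sum_mono2) (auto simp: subset_iff trans_le_add1)
  also have "\<dots> \<le> 0.43 + 5/4 * (3 powr (-4/5) - real (M + 3) powr (-4/5))" by (rule bound)
  also have "\<dots> \<le> 0.43 + 5/4 * (0.42 - 0)" using v(2) by (intro add_mono mult_left_mono diff_mono) auto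
  finally show ?thesis by simp
qed

text \<open>The summand 1 is the first term of the series, kept apart because no index in
  \<open>A\<close> uses it.\<close>

lemma zeta_ge:
  assumes s: "s > 1" and A: "finite A" "A \<subseteq> {2..}"
  shows "1 + (\<Sum>a\<in>A. real a powr (- s)) \<le> zeta_real s"
proof -
  have sm: "summable (\<lambda>i. 1 / real (Suc i) powr s)"
  proof -
    have "summable (\<lambda>i. real i powr (- s))" using s by (simp add: summable_real_powr_iff)
    then have "summable (\<lambda>i. real (Suc i) powr (- s))" by (subst summable_Suc_iff)
    then show ?thesis by (simp add: powr_minus divide_inverse)
  qed
  have "1 + (\<Sum>a\<in>A. real a powr (- s)) = (\<Sum>a\<in>insert 1 A. real a powr (- s))"
    using A by (subst sum.insert) auto
  \<comment> \<open>\<open>zeta_real\<close> counts from 0, hence the shift by one.\<close>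
  also have "\<dots> = (\<Sum>i\<in>(\<lambda>a. a - 1) ` insert 1 A. 1 / real (Suc i) powr s)"
  proof (subst sum.reindex)
    show "inj_on (\<lambda>a. a - 1) (insert 1 A)" using A by (intro inj_on_diff_nat) auto
    show "(\<Sum>a\<in>insert 1 A. real a powr - s) = sum ((\<lambda>i. 1 / real (Suc i) powr s) \<circ> (\<lambda>a. a - 1)) (insert 1 A)"
      using A by (intro sum.cong refl) (auto simp: powr_minus divide_inverse subset_iff)
  qed
  also have "\<dots> \<le> zeta_real s"
    unfolding zeta_real_def using A by (intro sum_le_suminf sm) auto
  finally show ?thesis .
qed

lemma zeta_ge_1: "s > 1 \<Longrightarrow> zeta_real s \<ge> 1"
  using zeta_ge[of s "{}"] by simp

section \<open>Samples per label and the failure probability of one level\<close>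

definition log_term :: "real \<Rightarrow> real \<Rightarrow> nat \<Rightarrow> real" where
  "log_term s \<alpha> a = ln (zeta_real s * real a powr (s + 1) / \<alpha>)"

lemma log_term_eq:
  assumes "s > 1" "0 < \<alpha>" "a \<ge> 1"
  shows "log_term s \<alpha> a = ln (zeta_real s) + (s + 1) * ln (real a) - ln \<alpha>"
  using assms zeta_ge_1[OF assms(1)] by (simp add: log_term_def ln_div ln_mult ln_powr)

lemma log_term_pos:
  assumes "s > 1" "0 < \<alpha>" "\<alpha> < 1" "a \<ge> 1"
  shows "log_term s \<alpha> a > 0"
proof -
  have "ln (zeta_real s) \<ge> 0" "(s + 1) * ln (real a) \<ge> 0" "ln \<alpha> < 0"
    using assms zeta_ge_1[OF assms(1)] by auto
  then show ?thesis unfolding log_term_eq[OF assms(1,2,4)] by linarith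
qed

lemma tau_eq: "tau s \<alpha> a = nat \<lceil>log_term s \<alpha> a / theta\<rceil>"
  by (simp add: tau_def log_term_def)

lemma tau_ge: "real (tau s \<alpha> a) \<ge> log_term s \<alpha> a / theta"
  unfolding tau_eq by (rule real_nat_ceiling_ge)

lemma tau_pos:
  assumes "s > 1" "0 < \<alpha>" "\<alpha> < 1" "a \<ge> 1"
  shows "tau s \<alpha> a \<ge> 1"
proof -
  have "0 < log_term s \<alpha> a / theta"
    using log_term_pos[OF assms] theta_pos by (rule divide_pos_pos)
  also have "\<dots> \<le> real (tau s \<alpha> a)" by (rule tau_ge)
  finally show ?thesis by simp
qed

lemma tau_mono:
  assumes "s > 1" "0 < \<alpha>" "1 \<le> a" "a \<le> b"
  shows "tau s \<alpha> a \<le> tau s \<alpha> b"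
proof -
  have "(s + 1) * ln (real a) \<le> (s + 1) * ln (real b)" using assms by (intro mult_left_mono) auto
  then have "log_term s \<alpha> a \<le> log_term s \<alpha> b" using assms by (simp add: log_term_eq)
  then show ?thesis unfolding tau_eq
    using theta_pos by (intro nat_mono ceiling_mono divide_right_mono) auto
qed

text \<open>The upper tail meets its share exactly: \<open>a * exp (- log_term s \<alpha> a)\<close>
  is \<alpha> / \<zeta>(s) times \<open>a powr (- s)\<close>. For the lower tail the rate 7/5 leaves
  \<open>a\<close> the exponent \<open>1 - 7/5 * (s + 1)\<close>, which is below \<open>-9/5\<close>
  as \<open>s > 1\<close>; the higher powers of \<alpha> and of 1 / \<zeta>(s) only help.\<close>

lemma failure_bound:
  assumes "s > 1" "0 < \<alpha>" "\<alpha> < 1" "a \<ge> 1"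
  shows "real a * (exp (- (theta * real (tau s \<alpha> a))) + exp (- ((1 - ln 2) / 2 * real (tau s \<alpha> a))))
    \<le> \<alpha> / zeta_real s * (real a powr (- s) + real a powr (-9/5))"
proof -
  let ?L = "log_term s \<alpha> a" and ?\<tau> = "real (tau s \<alpha> a)" and ?z = "zeta_real s"
  have z1: "?z \<ge> 1" using zeta_ge_1 assms by simp
  have a0: "real a > 0" using assms by simp
  have tau: "theta * ?\<tau> \<ge> ?L" using tau_ge[of s \<alpha> a] theta_pos by (simp add: field_simps)
  have "7/5 * theta * ?\<tau> \<le> (1 - ln 2) / 2 * ?\<tau>" by (intro mult_right_mono lower_rate_ge) auto
  then have tau2: "(1 - ln 2) / 2 * ?\<tau> \<ge> 7/5 * ?L" using tau by linarith
  have L: "?L = ln ?z + (s + 1) * ln (real a) - ln \<alpha>" using assms by (intro log_term_eq)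
  have pw: "real a * exp x \<le> \<alpha> / ?z * real a powr y" if "x + ln (real a) \<le> ln \<alpha> - ln ?z + y * ln (real a)" for x y
  proof -
    have "real a * exp x = exp (x + ln (real a))" using a0 by (simp add: exp_add)
    also have "\<dots> \<le> exp (ln \<alpha> - ln ?z + y * ln (real a))" using that by simp
    also have "\<dots> = \<alpha> / ?z * real a powr y" using a0 z1 assms by (simp add: exp_add exp_diff powr_def)
    finally show ?thesis .
  qed
  have "real a * exp (- (theta * ?\<tau>)) \<le> \<alpha> / ?z * real a powr (- s)"
    by (rule pw) (use tau L in \<open>simp add: algebra_simps\<close>)
  moreover have "real a * exp (- ((1 - ln 2) / 2 * ?\<tau>)) \<le> \<alpha> / ?z * real a powr (-9/5)"
  proof (rule pw)
    have "ln ?z \<ge> 0" "ln \<alpha> \<le> 0" "(s - 1) * ln (real a) \<ge> 0" using assms z1 by auto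
    moreover have "7/5 * ?L = 7/5 * ln ?z + 7/5 * ((s - 1) * ln (real a)) + 14/5 * ln (real a) - 7/5 * ln \<alpha>"
      unfolding L by (simp add: field_simps)
    ultimately show "- ((1 - ln 2) / 2 * ?\<tau>) + ln (real a) \<le> ln \<alpha> - ln ?z + -9/5 * ln (real a)"
      using tau2 by linarith
  qed
  ultimately show ?thesis by (simp add: distrib_left)
qed

lemma prob_space_chi:
  assumes "L2_onb \<rho> \<psi>" "j \<ge> 1"
  shows "prob_space (chi \<rho> \<psi> j)"
proof
  have m: "\<psi> j \<in> borel_measurable \<rho>" and i: "integrable \<rho> (\<lambda>x. (\<psi> j x)\<^sup>2)" and o: "(\<integral>x. \<psi> j x * \<psi> j x \<partial>\<rho>) = 1"
    using assms by (auto simp: L2_onb_def L2set_def)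
  have "emeasure (chi \<rho> \<psi> j) (space (chi \<rho> \<psi> j)) = (\<integral>\<^sup>+x. ennreal ((\<psi> j x)\<^sup>2) \<partial>\<rho>)"
    unfolding chi_def using m by (subst emeasure_density) (auto intro!: nn_integral_cong)
  also have "\<dots> = ennreal (\<integral>x. (\<psi> j x)\<^sup>2 \<partial>\<rho>)" using i by (intro nn_integral_eq_integral) auto
  finally show "emeasure (chi \<rho> \<psi> j) (space (chi \<rho> \<psi> j)) = 1" using o by (simp add: power2_eq_square)
qed

section \<open>Union bound over the levels and the two claims\<close>

theorem theorem3:
  fixes X :: "'a::euclidean_space set" and \<rho> :: "'a measure"
    and \<psi> :: "nat \<Rightarrow> 'a \<Rightarrow> real"
    and \<alpha> s :: real and K :: nat and n :: "nat \<Rightarrow> nat" and lab :: "nat \<Rightarrow> nat"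
  assumes X_borel: "X \<in> sets borel"
    and rho_sets: "sets \<rho> = sets (restrict_space borel X)"
    and rho_prob: "prob_space \<rho>"
    and onb: "L2_onb \<rho> \<psi>"
    and alpha: "0 < \<alpha>" "\<alpha> < 1"
    and s_gt: "1 < s"
    and K_ge: "1 \<le> K"
    and n1: "1 \<le> n 1"
    and n_mono: "\<And>k. 1 \<le> k \<Longrightarrow> k < K \<Longrightarrow> n k < n (Suc k)"
    and nonvanish: "\<And>x. x \<in> X \<Longrightarrow> \<exists>i\<in>{1..n 1}. \<psi> i x \<noteq> 0"
    and lab_counts: "\<And>k j. k \<in> {1..K} \<Longrightarrow> j \<in> {1..n k} \<Longrightarrow>
                       card {i \<in> {1..msamp s \<alpha> (n k)}. lab i = j} = tau s \<alpha> (n k)"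
  defines "P \<equiv> PiM {1..msamp s \<alpha> (n K)} (\<lambda>i. chi \<rho> \<psi> (lab i))"
  shows "measure P {\<omega> \<in> space P. \<forall>k\<in>{1..K}.
            spec_norm (n k) (\<lambda>p q. gram \<psi> (n k) (msamp s \<alpha> (n k)) \<omega> p q - idm p q) \<le> 1/2}
           \<ge> 1 - \<alpha> \<and>
         (\<forall>u\<in>L2set \<rho>. \<forall>k\<in>{1..K}.
           (\<integral>\<^sup>+ \<omega>. ennreal ((L2norm \<rho> (\<lambda>x. u x - uC \<psi> (n k) (msamp s \<alpha> (n k)) \<omega> u x))^2) \<partial>P)
           \<le> ennreal ((1 + 4 * theta / ln (zeta_real s * real (n k) powr (s + 1) / \<alpha>))
                        * (best_err \<rho> \<psi> (n k) u)^2 + \<alpha> * (L2norm \<rho> u)^2))"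
proof -
  define J where "J = {1..msamp s \<alpha> (n K)}"
  \<comment> \<open>Off \<open>J\<close> a probability measure must be supplied; \<open>chi\<close>
    may fail to be one for a label such as 0, which is outside the basis.\<close>
  define N where "N i = (if i \<in> J then chi \<rho> \<psi> (lab i) else \<rho>)" for i
  have PN: "P = Pi\<^sub>M J N" unfolding P_def J_def[symmetric] by (intro PiM_cong) (auto simp: N_def)
  have space: "space \<rho> = X" using sets_eq_imp_space_eq[OF rho_sets] by (simp add: space_restrict_space)
  have strict: "n i < n j" if "1 \<le> i" "i < j" "j \<le> K" for i j
    using that(2,3)
  proof (induction j)
    case (Suc j)
    then show ?case using n_mono[of j] that(1) by (cases "i = j") auto
  qed simp
  have mono: "n i \<le> n j" if "1 \<le> i" "i \<le> j" "j \<le> K" for i j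
    using strict[of i j] that by (cases "i = j") auto
  have inj: "inj_on n {1..K}"
    by (rule linorder_inj_onI) (use strict in fastforce)+
  have n_ge: "1 \<le> n k" if "k \<in> {1..K}" for k using n1 mono[of 1 k] that by auto
  have loc: "stratified_sampling \<rho> \<psi> (n k) (tau s \<alpha> (n k)) lab J N" if k: "k \<in> {1..K}" for k
  proof (intro stratified_sampling.intro rho_prob stratified_sampling_axioms.intro onb n_ge k
      tau_pos s_gt alpha)
    have K: "K \<in> {1..K}" using K_ge by simp
    have lab: "lab i \<in> {1..n K}" if "i \<in> J" for i
      using label_range[of "n K" "tau s \<alpha> (n K)" lab] lab_counts[OF K] that
      unfolding J_def msamp_def by blast
    show "\<exists>i\<in>{1..n k}. \<psi> i x \<noteq> 0" if "x \<in> space \<rho>" for x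
      using nonvanish[of x] that mono[of 1 k] k unfolding space by fastforce
    show "finite J" by (simp add: J_def)
    have "tau s \<alpha> (n k) * n k \<le> tau s \<alpha> (n K) * n K"
      using tau_mono[OF s_gt alpha(1) n_ge[OF k] mono[of k K]] mono[of k K] k by (intro mult_mono) auto
    then show sub: "{1..tau s \<alpha> (n k) * n k} \<subseteq> J" by (auto simp: J_def msamp_def)
    show "card {i \<in> {1..tau s \<alpha> (n k) * n k}. lab i = j} = tau s \<alpha> (n k)" if "j \<in> {1..n k}" for j
      using lab_counts[OF k that] by (simp add: msamp_def)
    show "prob_space (N i)" for i
      using rho_prob prob_space_chi[OF onb, of "lab i"] lab[of i] by (auto simp: N_def)
    show "sets (N i) = sets \<rho>" for i by (simp add: N_def chi_def)
    show "N i = chi \<rho> \<psi> (lab i)" if "i \<in> {1..tau s \<alpha> (n k) * n k}" for i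
      using sub that by (auto simp: N_def)
  qed
  interpret K: stratified_sampling \<rho> \<psi> "n K" "tau s \<alpha> (n K)" lab J N
    using K_ge by (intro loc) simp
  interpret PP: prob_space P unfolding PN by (rule K.PP.P.prob_space_axioms)
  define good where "good k \<omega> \<longleftrightarrow>
      spec_norm (n k) (\<lambda>p q. gram \<psi> (n k) (msamp s \<alpha> (n k)) \<omega> p q - idm p q) \<le> 1/2" for k \<omega>
  have good_eq: "stratified_sampling.good \<psi> (n k) (tau s \<alpha> (n k)) \<omega> \<longleftrightarrow> good k \<omega>" if "k \<in> {1..K}" for k \<omega>
    using stratified_sampling.good_def[OF loc[OF that]] by (simp add: good_def msamp_def)
  have good_sets: "{\<omega> \<in> space P. good k \<omega>} \<in> sets P" if "k \<in> {1..K}" for k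
    using stratified_sampling.good_sets[OF loc[OF that]] unfolding good_eq[OF that] PN .
  have bad_sets: "{\<omega> \<in> space P. \<not> good k \<omega>} \<in> sets P" if "k \<in> {1..K}" for k
  proof -
    have "{\<omega> \<in> space P. \<not> good k \<omega>} = space P - {\<omega> \<in> space P. good k \<omega>}" by auto
    then show ?thesis using good_sets[OF that] by auto
  qed
  \<comment> \<open>The failure budget of dimension \<open>a\<close>, zero where failure is
    impossible.\<close>
  define \<beta> where "\<beta> a = (if a = 1 then 0 else \<alpha> / zeta_real s * (real a powr (- s) + real a powr (-9/5)))" for a :: nat
  have z1: "zeta_real s \<ge> 1" using zeta_ge_1[OF s_gt] .
  have beta_nonneg: "\<beta> a \<ge> 0" for a using alpha z1 by (simp add: \<beta>_def)
  have bad_le: "PP.prob {\<omega> \<in> space P. \<not> good k \<omega>} \<le> \<beta> (n k)" if k: "k \<in> {1..K}" for k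
  proof (cases "n k = 1")
    case True
    then have "{\<omega> \<in> space P. \<not> good k \<omega>} = {}"
      using stratified_sampling.good_if_n_1[OF loc[OF k] True] unfolding good_eq[OF k] PN by blast
    then show ?thesis using True by (simp only: measure_empty \<beta>_def) simp
  next
    case False
    have "PP.prob {\<omega> \<in> space P. \<not> good k \<omega>} \<le> real (n k) * (exp (- (theta * real (tau s \<alpha> (n k))))
        + exp (- ((1 - ln 2) / 2 * real (tau s \<alpha> (n k)))))"
      using stratified_sampling.prob_not_good[OF loc[OF k]] unfolding good_eq[OF k] PN .
    also have "\<dots> \<le> \<beta> (n k)"
      using failure_bound[OF s_gt alpha n_ge[OF k]] False by (simp add: \<beta>_def)
    finally show ?thesis .
  qed
  have beta_sum: "(\<Sum>k\<in>{1..K}. \<beta> (n k)) \<le> \<alpha>"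
  proof -
    define A where "A = n ` {1..K} - {1}"
    have A: "finite A" "A \<subseteq> {2..}" using n_ge by (fastforce simp: A_def)+
    \<comment> \<open>Strictly growing dimensions make \<open>n\<close> injective, so the levels use
      distinct integers and each term of the series is spent at most once.\<close>
    have "(\<Sum>k\<in>{1..K}. \<beta> (n k)) = (\<Sum>a\<in>n ` {1..K}. \<beta> a)" using inj by (simp add: sum.reindex)
    also have "\<dots> = (\<Sum>a\<in>A. \<alpha> / zeta_real s * (real a powr (- s) + real a powr (-9/5)))"
      by (intro sum.mono_neutral_cong_right) (auto simp: A_def \<beta>_def)
    also have "\<dots> = \<alpha> / zeta_real s * ((\<Sum>a\<in>A. real a powr (- s)) + (\<Sum>a\<in>A. real a powr (-9/5)))"
      by (simp only: sum_distrib_left[symmetric] sum.distrib)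
    also have "\<dots> \<le> \<alpha> / zeta_real s * zeta_real s"
      using zeta_ge[OF s_gt A] sum_powr_neg_le_1[OF A] alpha z1 by (intro mult_left_mono) auto
    finally show ?thesis using z1 by simp
  qed
  have bad_le_alpha: "PP.prob {\<omega> \<in> space P. \<not> good k \<omega>} \<le> \<alpha>" if k: "k \<in> {1..K}" for k
  proof -
    have "\<beta> (n k) \<le> (\<Sum>k\<in>{1..K}. \<beta> (n k))" using k beta_nonneg by (intro member_le_sum) auto
    then show ?thesis using bad_le[OF k] beta_sum by linarith
  qed
  have part1: "measure P {\<omega> \<in> space P. \<forall>k\<in>{1..K}. good k \<omega>} \<ge> 1 - \<alpha>"
  proof -
    have U: "(\<Union>k\<in>{1..K}. {\<omega> \<in> space P. \<not> good k \<omega>}) \<in> sets P" using bad_sets by blast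
    have "PP.prob (\<Union>k\<in>{1..K}. {\<omega> \<in> space P. \<not> good k \<omega>}) \<le> (\<Sum>k\<in>{1..K}. PP.prob {\<omega> \<in> space P. \<not> good k \<omega>})"
      using bad_sets by (intro measure_UNION_le) auto
    also have "\<dots> \<le> (\<Sum>k\<in>{1..K}. \<beta> (n k))" by (intro sum_mono bad_le)
    finally have "PP.prob (\<Union>k\<in>{1..K}. {\<omega> \<in> space P. \<not> good k \<omega>}) \<le> \<alpha>" using beta_sum by linarith
    moreover have "{\<omega> \<in> space P. \<forall>k\<in>{1..K}. good k \<omega>} = space P - (\<Union>k\<in>{1..K}. {\<omega> \<in> space P. \<not> good k \<omega>})" by auto
    ultimately show ?thesis using PP.prob_compl[OF U] by simp
  qed
  have part2: "(\<integral>\<^sup>+ \<omega>. ennreal ((L2norm \<rho> (\<lambda>x. u x - uC \<psi> (n k) (msamp s \<alpha> (n k)) \<omega> u x))^2) \<partial>P)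
     \<le> ennreal ((1 + 4 * theta / ln (zeta_real s * real (n k) powr (s + 1) / \<alpha>))
                  * (best_err \<rho> \<psi> (n k) u)^2 + \<alpha> * (L2norm \<rho> u)^2)"
    if u: "u \<in> L2set \<rho>" and k: "k \<in> {1..K}" for u k
  proof -
    have L: "log_term s \<alpha> (n k) > 0" by (rule log_term_pos[OF s_gt alpha n_ge[OF k]])
    have "4 / real (tau s \<alpha> (n k)) \<le> 4 / (log_term s \<alpha> (n k) / theta)"
      using divide_pos_pos[OF L theta_pos] tau_pos[OF s_gt alpha n_ge[OF k]]
      by (intro divide_left_mono mult_pos_pos tau_ge) auto
    then have t: "4 / real (tau s \<alpha> (n k)) \<le> 4 * theta / log_term s \<alpha> (n k)" by simp
    have "(\<integral>\<^sup>+ \<omega>. ennreal ((L2norm \<rho> (\<lambda>x. u x - uC \<psi> (n k) (msamp s \<alpha> (n k)) \<omega> u x))^2) \<partial>P)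
      \<le> ennreal ((1 + 4 / real (tau s \<alpha> (n k))) * (best_err \<rho> \<psi> (n k) u)\<^sup>2
         + PP.prob {\<omega> \<in> space P. \<not> good k \<omega>} * (L2norm \<rho> u)\<^sup>2)"
      using stratified_sampling.expected_error[OF loc[OF k] u] unfolding good_eq[OF k] PN msamp_def .
    also have "\<dots> \<le> ennreal ((1 + 4 * theta / log_term s \<alpha> (n k)) * (best_err \<rho> \<psi> (n k) u)^2 + \<alpha> * (L2norm \<rho> u)^2)"
      using t bad_le_alpha[OF k] by (intro ennreal_leI add_mono mult_right_mono) auto
    finally show ?thesis by (simp only: log_term_def)
  qed
  show ?thesis using part1 part2 unfolding good_def by blast
qed

end
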